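(* Let $1<q<+\infty$ and $g\in\mathcal{B}$. The following assertions are equivalent: (1) $T_g: RM(1,q)\rightarrow RM(1,q)$ is weakly compact. (2) $T_g: RM(1,q)\rightarrow RM(1,1)$ is compact. (3) $T_g: RM(1,q)\rightarrow RM(1,1)$ is weakly compact. (4) $T_g: RM(1,q)\rightarrow RM(1,1)$ does not fix a copy of $\ell^1$. (5) $T_g: RM(1,q)\rightarrow RM(1,q)$ does not fix a copy of $\ell^1$.
   Context: $\mathbb{D}$ is the open unit disc of $\mathbb{C}$ and $\mathcal{H}(\mathbb{D})$ the space of analytic functions on $\mathbb{D}$. For $1\leq q<+\infty$, $RM(1,q)=\{f\in\mathcal{H}(\mathbb{D}):\rho_{1,q}(f)<+\infty\}$, a Banach space with norm $$\rho_{1,q}(f)=\Big(\frac{1}{2\pi}\int_0^{2\pi}\Big(\int_0^1|f(re^{it})|\,dr\Big)^{q}dt\Big)^{1/q}.$$ The Bloch space $\mathcal{B}$ is the set of $f\in\mathcal{H}(\mathbb{D})$ with $\sup_{z\in\mathbb{D}}(1-|z|^2)|f'(z)|<+\infty$. The integration operator is $T_g(f)(z)=\int_0^z f(w)g'(w)\,dw$, $z\in\mathbb{D}$; for $g\in\mathcal{B}$ it is bounded on $RM(1,q)\subset RM(1,1)$. A bounded operator $T:X\to Y$ between Banach spaces fixes a copy of a Banach space $E$ if there is a closed subspace $M\subset X$ isomorphic to $E$ such that $T|_M$ is an isomorphism onto its image. *)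

theory Defs
  imports "HOL-Complex_Analysis.Complex_Analysis"
begin

section \<open>Normed spaces of complex-valued functions\<close>

text \<open>
  A complex normed space is represented by a carrier set of functions with values in the complex
  numbers, closed under the pointwise vector operations, together with a norm that is
  meaningful on the carrier only.
\<close>

record 'a fspace =
  carr :: "('a \<Rightarrow> complex) set"
  nrm :: "('a \<Rightarrow> complex) \<Rightarrow> real"

definition norm_topology :: "'a fspace \<Rightarrow> ('a \<Rightarrow> complex) topology" where
  "norm_topology X = Metric_space.mtopology (carr X) (\<lambda>f g. nrm X (\<lambda>x. f x - g x))"

definition dual_space :: "'a fspace \<Rightarrow> (('a \<Rightarrow> complex) \<Rightarrow> complex) set" where
  "dual_space X = {\<phi>.
     (\<forall>f\<in>carr X. \<forall>g\<in>carr X. \<forall>a b. \<phi> (\<lambda>x. a * f x + b * g x) = a * \<phi> f + b * \<phi> g) \<and>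
     (\<exists>C. \<forall>f\<in>carr X. norm (\<phi> f) \<le> C * nrm X f)}"

definition weak_topology :: "'a fspace \<Rightarrow> ('a \<Rightarrow> complex) topology" where
  "weak_topology X =
     topology_generated_by {{f \<in> carr X. \<phi> f \<in> U} |\<phi> U. \<phi> \<in> dual_space X \<and> open U}"

definition unit_ball :: "'a fspace \<Rightarrow> ('a \<Rightarrow> complex) set" where
  "unit_ball X = {f \<in> carr X. nrm X f \<le> 1}"

definition bounded_operator ::
    "'a fspace \<Rightarrow> 'b fspace \<Rightarrow> (('a \<Rightarrow> complex) \<Rightarrow> ('b \<Rightarrow> complex)) \<Rightarrow> bool" where
  "bounded_operator X Y T \<longleftrightarrow>
     T ` carr X \<subseteq> carr Y \<and>
     (\<forall>f\<in>carr X. \<forall>g\<in>carr X. \<forall>a b.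
        T (\<lambda>x. a * f x + b * g x) = (\<lambda>y. a * T f y + b * T g y)) \<and>
     (\<exists>C. \<forall>f\<in>carr X. nrm Y (T f) \<le> C * nrm X f)"

definition compact_operator ::
    "'a fspace \<Rightarrow> 'b fspace \<Rightarrow> (('a \<Rightarrow> complex) \<Rightarrow> ('b \<Rightarrow> complex)) \<Rightarrow> bool" where
  "compact_operator X Y T \<longleftrightarrow> bounded_operator X Y T \<and>
     compactin (norm_topology Y) (norm_topology Y closure_of (T ` unit_ball X))"

definition weakly_compact_operator ::
    "'a fspace \<Rightarrow> 'b fspace \<Rightarrow> (('a \<Rightarrow> complex) \<Rightarrow> ('b \<Rightarrow> complex)) \<Rightarrow> bool" where
  "weakly_compact_operator X Y T \<longleftrightarrow> bounded_operator X Y T \<and>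
     compactin (weak_topology Y) (weak_topology Y closure_of (T ` unit_ball X))"

definition isomorphism ::
    "'a fspace \<Rightarrow> 'b fspace \<Rightarrow> (('a \<Rightarrow> complex) \<Rightarrow> ('b \<Rightarrow> complex)) \<Rightarrow> bool" where
  "isomorphism X Y J \<longleftrightarrow> bounded_operator X Y J \<and> bij_betw J (carr X) (carr Y) \<and>
     bounded_operator Y X (inv_into (carr X) J)"

definition closed_subspace :: "'a fspace \<Rightarrow> ('a \<Rightarrow> complex) set \<Rightarrow> bool" where
  "closed_subspace X M \<longleftrightarrow> M \<noteq> {} \<and>
     (\<forall>f\<in>M. \<forall>g\<in>M. \<forall>a b. (\<lambda>x. a * f x + b * g x) \<in> M) \<and>
     closedin (norm_topology X) M"

definition fixes_copy ::
    "'a fspace \<Rightarrow> 'b fspace \<Rightarrow> 'c fspace \<Rightarrow> (('a \<Rightarrow> complex) \<Rightarrow> ('b \<Rightarrow> complex)) \<Rightarrow> bool" where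
  "fixes_copy X Y E T \<longleftrightarrow> bounded_operator X Y T \<and>
     (\<exists>M. closed_subspace X M \<and>
          (\<exists>J. isomorphism E (X\<lparr>carr := M\<rparr>) J) \<and>
          isomorphism (X\<lparr>carr := M\<rparr>) (Y\<lparr>carr := T ` M\<rparr>) T)"

definition ell1 :: "nat fspace" where
  "ell1 = \<lparr>carr = {a. summable (\<lambda>n. norm (a n))}, nrm = (\<lambda>a. \<Sum>n. norm (a n))\<rparr>"


section \<open>Average radial integrability spaces and the integration operator\<close>

definition epowr :: "ennreal \<Rightarrow> real \<Rightarrow> ennreal" where
  "epowr x p = (if x = top then top else ennreal (enn2real x powr p))"

text \<open>The quantity \<open>\<rho>\<^bsub>1,q\<^esub>(f)\<close>, possibly infinite.\<close>

definition RM_rho :: "real \<Rightarrow> (complex \<Rightarrow> complex) \<Rightarrow> ennreal" where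
  "RM_rho q f = epowr (ennreal (1 / (2 * pi)) *
     (\<integral>\<^sup>+t\<in>{0..2*pi}.
        epowr (\<integral>\<^sup>+r\<in>{0..<1}. ennreal (norm (f (of_real r * cis t))) \<partial>lborel) q \<partial>lborel)) (1 / q)"

text \<open>
  A function on the unit disc is represented by its extension by \<open>0\<close> to the whole plane, so that
  distinct elements of the carrier are distinct functions on the disc.
\<close>

definition RM :: "real \<Rightarrow> complex fspace" where
  "RM q = \<lparr>carr = {f. f holomorphic_on ball 0 1 \<and> (\<forall>z. z \<notin> ball 0 1 \<longrightarrow> f z = 0) \<and> RM_rho q f < top},
           nrm = (\<lambda>f. enn2real (RM_rho q f))\<rparr>"

definition Bloch :: "(complex \<Rightarrow> complex) set" where
  "Bloch = {f. f holomorphic_on ball 0 1 \<and>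
     bdd_above ((\<lambda>z. (1 - (norm z)\<^sup>2) * norm (deriv f z)) ` ball 0 1)}"

text \<open>The path of integration is the segment from \<open>0\<close> to \<open>z\<close>.\<close>

definition T_op :: "(complex \<Rightarrow> complex) \<Rightarrow> (complex \<Rightarrow> complex) \<Rightarrow> (complex \<Rightarrow> complex)" where
  "T_op g f = (\<lambda>z. if z \<in> ball 0 1
     then contour_integral (linepath 0 z) (\<lambda>w. f w * deriv g w) else 0)"

end

theory Submission
  imports Defs
begin

text \<open>
  Everything rests on a dichotomy for bounded sequences \<open>u\<^sub>n\<close> in \<open>RM q\<close> that tend to \<open>0\<close> locally
  uniformly. If \<open>T_op g u\<^sub>n\<close> does not tend to \<open>0\<close> in \<open>RM 1\<close>, a subsequence of these images lives
  essentially on disjoint annuli, hence is equivalent to the unit vector basis of \<open>\<ell>\<^sup>1\<close>, and since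
  the \<open>u\<^sub>n\<close> are bounded the operator fixes a copy of \<open>\<ell>\<^sup>1\<close>. Otherwise Montel's theorem and
  Fatou's lemma make the image of the unit ball compact in \<open>RM 1\<close>. On bounded subsets of \<open>RM q\<close> with
  \<open>q > 1\<close> the norm topology of \<open>RM 1\<close> is finer than the weak topology of \<open>RM q\<close>, because almost
  disjoint functions add up in \<open>L\<^sup>q\<close> with norm of order \<open>N\<^sup>1\<^sup>/\<^sup>q = o(N)\<close>; so the same image is
  weakly compact in \<open>RM q\<close>. Conversely a weakly compact operator fixes no copy of \<open>\<ell>\<^sup>1\<close>, by
  Hahn--Banach. Boundedness of \<open>T_op g\<close> holds already on each radius, by Tonelli and
  \<open>(1 - |z|) |g'(z)| \<le> K\<close>.
\<close>

section \<open>Normed function spaces and the Hahn--Banach theorem\<close>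

text \<open>Neither dual space is described concretely, and weak compactness is handled without
  sequences. Two devices make up for this. To obtain weak compactness, a set that is compact for a
  metric is carried over by an identity map shown to be continuous on it. To refute it, a cluster
  point of the unit vectors is tested by functionals defined only on a small subspace and extended.
  The disjoint annuli come from two kinds of smallness: a locally uniformly null sequence has little
  mass near the centre once the index is large, while one integrable function has little mass near
  the unit circle. Radii and indices are therefore chosen alternately. The two targets are linked by
  the inequality between their norms: a lower bound for \<open>T_op g\<close> on a subspace in the
  smaller norm of \<open>RM 1\<close> is one in the norm of \<open>RM q\<close>, so a single copy of
  the sequence space serves both. The hypothesis \<open>1 < q\<close> is used on the way from the
  absence of such a copy to weak compactness in \<open>RM q\<close>.\<close>

locale normed_fspace =
  fixes X :: "'a fspace"
  assumes zero_mem: "(\<lambda>_. 0) \<in> carr X"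
    and lincomb: "f \<in> carr X \<Longrightarrow> g \<in> carr X \<Longrightarrow> (\<lambda>x. a * f x + b * g x) \<in> carr X"
    and nrm_nonneg: "0 \<le> nrm X f"
    and nrm_diff_commute: "nrm X (\<lambda>x. f x - g x) = nrm X (\<lambda>x. g x - f x)"
    and nrm_triangle: "f \<in> carr X \<Longrightarrow> g \<in> carr X \<Longrightarrow> nrm X (\<lambda>x. f x + g x) \<le> nrm X f + nrm X g"
    and nrm_scale: "f \<in> carr X \<Longrightarrow> nrm X (\<lambda>x. a * f x) = norm a * nrm X f"
    and nrm_eq_0D: "f \<in> carr X \<Longrightarrow> nrm X f = 0 \<Longrightarrow> f = (\<lambda>_. 0)"
begin

lemma scale_mem: "f \<in> carr X \<Longrightarrow> (\<lambda>x. a * f x) \<in> carr X"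
  using lincomb[of f f a 0] by simp

lemma add_mem: "f \<in> carr X \<Longrightarrow> g \<in> carr X \<Longrightarrow> (\<lambda>x. f x + g x) \<in> carr X"
  using lincomb[of f g 1 1] by simp

lemma diff_mem: "f \<in> carr X \<Longrightarrow> g \<in> carr X \<Longrightarrow> (\<lambda>x. f x - g x) \<in> carr X"
  using lincomb[of f g 1 "-1"] by simp

lemma nrm_0: "nrm X (\<lambda>_. 0) = 0"
  using nrm_scale[OF zero_mem, of 0] by simp

text \<open>\<open>Metric_space\<close> asks for nonnegativity and symmetry at all pairs of
  functions, inside the carrier or not; this is why the locale states \<open>nrm_nonneg\<close> and
  \<open>nrm_diff_commute\<close> without membership.\<close>

lemma Metric_space_nrm: "Metric_space (carr X) (\<lambda>f g. nrm X (\<lambda>x. f x - g x))"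
proof
  show "nrm X (\<lambda>x. f x - g x) = 0 \<longleftrightarrow> f = g" if "f \<in> carr X" "g \<in> carr X" for f g
    using nrm_eq_0D[OF diff_mem[OF that]] nrm_0 by (auto simp: fun_eq_iff)
  show "nrm X (\<lambda>x. f x - h x) \<le> nrm X (\<lambda>x. f x - g x) + nrm X (\<lambda>x. g x - h x)"
    if "f \<in> carr X" "g \<in> carr X" "h \<in> carr X" for f g h
    using nrm_triangle[OF diff_mem[OF that(1,2)] diff_mem[OF that(2,3)]] by simp
qed (auto simp: nrm_nonneg intro: nrm_diff_commute)

text \<open>Partial real-linear functionals are encoded as graphs, so that extension is inclusion
  and Zorn's lemma acts on plain sets. Single-valuedness is a consequence: a value over the zero
  function is at most 0, and so is its negative.\<close>

definition dominated_graph :: "real \<Rightarrow> (('a \<Rightarrow> complex) \<times> real) set \<Rightarrow> bool" where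
  "dominated_graph C G \<longleftrightarrow>
     (\<forall>(f, a)\<in>G. f \<in> carr X \<and> a \<le> C * nrm X f) \<and>
     (\<forall>(f, a)\<in>G. \<forall>(g, b)\<in>G. \<forall>r s. (\<lambda>x. of_real r * f x + of_real s * g x, r * a + s * b) \<in> G)"

lemma dominated_graphD:
  assumes "dominated_graph C G"
  shows "(f, a) \<in> G \<Longrightarrow> f \<in> carr X" and "(f, a) \<in> G \<Longrightarrow> a \<le> C * nrm X f"
    and "(f, a) \<in> G \<Longrightarrow> (g, b) \<in> G \<Longrightarrow>
         (\<lambda>x. of_real r * f x + of_real s * g x, r * a + s * b) \<in> G"
  using assms unfolding dominated_graph_def by blast+

text \<open>The value at \<open>h\<close> must lie above every
  \<open>a - C * nrm X (\<lambda>x. f x - h x)\<close> and below every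
  \<open>C * nrm X (\<lambda>x. g x + h x) - b\<close>; \<open>key\<close> says that this interval
  is nonempty, and \<open>c\<close> is its lower end. If \<open>h\<close> is already in the domain
  the two ends coincide, so no case distinction arises.\<close>

lemma dominated_graph_extend:
  assumes G: "dominated_graph C G" "(\<lambda>_. 0, 0) \<in> G" and h: "h \<in> carr X" and C: "0 \<le> C"
  obtains G' c where "dominated_graph C G'" "G \<subseteq> G'" "(h, c) \<in> G'"
proof -
  note D = dominated_graphD[OF G(1)]
  have key: "a - C * nrm X (\<lambda>x. f x - h x) \<le> C * nrm X (\<lambda>x. g x + h x) - b"
    if "(f, a) \<in> G" "(g, b) \<in> G" for f a g b
  proof -
    have m: "f \<in> carr X" "g \<in> carr X" using D(1) that by blast+
    have "(\<lambda>x. f x + g x, a + b) \<in> G" using D(3)[OF that, of 1 1] by simp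
    hence "a + b \<le> C * nrm X (\<lambda>x. f x + g x)" by (rule D(2))
    also have "\<dots> \<le> C * (nrm X (\<lambda>x. f x - h x) + nrm X (\<lambda>x. g x + h x))"
      using nrm_triangle[OF diff_mem[OF m(1) h] add_mem[OF m(2) h]] C
      by (intro mult_left_mono) (auto simp: algebra_simps)
    finally show ?thesis by (simp add: algebra_simps)
  qed
  define c where "c = (SUP (f, a)\<in>G. a - C * nrm X (\<lambda>x. f x - h x))"
  have bdd: "bdd_above ((\<lambda>(f, a). a - C * nrm X (\<lambda>x. f x - h x)) ` G)"
    using key[OF _ G(2)] unfolding bdd_above_def by (auto intro!: exI[of _ "C * nrm X h"])
  have c1: "a - C * nrm X (\<lambda>x. f x - h x) \<le> c" if "(f, a) \<in> G" for f a
    unfolding c_def using cSUP_upper[OF that bdd] by simp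
  have c2: "c \<le> C * nrm X (\<lambda>x. f x + h x) - a" if "(f, a) \<in> G" for f a
    unfolding c_def using G(2) key[OF _ that] by (intro cSUP_least) auto
  define G' where "G' = {(\<lambda>x. f x + of_real s * h x, a + s * c) | f a s. (f, a) \<in> G}"
  \<comment> \<open>Dividing by |s| leaves the coefficient 1 or -1 at \<open>h\<close>, which is
    covered by \<open>c2\<close> or \<open>c1\<close>.\<close>
  have dom: "a + s * c \<le> C * nrm X (\<lambda>x. f x + of_real s * h x)" if fa: "(f, a) \<in> G" for f a s
  proof -
    have f: "f \<in> carr X" using D(1) fa by blast
    consider "s = 0" | "s > 0" | "s < 0" by linarith
    thus ?thesis
    proof cases
      case 1 thus ?thesis using D(2)[OF fa] by simp
    next
      case 2
      have "(\<lambda>x. of_real (1 / s) * f x, a / s) \<in> G"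
        using D(3)[OF fa fa, of "1/s" 0] by simp
      from c2[OF this] have "s * c \<le> s * (C * nrm X (\<lambda>x. of_real (1 / s) * f x + h x) - a / s)"
        using 2 by (intro mult_left_mono) auto
      also have "\<dots> = C * (s * nrm X (\<lambda>x. of_real (1 / s) * f x + h x)) - a"
        using 2 by (simp add: field_simps)
      also have "s * nrm X (\<lambda>x. of_real (1 / s) * f x + h x) = nrm X (\<lambda>x. f x + of_real s * h x)"
        using nrm_scale[OF add_mem[OF scale_mem[OF f] h], of "of_real s" "of_real (1/s)"] 2
        by (simp add: algebra_simps)
      finally show ?thesis by simp
    next
      case 3
      define t where "t = - s"
      have t: "t > 0" using 3 by (simp add: t_def)
      have "(\<lambda>x. of_real (1 / t) * f x, a / t) \<in> G"
        using D(3)[OF fa fa, of "1/t" 0] by simp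
      from c1[OF this] have "t * (a / t - C * nrm X (\<lambda>x. of_real (1 / t) * f x - h x)) \<le> t * c"
        using t by (intro mult_left_mono) auto
      moreover have "t * nrm X (\<lambda>x. of_real (1 / t) * f x - h x) = nrm X (\<lambda>x. f x - of_real t * h x)"
        using nrm_scale[OF diff_mem[OF scale_mem[OF f] h], of "of_real t" "of_real (1/t)"] t
        by (simp add: algebra_simps)
      moreover have "t * (a / t - N) = a - t * N" for N using t by (simp add: field_simps)
      ultimately have "a - C * nrm X (\<lambda>x. f x - of_real t * h x) \<le> t * c"
        by (metis mult.left_commute)
      thus ?thesis by (simp add: t_def)
    qed
  qed
  have "dominated_graph C G'"
    unfolding dominated_graph_def
  proof (intro conjI ballI allI, safe)
    fix f a assume "(f, a) \<in> G'"
    then obtain f' a' s where *: "(f', a') \<in> G" "f = (\<lambda>x. f' x + of_real s * h x)" "a = a' + s * c"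
      by (auto simp: G'_def)
    show "f \<in> carr X" using add_mem[OF D(1)[OF *(1)] scale_mem[OF h]] *(2) by simp
    show "a \<le> C * nrm X f" using dom[OF *(1)] * by simp
  next
    fix f a g b and r s :: real assume "(f, a) \<in> G'" "(g, b) \<in> G'"
    then obtain f' a' s1 g' b' s2 where *: "(f', a') \<in> G" "f = (\<lambda>x. f' x + of_real s1 * h x)" "a = a' + s1 * c"
      "(g', b') \<in> G" "g = (\<lambda>x. g' x + of_real s2 * h x)" "b = b' + s2 * c"
      by (auto simp: G'_def)
    show "(\<lambda>x. of_real r * f x + of_real s * g x, r * a + s * b) \<in> G'"
      unfolding G'_def using D(3)[OF *(1,4), of r s] *
      by (intro CollectI exI[of _ "\<lambda>x. of_real r * f' x + of_real s * g' x"]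
            exI[of _ "r * a' + s * b'"] exI[of _ "r * s1 + s * s2"])
         (auto simp: algebra_simps fun_eq_iff)
  qed
  moreover have "G \<subseteq> G'"
  proof safe
    fix f a assume "(f, a) \<in> G"
    thus "(f, a) \<in> G'" unfolding G'_def by (intro CollectI exI[of _ f] exI[of _ a] exI[of _ 0]) auto
  qed
  moreover have "(h, c) \<in> G'"
    unfolding G'_def using G(2) by (intro CollectI exI[of _ "\<lambda>_. 0"] exI[of _ 0] exI[of _ 1]) auto
  ultimately show thesis using that by blast
qed

lemma real_hahn_banach:
  assumes G: "dominated_graph C G" "(\<lambda>_. 0, 0) \<in> G" and C: "0 \<le> C"
  obtains u where "\<And>f a. (f, a) \<in> G \<Longrightarrow> u f = a"
    and "\<And>f. f \<in> carr X \<Longrightarrow> u f \<le> C * nrm X f"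
    and "\<And>f g r s. f \<in> carr X \<Longrightarrow> g \<in> carr X \<Longrightarrow>
           u (\<lambda>x. of_real r * f x + of_real s * g x) = r * u f + s * u g"
proof -
  define \<A> where "\<A> = {H. dominated_graph C H \<and> G \<subseteq> H}"
  have "\<exists>M\<in>\<A>. \<forall>H\<in>\<A>. M \<subseteq> H \<longrightarrow> H = M"
  proof (rule subset_Zorn_nonempty)
    show "\<A> \<noteq> {}" using G by (auto simp: \<A>_def)
    fix \<C> assume \<C>: "\<C> \<noteq> {}" "subset.chain \<A> \<C>"
    hence sub: "\<C> \<subseteq> \<A>" and tot: "H \<in> \<C> \<Longrightarrow> K \<in> \<C> \<Longrightarrow> H \<subseteq> K \<or> K \<subseteq> H" for H K
      by (auto simp: subset_chain_def)
    have "dominated_graph C (\<Union>\<C>)"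
      unfolding dominated_graph_def
    proof (intro conjI ballI allI, safe)
      fix f a H assume "H \<in> \<C>" "(f, a) \<in> H"
      moreover from this sub have "dominated_graph C H" by (auto simp: \<A>_def)
      ultimately show "f \<in> carr X" "a \<le> C * nrm X f" using dominated_graphD by blast+
    next
      fix f a g b H K and r s :: real
      assume *: "H \<in> \<C>" "(f, a) \<in> H" "K \<in> \<C>" "(g, b) \<in> K"
      then obtain L where "L \<in> \<C>" "(f, a) \<in> L" "(g, b) \<in> L" using tot[OF *(1,3)] by blast
      moreover from this sub have "dominated_graph C L" by (auto simp: \<A>_def)
      ultimately show "(\<lambda>x. of_real r * f x + of_real s * g x, r * a + s * b) \<in> \<Union>\<C>"
        using dominated_graphD(3) by blast
    qed
    moreover have "G \<subseteq> \<Union>\<C>" using \<C>(1) sub by (auto simp: \<A>_def)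
    ultimately show "\<Union>\<C> \<in> \<A>" by (simp add: \<A>_def)
  qed
  then obtain M where M: "dominated_graph C M" "G \<subseteq> M"
    and max: "\<And>H. dominated_graph C H \<Longrightarrow> G \<subseteq> H \<Longrightarrow> M \<subseteq> H \<Longrightarrow> H = M"
    by (auto simp: \<A>_def)
  have M0: "(\<lambda>_. 0, 0) \<in> M" using G M by blast
  note D = dominated_graphD[OF M(1)]
  have total: "\<exists>c. (h, c) \<in> M" if h: "h \<in> carr X" for h
  proof -
    obtain G' c where "dominated_graph C G'" "M \<subseteq> G'" "(h, c) \<in> G'"
      using dominated_graph_extend[OF M(1) M0 h C] by blast
    thus ?thesis using max[of G'] M(2) by blast
  qed
  have zero: "a = 0" if "(\<lambda>_. 0, a) \<in> M" for a
  proof -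
    have "a \<le> 0" using D(2)[OF that] nrm_0 by simp
    moreover have "- a \<le> 0" using D(2)[OF D(3)[OF that that, of "-1" 0]] nrm_0 by simp
    ultimately show ?thesis by simp
  qed
  have uniq: "a = b" if "(f, a) \<in> M" "(f, b) \<in> M" for f a b
    using zero[of "a - b"] D(3)[OF that, of 1 "-1"] by simp
  define u where "u f = (THE a. (f, a) \<in> M)" for f
  have u: "u f = a" if "(f, a) \<in> M" for f a
    unfolding u_def using that uniq by blast
  have u': "(f, u f) \<in> M" if "f \<in> carr X" for f
    using total[OF that] u by blast
  show thesis
  proof (rule that[of u])
    show "u f = a" if "(f, a) \<in> G" for f a using u M(2) that by blast
    show "u f \<le> C * nrm X f" if "f \<in> carr X" for f using D(2)[OF u'[OF that]] .
    show "u (\<lambda>x. of_real r * f x + of_real s * g x) = r * u f + s * u g"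
      if "f \<in> carr X" "g \<in> carr X" for f g r s
      using u[OF D(3)[OF u'[OF that(1)] u'[OF that(2)]]] .
  qed
qed

text \<open>The functional to be extended is given by its graph: the bound forces \<open>G\<close> to be single-valued.\<close>

lemma hahn_banach:
  fixes G :: "(('a \<Rightarrow> complex) \<times> complex) set"
  assumes zero: "(\<lambda>_. 0, 0) \<in> G" and C: "0 \<le> C"
    and dom: "\<And>f a. (f, a) \<in> G \<Longrightarrow> f \<in> carr X \<and> norm a \<le> C * nrm X f"
    and lin: "\<And>f a g b r s. (f, a) \<in> G \<Longrightarrow> (g, b) \<in> G \<Longrightarrow>
                (\<lambda>x. r * f x + s * g x, r * a + s * b) \<in> G"
  obtains \<phi> where "\<phi> \<in> dual_space X" and "\<And>f a. (f, a) \<in> G \<Longrightarrow> \<phi> f = a"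
    and "\<And>f. f \<in> carr X \<Longrightarrow> norm (\<phi> f) \<le> C * nrm X f"
proof -
  define H where "H = {(f, Re a) | f a. (f, a) \<in> G}"
  have "dominated_graph C H"
    unfolding dominated_graph_def
  proof (intro conjI ballI allI, safe)
    fix f a assume "(f, a) \<in> H"
    then obtain b where b: "(f, b) \<in> G" "a = Re b" by (auto simp: H_def)
    show "f \<in> carr X" using dom b by blast
    show "a \<le> C * nrm X f" using dom[OF b(1)] complex_Re_le_cmod[of b] b(2) by simp
  next
    fix f a g b and r s :: real assume "(f, a) \<in> H" "(g, b) \<in> H"
    then obtain a' b' where *: "(f, a') \<in> G" "a = Re a'" "(g, b') \<in> G" "b = Re b'" by (auto simp: H_def)
    show "(\<lambda>x. of_real r * f x + of_real s * g x, r * a + s * b) \<in> H"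
      unfolding H_def using lin[OF *(1,3), of "of_real r" "of_real s"] *(2,4)
      by (intro CollectI exI[of _ "\<lambda>x. of_real r * f x + of_real s * g x"]
            exI[of _ "of_real r * a' + of_real s * b'"]) auto
  qed
  moreover have "(\<lambda>_. 0, 0) \<in> H" unfolding H_def using zero by force
  ultimately obtain u where u: "\<And>f a. (f, a) \<in> H \<Longrightarrow> u f = a"
    and ub: "\<And>f. f \<in> carr X \<Longrightarrow> u f \<le> C * nrm X f"
    and ul: "\<And>f g r s. f \<in> carr X \<Longrightarrow> g \<in> carr X \<Longrightarrow>
           u (\<lambda>x. of_real r * f x + of_real s * g x) = r * u f + s * u g"
    using real_hahn_banach[OF _ _ C, of H] by blast
  \<comment> \<open>\<open>H\<close> keeps only real parts. A complex-linear functional with real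
    part \<open>u\<close> has imaginary part -u(i f), so the formula is forced.\<close>
  define \<phi> where "\<phi> f = Complex (u f) (- u (\<lambda>x. \<i> * f x))" for f
  have u_scale: "u (\<lambda>x. a * f x) = Re a * u f + Im a * u (\<lambda>x. \<i> * f x)" if "f \<in> carr X" for f a
  proof -
    have "(\<lambda>x. a * f x) = (\<lambda>x. of_real (Re a) * f x + of_real (Im a) * (\<i> * f x))"
      by (rule ext, subst complex_eq[of a]) (simp add: algebra_simps)
    thus ?thesis using ul[OF that scale_mem[OF that], of "Re a" "Im a" \<i>] by simp
  qed
  have u_add: "u (\<lambda>x. f x + g x) = u f + u g" if "f \<in> carr X" "g \<in> carr X" for f g
    using ul[OF that, of 1 1] by simp
  have \<phi>_scale: "\<phi> (\<lambda>x. a * f x) = a * \<phi> f" if f: "f \<in> carr X" for a f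
    using u_scale[OF f, of a] u_scale[OF f, of "\<i> * a"]
    by (simp add: \<phi>_def complex_eq_iff mult.assoc)
  have \<phi>_add: "\<phi> (\<lambda>x. f x + g x) = \<phi> f + \<phi> g" if f: "f \<in> carr X" "g \<in> carr X" for f g
    using u_add[OF f] u_add[OF scale_mem[OF f(1), of \<i>] scale_mem[OF f(2), of \<i>]]
    by (simp add: \<phi>_def complex_eq_iff distrib_left)
  have \<phi>_lin: "\<phi> (\<lambda>x. a * f x + b * g x) = a * \<phi> f + b * \<phi> g"
    if f: "f \<in> carr X" "g \<in> carr X" for f g a b
    using \<phi>_add[OF scale_mem[OF f(1)] scale_mem[OF f(2)]] \<phi>_scale f by simp
  have \<phi>_bound: "norm (\<phi> f) \<le> C * nrm X f" if f: "f \<in> carr X" for f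
  proof (cases "\<phi> f = 0")
    case True thus ?thesis using C nrm_nonneg by simp
  next
    case False
    \<comment> \<open>Rotation by \<open>c\<close> makes the value real and nonnegative; there it
      coincides with \<open>u\<close>, and the one-sided bound controls the modulus.\<close>
    define c where "c = of_real (norm (\<phi> f)) / \<phi> f"
    have nc: "norm c = 1" using False by (simp add: c_def norm_divide)
    have "\<phi> (\<lambda>x. c * f x) = of_real (norm (\<phi> f))" unfolding \<phi>_scale[OF f] using False by (simp add: c_def)
    hence "u (\<lambda>x. c * f x) = norm (\<phi> f)" by (simp add: \<phi>_def complex_eq_iff)
    thus ?thesis using ub[OF scale_mem[OF f], of c] nrm_scale[OF f, of c] nc by simp
  qed
  have \<phi>_G: "\<phi> f = a" if fa: "(f, a) \<in> G" for f a
  proof -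
    have "(f, Re a) \<in> H" using fa by (auto simp: H_def)
    moreover have "(\<lambda>x. \<i> * f x, - Im a) \<in> H"
      using lin[OF fa fa, of \<i> 0] by (force simp: H_def)
    ultimately show ?thesis using u by (simp add: \<phi>_def complex_eq_iff)
  qed
  have "\<phi> \<in> dual_space X" unfolding dual_space_def using \<phi>_lin \<phi>_bound by blast
  thus thesis using that \<phi>_G \<phi>_bound by blast
qed

end


section \<open>Weak topologies\<close>

lemma topspace_weak_topology: "topspace (weak_topology X) = carr X"
proof -
  have "(\<lambda>_. 0) \<in> dual_space X"
    unfolding dual_space_def by (auto intro!: exI[of _ 0])
  hence "carr X \<in> {{f \<in> carr X. \<phi> f \<in> U} |\<phi> U. \<phi> \<in> dual_space X \<and> open U}"
    by (intro CollectI exI[of _ "\<lambda>_. 0"] exI[of _ UNIV]) auto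
  thus ?thesis unfolding weak_topology_def topology_generated_by_topspace by blast
qed

lemma continuous_map_dual:
  assumes "\<phi> \<in> dual_space X"
  shows "continuous_map (weak_topology X) euclidean \<phi>"
  unfolding continuous_map topspace_weak_topology
proof (intro conjI allI impI)
  fix U :: "complex set" assume "openin euclidean U"
  hence "{f \<in> carr X. \<phi> f \<in> U} \<in> {{f \<in> carr X. \<phi> f \<in> U} |\<phi> U. \<phi> \<in> dual_space X \<and> open U}"
    using assms by auto
  thus "openin (weak_topology X) {f \<in> carr X. \<phi> f \<in> U}"
    unfolding weak_topology_def by (rule topology_generated_by_Basis)
qed auto

lemma continuous_map_weak_topologyI:
  assumes "F ` topspace Z \<subseteq> carr X"
    and "\<And>\<phi>. \<phi> \<in> dual_space X \<Longrightarrow> continuous_map Z euclidean (\<lambda>z. \<phi> (F z))"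
  shows "continuous_map Z (weak_topology X) F"
  unfolding weak_topology_def
proof (rule continuous_on_generated_topo)
  show "F ` topspace Z \<subseteq> \<Union> {{f \<in> carr X. \<phi> f \<in> U} |\<phi> U. \<phi> \<in> dual_space X \<and> open U}"
    using assms(1) topspace_weak_topology[of X]
    unfolding weak_topology_def topology_generated_by_topspace by simp
  fix V assume "V \<in> {{f \<in> carr X. \<phi> f \<in> U} |\<phi> U. \<phi> \<in> dual_space X \<and> open U}"
  then obtain \<phi> U where V: "V = {f \<in> carr X. \<phi> f \<in> U}" "\<phi> \<in> dual_space X" "open U" by blast
  have "F -` V \<inter> topspace Z = {z \<in> topspace Z. \<phi> (F z) \<in> U}" using assms(1) V(1) by auto
  thus "openin Z (F -` V \<inter> topspace Z)"
    using assms(2)[OF V(2)] V(3) by (simp add: continuous_map)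
qed

text \<open>Relative compactness thus follows from any compact superset. The Hausdorff property
  makes that superset closed, which is why it is established for the weak topology.\<close>

lemma compactin_closure_of_subset:
  assumes "Hausdorff_space Z" "compactin Z K" "S \<subseteq> K"
  shows "compactin Z (Z closure_of S)"
  using assms by (meson closed_compactin closedin_closure_of closure_of_minimal compactin_imp_closedin)

context normed_fspace
begin

text \<open>Hahn-Banach extends the functional on the line through \<open>h\<close>, the difference
  of \<open>f\<close> and \<open>g\<close>, whose value at \<open>h\<close> is
  \<open>nrm X h\<close>. Its values at \<open>f\<close> and \<open>g\<close> then differ, and
  disjoint neighbourhoods in the plane are pulled back.\<close>

lemma Hausdorff_weak_topology: "Hausdorff_space (weak_topology X)"
  unfolding Hausdorff_space_def topspace_weak_topology
proof (intro allI impI, elim conjE)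
  fix f g assume fg: "f \<in> carr X" "g \<in> carr X" "f \<noteq> g"
  define h where "h = (\<lambda>x. f x - g x)"
  have h: "h \<in> carr X" using diff_mem[OF fg(1,2)] by (simp add: h_def)
  have "nrm X h \<noteq> 0" using nrm_eq_0D[OF h] fg(3) by (auto simp: h_def fun_eq_iff)
  define G where "G = {(\<lambda>x. r * h x, r * of_real (nrm X h)) | r. True}"
  have memG: "(\<lambda>x. r * h x, r * of_real (nrm X h)) \<in> G" for r by (auto simp: G_def)
  obtain \<phi> where \<phi>: "\<phi> \<in> dual_space X" "\<And>f a. (f, a) \<in> G \<Longrightarrow> \<phi> f = a"
  proof (rule hahn_banach[of G 1])
    show "(\<lambda>_. 0, 0) \<in> G" using memG[of 0] by simp
    show "f \<in> carr X \<and> norm a \<le> 1 * nrm X f" if "(f, a) \<in> G" for f a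
      using that scale_mem[OF h] nrm_scale[OF h] nrm_nonneg[of h] by (auto simp: G_def norm_mult)
    show "(\<lambda>x. r * f x + s * g x, r * a + s * b) \<in> G" if "(f, a) \<in> G" "(g, b) \<in> G" for f a g b r s
    proof -
      obtain p q where "f = (\<lambda>x. p * h x)" "a = p * of_real (nrm X h)"
        "g = (\<lambda>x. q * h x)" "b = q * of_real (nrm X h)" using \<open>(f, a) \<in> G\<close> \<open>(g, b) \<in> G\<close> by (auto simp: G_def)
      thus ?thesis using memG[of "r * p + s * q"] by (simp add: algebra_simps)
    qed
  qed auto
  have "\<phi> h = of_real (nrm X h)" using \<phi>(2) memG[of 1] by simp
  moreover have "\<phi> h = \<phi> f - \<phi> g"
  proof -
    have "\<phi> (\<lambda>x. 1 * f x + (-1) * g x) = 1 * \<phi> f + (-1) * \<phi> g"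
      using \<phi>(1) fg(1,2) unfolding dual_space_def by blast
    thus ?thesis by (simp add: h_def)
  qed
  ultimately have "\<phi> f \<noteq> \<phi> g" using \<open>nrm X h \<noteq> 0\<close> by auto
  then obtain U V where UV: "open U" "open V" "\<phi> f \<in> U" "\<phi> g \<in> V" "U \<inter> V = {}"
    by (rule hausdorff[THEN exE]) blast
  have *: "openin (weak_topology X) {f \<in> carr X. \<phi> f \<in> W}" if "open W" for W
    using continuous_map_dual[OF \<phi>(1)] that by (auto simp: continuous_map topspace_weak_topology)
  show "\<exists>U V. openin (weak_topology X) U \<and> openin (weak_topology X) V \<and> f \<in> U \<and> g \<in> V \<and> disjnt U V"
  proof (intro exI conjI)
    show "disjnt {f \<in> carr X. \<phi> f \<in> U} {f \<in> carr X. \<phi> f \<in> V}"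
      using UV(5) unfolding disjnt_def by blast
  qed (use *[OF UV(1)] *[OF UV(2)] UV(3,4) fg in simp_all)
qed

lemma dual_diff:
  assumes "\<phi> \<in> dual_space X" "f \<in> carr X" "g \<in> carr X"
  shows "\<phi> (\<lambda>x. f x - g x) = \<phi> f - \<phi> g"
proof -
  have "\<phi> (\<lambda>x. 1 * f x + (-1) * g x) = 1 * \<phi> f + (-1) * \<phi> g"
    using assms unfolding dual_space_def by blast
  thus ?thesis by simp
qed

lemma topspace_norm_topology: "topspace (norm_topology X) = carr X"
  unfolding norm_topology_def using Metric_space.topspace_mtopology[OF Metric_space_nrm] .

lemma continuous_map_norm_weak: "continuous_map (norm_topology X) (weak_topology X) (\<lambda>f. f)"
proof (rule continuous_map_weak_topologyI)
  fix \<phi> assume \<phi>: "\<phi> \<in> dual_space X"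
  then obtain C where C: "\<And>f. f \<in> carr X \<Longrightarrow> norm (\<phi> f) \<le> C * nrm X f" unfolding dual_space_def by blast
  interpret M: Metric_space "carr X" "\<lambda>f g. nrm X (\<lambda>x. f x - g x)" by (rule Metric_space_nrm)
  show "continuous_map (norm_topology X) euclidean (\<lambda>f. \<phi> f)"
    unfolding norm_topology_def mtopology_is_euclidean[symmetric]
      M.metric_continuous_map[OF Met_TC.Metric_space_axioms]
  proof (intro conjI ballI allI impI)
    fix f and e :: real assume f: "f \<in> carr X" and e: "e > 0"
    show "\<exists>\<delta>>0. \<forall>g. g \<in> carr X \<and> nrm X (\<lambda>x. f x - g x) < \<delta> \<longrightarrow> dist (\<phi> f) (\<phi> g) < e"
    \<comment> \<open>The constant in \<open>dual_space\<close> has no prescribed sign;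
      \<open>\<bar>C\<bar> + 1\<close> is a positive substitute.\<close>
    proof (intro exI[of _ "e / (\<bar>C\<bar> + 1)"] conjI allI impI)
      fix g assume g: "g \<in> carr X \<and> nrm X (\<lambda>x. f x - g x) < e / (\<bar>C\<bar> + 1)"
      have "dist (\<phi> f) (\<phi> g) = norm (\<phi> (\<lambda>x. f x - g x))"
        using dual_diff[OF \<phi> f, of g] g by (simp add: dist_norm)
      also have "\<dots> \<le> C * nrm X (\<lambda>x. f x - g x)" using C diff_mem[OF f, of g] g by blast
      also have "\<dots> \<le> (\<bar>C\<bar> + 1) * nrm X (\<lambda>x. f x - g x)"
        using nrm_nonneg by (intro mult_right_mono) auto
      also have "\<dots> < (\<bar>C\<bar> + 1) * (e / (\<bar>C\<bar> + 1))" using g by (intro mult_strict_left_mono) auto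
      finally show "dist (\<phi> f) (\<phi> g) < e" by simp
    qed (use e in auto)
  qed auto
qed (simp add: topspace_norm_topology)

end

text \<open>The norm closure of the image is weakly compact under the continuous identity, hence
  weakly closed, hence contains the weak closure.\<close>

lemma compact_imp_weakly_compact_operator:
  assumes Y: "normed_fspace Y" and T: "compact_operator X Y T"
  shows "weakly_compact_operator X Y T"
proof -
  interpret normed_fspace Y by fact
  let ?K = "norm_topology Y closure_of (T ` unit_ball X)"
  have "compactin (weak_topology Y) ((\<lambda>f. f) ` ?K)"
    using T continuous_map_norm_weak by (intro image_compactin) (auto simp: compact_operator_def)
  moreover have "T ` unit_ball X \<subseteq> ?K"
    using T by (intro closure_of_subset)
      (auto simp: topspace_norm_topology compact_operator_def bounded_operator_def unit_ball_def)
  ultimately show ?thesis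
    using T Hausdorff_weak_topology compactin_closure_of_subset
    unfolding weakly_compact_operator_def compact_operator_def by auto
qed

lemma inv_into_linear:
  assumes lin: "\<And>f g a b. f \<in> A \<Longrightarrow> g \<in> A \<Longrightarrow> T (\<lambda>x. a * f x + b * g x) = (\<lambda>y. a * T f y + b * T g y)"
    and sub: "\<And>f g a b. f \<in> A \<Longrightarrow> g \<in> A \<Longrightarrow> (\<lambda>x. (a::complex) * f x + b * g x) \<in> A"
    and inj: "inj_on T A" and "u \<in> T ` A" "v \<in> T ` A"
  shows "inv_into A T (\<lambda>y. (a::complex) * u y + b * v y) = (\<lambda>x. a * inv_into A T u x + b * inv_into A T v x)"
proof -
  obtain f g where "f \<in> A" "g \<in> A" "u = T f" "v = T g" using assms(4,5) by blast
  thus ?thesis using lin[of f g a b, symmetric] sub[of f g a b] inj by simp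
qed

text \<open>Injectivity is a separate assumption because \<open>X\<close> is an arbitrary record
  here: the lower bound on norms alone does not separate points.\<close>

lemma isomorphismI:
  assumes T: "bounded_operator X Y T" and img: "T ` carr X = carr Y"
    and sub: "\<And>f g a b. f \<in> carr X \<Longrightarrow> g \<in> carr X \<Longrightarrow> (\<lambda>x. a * f x + b * g x) \<in> carr X"
    and below: "\<And>f. f \<in> carr X \<Longrightarrow> nrm X f \<le> C * nrm Y (T f)"
    and inj: "inj_on T (carr X)"
  shows "isomorphism X Y T"
proof -
  have lin: "T (\<lambda>x. a * f x + b * g x) = (\<lambda>y. a * T f y + b * T g y)" if "f \<in> carr X" "g \<in> carr X" for f g a b
    using T that unfolding bounded_operator_def by blast
  have "bounded_operator Y X (inv_into (carr X) T)"
    unfolding bounded_operator_def img[symmetric]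
  proof (intro conjI ballI allI)
    show "inv_into (carr X) T ` T ` carr X \<subseteq> carr X" using inj by auto
    show "\<exists>C. \<forall>f\<in>T ` carr X. nrm X (inv_into (carr X) T f) \<le> C * nrm Y f"
      using below inj by (intro exI[of _ C]) auto
  qed (use inv_into_linear[OF lin sub inj] in blast)
  thus ?thesis using T img inj by (auto simp: isomorphism_def bij_betw_def)
qed

lemma isomorphism_bounded_below:
  assumes "isomorphism X Y T"
  obtains C where "\<And>f. f \<in> carr X \<Longrightarrow> nrm X f \<le> C * nrm Y (T f)" 
proof -
  have bij: "bij_betw T (carr X) (carr Y)" using assms by (simp add: isomorphism_def)
  have "\<exists>C. \<forall>f\<in>carr Y. nrm X (inv_into (carr X) T f) \<le> C * nrm Y f"
    using assms by (simp add: isomorphism_def bounded_operator_def)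
  then obtain C where C: "\<And>f. f \<in> carr Y \<Longrightarrow> nrm X (inv_into (carr X) T f) \<le> C * nrm Y f"
    by blast
  have "nrm X f \<le> C * nrm Y (T f)" if "f \<in> carr X" for f
    using C[of "T f"] that bij by (auto simp: bij_betw_def)
  thus thesis using that by blast
qed

text \<open>The finite intersection property gives a cluster point of a sequence from its tails. In
  the weak topology this takes the place of a convergent subsequence.\<close>

lemma nest_compactin:
  fixes S :: "nat \<Rightarrow> 'a set"
  assumes K: "compactin Z K" and S: "\<And>n. S n \<noteq> {}" "\<And>n. S n \<subseteq> K" "decseq S"
  shows "\<exists>y. \<forall>n. y \<in> Z closure_of S n"
proof -
  have "K \<inter> \<Inter>(range (\<lambda>n. Z closure_of S n)) \<noteq> {}"
  proof (rule compactin_fip[THEN iffD1, THEN conjunct2, rule_format, OF K], intro conjI ballI allI impI)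
    fix \<F> assume \<F>: "finite \<F> \<and> \<F> \<subseteq> range (\<lambda>n. Z closure_of S n)"
    then obtain I where I: "finite I" "\<F> = (\<lambda>n. Z closure_of S n) ` I"
      by (metis finite_subset_image)
    obtain N where N: "\<forall>i\<in>I. i \<le> N" using I(1) finite_nat_set_iff_bounded_le by auto
    obtain y where y: "y \<in> S N" using S(1) by blast
    have "y \<in> Z closure_of S i" if "i \<in> I" for i
    proof -
      have "S i \<subseteq> topspace Z" using S(2)[of i] compactin_subset_topspace[OF K] by blast
      moreover have "y \<in> S i" using decseqD[OF S(3), of i N] N that y by blast
      ultimately show ?thesis using closure_of_subset by blast
    qed
    thus "K \<inter> \<Inter>\<F> \<noteq> {}" using I(2) y S(2) by blast
  qed auto
  thus ?thesis by blast
qed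


section \<open>Copies of the sequence space\<close>

lemma ell1_lincomb:
  "a \<in> carr ell1 \<Longrightarrow> b \<in> carr ell1 \<Longrightarrow> (\<lambda>n. r * a n + s * b n) \<in> carr ell1"
proof -
  assume "a \<in> carr ell1" "b \<in> carr ell1"
  hence "summable (\<lambda>n. norm r * norm (a n) + norm s * norm (b n))"
    by (intro summable_add summable_mult) (auto simp: ell1_def)
  hence "summable (\<lambda>n. norm (r * a n + s * b n))"
    by (rule summable_comparison_test'[where N = 0])
       (use norm_triangle_ineq[of "r * a _" "s * b _"] in \<open>simp add: norm_mult\<close>)
  thus ?thesis by (simp add: ell1_def)
qed

text \<open>The tail sums are bounded functionals that equal 1 at every unit vector from index
  \<open>N\<close> on, yet tend to 0 at each fixed sequence. This opposition is what a weak cluster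
  point of the unit vectors cannot survive.\<close>

lemma ell1_tail_lincomb:
  assumes "a \<in> carr ell1" "b \<in> carr ell1"
  shows "(\<Sum>n. r * a (n + N) + s * b (n + N)) = r * (\<Sum>n. a (n + N)) + s * (\<Sum>n. b (n + N))"
proof -
  have "summable (\<lambda>n. a (n + N))" "summable (\<lambda>n. b (n + N))"
    using assms by (simp_all add: ell1_def summable_norm_cancel summable_iff_shift)
  thus ?thesis by (simp add: suminf_add[symmetric] suminf_mult summable_mult)
qed

lemma ell1_tail_bound:
  assumes "a \<in> carr ell1"
  shows "norm (\<Sum>n. a (n + N)) \<le> nrm ell1 a"
proof -
  have s: "summable (\<lambda>n. norm (a n))" using assms by (simp add: ell1_def)
  hence s': "summable (\<lambda>n. norm (a (n + N)))" by (simp add: summable_iff_shift[of "\<lambda>n. norm (a n)"])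
  have "norm (\<Sum>n. a (n + N)) \<le> (\<Sum>n. norm (a (n + N)))" by (rule summable_norm[OF s'])
  also have "\<dots> = (\<Sum>n. norm (a n)) - (\<Sum>n<N. norm (a n))" by (rule suminf_minus_initial_segment[OF s])
  also have "\<dots> \<le> nrm ell1 a" by (simp add: ell1_def sum_nonneg)
  finally show ?thesis .
qed

lemma ell1_tail_tendsto_0:
  assumes "a \<in> carr ell1"
  shows "(\<lambda>N. \<Sum>n. a (n + N)) \<longlonglongrightarrow> 0"
proof -
  have s: "summable a" using assms by (simp add: ell1_def summable_norm_cancel)
  have "(\<lambda>N. (\<Sum>n. a n) - (\<Sum>n<N. a n)) \<longlonglongrightarrow> (\<Sum>n. a n) - (\<Sum>n. a n)"
    by (intro tendsto_diff tendsto_const summable_LIMSEQ s)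
  thus ?thesis by (simp add: suminf_minus_initial_segment[OF s])
qed

lemma ell1_single:
  "(\<lambda>k. if k = n then v else 0) \<in> carr ell1" "nrm ell1 (\<lambda>k. if k = n then v else 0) = norm v"
  "n \<ge> N \<Longrightarrow> (\<Sum>k. if k + N = n then v else 0) = v"
proof -
  have *: "(\<lambda>k. norm (if k = n then v else 0)) sums norm v"
    using sums_single[of n "\<lambda>_. norm v"] by (simp add: if_distrib[of norm] cong: if_cong)
  show "(\<lambda>k. if k = n then v else 0) \<in> carr ell1" "nrm ell1 (\<lambda>k. if k = n then v else 0) = norm v"
    using * by (auto simp: ell1_def sums_iff)
  show "(\<Sum>k. if k + N = n then v else 0) = v" if "n \<ge> N"
  proof -
    have "(\<lambda>k. if k + N = n then v else 0) = (\<lambda>k. if k = n - N then v else 0)"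
      using that by (auto simp: fun_eq_iff)
    thus ?thesis using sums_single[of "n - N" "\<lambda>_. v"] by (simp add: sums_iff)
  qed
qed

text \<open>Let \<open>y\<close> be a weak cluster point of the images of the unit vectors. If \<open>y\<close> had positive distance
  from their span, a functional would separate it from the span; otherwise \<open>y\<close> is close to some
  \<open>L a\<close>, while every functional summing the coefficients from \<open>N\<close> on takes the same nonzero value
  at \<open>y\<close>.\<close>

lemma weakly_compact_imp_not_fixes_ell1:
  assumes X: "normed_fspace X" and Y: "normed_fspace Y" and W: "weakly_compact_operator X Y T"
  shows "\<not> fixes_copy X Y ell1 T"
proof
  interpret normed_fspace Y by fact
  assume "fixes_copy X Y ell1 T"
  then obtain M J where
    isoJ: "isomorphism ell1 (X\<lparr>carr := M\<rparr>) J" and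
    isoT: "isomorphism (X\<lparr>carr := M\<rparr>) (Y\<lparr>carr := T ` M\<rparr>) T" and M: "closed_subspace X M"
    unfolding fixes_copy_def by blast
  have MX: "M \<subseteq> carr X"
    using M closedin_subset[of "norm_topology X" M] normed_fspace.topspace_norm_topology[OF X]
    unfolding closed_subspace_def by blast
  obtain D1 where D1: "\<And>a. a \<in> carr ell1 \<Longrightarrow> nrm ell1 a \<le> D1 * nrm X (J a)"
    using isomorphism_bounded_below[OF isoJ] by auto
  obtain D2 where D2: "\<And>f. f \<in> M \<Longrightarrow> nrm X f \<le> D2 * nrm Y (T f)"
    using isomorphism_bounded_below[OF isoT] by auto
  have J: "bounded_operator ell1 (X\<lparr>carr := M\<rparr>) J" using isoJ by (simp add: isomorphism_def)
  hence "\<exists>C. \<forall>a\<in>carr ell1. nrm X (J a) \<le> C * nrm ell1 a"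
    by (simp add: bounded_operator_def)
  then obtain C where C: "\<And>a. a \<in> carr ell1 \<Longrightarrow> nrm X (J a) \<le> C * nrm ell1 a"
    by blast
  have JM: "J a \<in> M" if "a \<in> carr ell1" for a
    using J that unfolding bounded_operator_def by auto
  have Jlin: "J (\<lambda>n. r * a n + s * b n) = (\<lambda>x. r * J a x + s * J b x)"
    if "a \<in> carr ell1" "b \<in> carr ell1" for a b r s
    using J that unfolding bounded_operator_def by blast
  have TY: "f \<in> carr X \<Longrightarrow> T f \<in> carr Y"
    and Tlin: "f \<in> carr X \<Longrightarrow> g \<in> carr X \<Longrightarrow> T (\<lambda>x. r * f x + s * g x) = (\<lambda>y. r * T f y + s * T g y)"
    for f g r s
    using W unfolding weakly_compact_operator_def bounded_operator_def by auto
  \<comment> \<open>The unit vectors are divided by \<open>c\<close> so that \<open>J\<close> maps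
    them into the unit ball; the maximum keeps \<open>c\<close> positive whatever the sign of
    \<open>C\<close>.\<close>
  define c where "c = max C 1"
  have c: "c > 0" "C \<le> c" by (auto simp: c_def)
  define L where "L a = T (J a)" for a
  have L_mem: "L a \<in> carr Y" if "a \<in> carr ell1" for a
    using JM[OF that] MX TY by (auto simp: L_def)
  have L_lin: "L (\<lambda>n. r * a n + s * b n) = (\<lambda>x. r * L a x + s * L b x)"
    if "a \<in> carr ell1" "b \<in> carr ell1" for a b r s
    using JM that MX by (simp add: L_def Jlin Tlin subset_iff)
  define D where "D = \<bar>D1\<bar> * \<bar>D2\<bar> + 1"
  have "D > 0" by (simp add: D_def add_nonneg_pos)
  have D: "nrm ell1 a \<le> D * nrm Y (L a)" if a: "a \<in> carr ell1" for a
  proof -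
    have "nrm X (J a) \<le> \<bar>D2\<bar> * nrm Y (L a)"
      using D2[OF JM[OF a]] mult_right_mono[OF abs_ge_self nrm_nonneg, of D2 "L a"] by (simp add: L_def)
    hence "D1 * nrm X (J a) \<le> \<bar>D1\<bar> * (\<bar>D2\<bar> * nrm Y (L a))"
      by (intro mult_mono) (auto simp: normed_fspace.nrm_nonneg[OF X])
    also have "\<dots> \<le> D * nrm Y (L a)" using nrm_nonneg[of "L a"] by (simp add: D_def algebra_simps)
    finally show ?thesis using D1[OF a] by simp
  qed
  define e where "e n = (\<lambda>k. if k = n then of_real (1 / c) else (0::complex))" for n :: nat
  have e: "e n \<in> carr ell1" "nrm ell1 (e n) = 1 / c" for n
    using c(1) by (simp_all add: e_def ell1_single norm_divide)
  define S where "S N = (\<lambda>n. L (e n)) ` {N..}" for N :: nat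
  define K where "K = weak_topology Y closure_of (T ` unit_ball X)"
  have K: "compactin (weak_topology Y) K" using W by (simp add: weakly_compact_operator_def K_def)
  have "J (e n) \<in> unit_ball X" for n
  proof -
    have "nrm X (J (e n)) \<le> C * (1 / c)" using C[OF e(1)] e(2) by metis
    also have "\<dots> \<le> 1" using c by simp
    finally show ?thesis using JM[OF e(1)] MX by (auto simp: unit_ball_def)
  qed
  hence "S n \<subseteq> T ` unit_ball X" for n by (auto simp: S_def L_def)
  moreover have "T ` unit_ball X \<subseteq> K"
    unfolding K_def using TY by (intro closure_of_subset) (auto simp: topspace_weak_topology unit_ball_def)
  ultimately have SK: "S n \<subseteq> K" for n by blast
  have S: "S n \<noteq> {}" "decseq S" for n by (auto simp: S_def decseq_def)
  obtain y where y: "\<And>N. y \<in> weak_topology Y closure_of (S N)"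
    using nest_compactin[OF K S(1) SK S(2)] by blast
  have yY: "y \<in> carr Y"
    using y closure_of_subset_topspace[of "weak_topology Y"] topspace_weak_topology[of Y] by blast
  \<comment> \<open>The set where a functional takes the value \<open>v\<close> is weakly closed; as
    it contains the tail \<open>S N\<close>, it contains \<open>y\<close>.\<close>
  have \<phi>y: "\<phi> y = v" if \<phi>: "\<phi> \<in> dual_space Y" and v: "\<And>n. n \<ge> N \<Longrightarrow> \<phi> (L (e n)) = v" for \<phi> v N
  proof -
    have "closedin (weak_topology Y) {f \<in> topspace (weak_topology Y). \<phi> f \<in> {v}}"
      by (rule closedin_continuous_map_preimage[OF continuous_map_dual[OF \<phi>]]) simp
    moreover have "S N \<subseteq> {f \<in> topspace (weak_topology Y). \<phi> f \<in> {v}}"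
      using v L_mem e(1) by (auto simp: S_def topspace_weak_topology)
    ultimately show ?thesis using closure_of_minimal y[of N] by blast
  qed
  show False
  proof (cases "\<exists>\<epsilon>>0. \<forall>a\<in>carr ell1. \<epsilon> \<le> nrm Y (\<lambda>x. y x - L a x)")
    case True
    then obtain \<epsilon> where \<epsilon>: "\<epsilon> > 0" "\<And>a. a \<in> carr ell1 \<Longrightarrow> \<epsilon> \<le> nrm Y (\<lambda>x. y x - L a x)" by blast
    \<comment> \<open>Graph of the functional that is 1 at \<open>y\<close> and 0 on the range of
      \<open>L\<close>; the distance \<open>\<epsilon>\<close> of \<open>y\<close> from that range
      bounds it by \<open>1 / \<epsilon>\<close>.\<close>
    define G where "G = {(\<lambda>x. l * y x + L a x, l) | l a. a \<in> carr ell1}"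
    have memG: "(\<lambda>x. l * y x + L a x, l) \<in> G" if "a \<in> carr ell1" for l a using that by (auto simp: G_def)
    have z: "(\<lambda>_. 0) \<in> carr ell1" by (simp add: ell1_def)
    have L0: "L (\<lambda>_. 0) = (\<lambda>_. 0)" using L_lin[OF z z, of 0 0] by simp
    obtain \<phi> where \<phi>: "\<phi> \<in> dual_space Y" "\<And>f a. (f, a) \<in> G \<Longrightarrow> \<phi> f = a"
    proof (rule hahn_banach[of G "1 / \<epsilon>"])
      show "(\<lambda>_. 0, 0) \<in> G" using memG[OF z, of 0] L0 by simp
      fix f l assume "(f, l) \<in> G"
      then obtain a where a: "f = (\<lambda>x. l * y x + L a x)" "a \<in> carr ell1" by (auto simp: G_def)
      have f: "f \<in> carr Y" using lincomb[OF yY L_mem[OF a(2)], of l 1] a(1) by simp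
      have "norm l * \<epsilon> \<le> nrm Y f"
      proof (cases "l = 0")
        case False
        \<comment> \<open>With this \<open>b\<close> the function \<open>f\<close> is
          \<open>l\<close> times the difference of \<open>y\<close> and \<open>L b\<close>. The term
          \<open>0 * a n\<close> only gives \<open>b\<close> the shape of
          \<open>ell1_lincomb\<close>.\<close>
        define b where "b = (\<lambda>n. (- 1 / l) * a n + 0 * a n)"
        have b: "b \<in> carr ell1" unfolding b_def by (rule ell1_lincomb[OF a(2) a(2)])
        have "f = (\<lambda>x. l * (y x - L b x))"
          unfolding b_def L_lin[OF a(2) a(2)] a(1) using False by (auto simp: field_simps)
        hence "nrm Y f = norm l * nrm Y (\<lambda>x. y x - L b x)"
          using nrm_scale[OF diff_mem[OF yY L_mem[OF b]]] by simp
        thus ?thesis using \<epsilon>(2)[OF b] by (simp add: mult_left_mono)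
      qed (simp add: nrm_nonneg)
      thus "f \<in> carr Y \<and> norm l \<le> 1 / \<epsilon> * nrm Y f" using f \<epsilon>(1) by (simp add: field_simps)
    next
      fix f l g k r s assume "(f, l) \<in> G" "(g, k) \<in> G"
      then obtain a b where ab: "f = (\<lambda>x. l * y x + L a x)" "a \<in> carr ell1"
         "g = (\<lambda>x. k * y x + L b x)" "b \<in> carr ell1" by (auto simp: G_def)
      show "(\<lambda>x. r * f x + s * g x, r * l + s * k) \<in> G"
        using memG[OF ell1_lincomb[OF ab(2,4), of r s], of "r * l + s * k"] L_lin[OF ab(2,4), of r s] ab
        by (simp add: algebra_simps)
    qed (use \<epsilon> in auto)
    have "\<phi> y = 1" using \<phi>(2)[OF memG[OF z, of 1]] L0 by simp
    moreover have "\<phi> (L (e n)) = 0" for n using \<phi>(2)[OF memG[OF e(1), of 0]] by simp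
    ultimately show False using \<phi>y[OF \<phi>(1), of 0 0] by simp
  next
    case False
    \<comment> \<open>Makes \<open>D * \<epsilon>\<close> half of \<open>1 / c\<close>, the value at
      \<open>y\<close> of every tail functional.\<close>
    define \<epsilon> where "\<epsilon> = 1 / (2 * c * D)"
    have "\<epsilon> > 0" using c \<open>D > 0\<close> by (simp add: \<epsilon>_def)
    then obtain a where a: "a \<in> carr ell1" "nrm Y (\<lambda>x. y x - L a x) < \<epsilon>" using False by (meson not_le)
    have "norm (of_real (1 / c) - (\<Sum>n. a (n + N))) \<le> D * \<epsilon>" for N
    proof -
      \<comment> \<open>The tail functional transported along \<open>L\<close>. Since
        \<open>L\<close> is bounded below, its bound \<open>D\<close> does not depend on
        \<open>N\<close>, so \<open>N\<close> may tend to infinity afterwards.\<close>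
      define G where "G = {(L b, \<Sum>n. b (n + N)) | b. b \<in> carr ell1}"
      have memG: "(L b, \<Sum>n. b (n + N)) \<in> G" if "b \<in> carr ell1" for b using that by (auto simp: G_def)
      have z: "(\<lambda>_. 0) \<in> carr ell1" by (simp add: ell1_def)
      obtain \<phi> where \<phi>: "\<phi> \<in> dual_space Y" "\<And>f a. (f, a) \<in> G \<Longrightarrow> \<phi> f = a"
         "\<And>f. f \<in> carr Y \<Longrightarrow> norm (\<phi> f) \<le> D * nrm Y f"
      proof (rule hahn_banach[of G D])
        show "(\<lambda>_. 0, 0) \<in> G" using memG[OF z] L_lin[OF z z, of 0 0] by simp
        show "f \<in> carr Y \<and> norm l \<le> D * nrm Y f" if fl: "(f, l) \<in> G" for f l
        proof -
          obtain b where b: "f = L b" "l = (\<Sum>n. b (n + N))" "b \<in> carr ell1" using fl by (auto simp: G_def)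
          show ?thesis using L_mem[OF b(3)] ell1_tail_bound[OF b(3), of N] D[OF b(3)] b(1,2) by simp
        qed
        show "(\<lambda>x. r * f x + s * g x, r * l + s * k) \<in> G" if fg: "(f, l) \<in> G" "(g, k) \<in> G" for f l g k r s
        proof -
          obtain a b where ab: "f = L a" "l = (\<Sum>n. a (n + N))" "a \<in> carr ell1"
            "g = L b" "k = (\<Sum>n. b (n + N))" "b \<in> carr ell1" using fg by (auto simp: G_def)
          show ?thesis
            using memG[OF ell1_lincomb[OF ab(3,6), of r s]] ell1_tail_lincomb[OF ab(3,6), of r N s]
              L_lin[OF ab(3,6)] ab by simp
        qed
      qed (use \<open>D > 0\<close> in auto)
      have "\<phi> y = of_real (1 / c)"
      proof (rule \<phi>y[OF \<phi>(1)])
        show "\<phi> (L (e n)) = of_real (1 / c)" if "n \<ge> N" for n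
          using \<phi>(2)[OF memG[OF e(1)]] ell1_single(3)[OF that] by (simp add: e_def)
      qed
      moreover have "\<phi> (L a) = (\<Sum>n. a (n + N))" using \<phi>(2)[OF memG[OF a(1)]] .
      ultimately have "norm (of_real (1 / c) - (\<Sum>n. a (n + N))) = norm (\<phi> (\<lambda>x. y x - L a x))"
        using dual_diff[OF \<phi>(1) yY L_mem[OF a(1)]] by simp
      also have "\<dots> \<le> D * nrm Y (\<lambda>x. y x - L a x)" by (rule \<phi>(3)[OF diff_mem[OF yY L_mem[OF a(1)]]])
      also have "\<dots> \<le> D * \<epsilon>" using a(2) \<open>D > 0\<close> by (intro mult_left_mono) auto
      finally show ?thesis .
    qed
    moreover have "(\<lambda>N. norm (of_real (1 / c) - (\<Sum>n. a (n + N)))) \<longlonglongrightarrow> norm (of_real (1 / c) - (0::complex))"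
      by (intro tendsto_intros ell1_tail_tendsto_0 a(1))
    ultimately have "norm (of_real (1 / c) - (0::complex)) \<le> D * \<epsilon>"
      by (intro LIMSEQ_le_const2) auto
    hence "1 / c \<le> D * \<epsilon>" using c by (simp add: norm_divide)
    also have "\<dots> = 1 / (2 * c)" using \<open>D > 0\<close> by (simp add: \<epsilon>_def)
    finally show False using c by (simp add: field_simps)
  qed
qed

section \<open>Completeness of the sequence space and a criterion for fixing a copy\<close>

lemma nrm_ell1_nonneg: "a \<in> carr ell1 \<Longrightarrow> 0 \<le> nrm ell1 a"
  by (auto simp: ell1_def intro: suminf_nonneg)

lemma sum_le_nrm_ell1: "a \<in> carr ell1 \<Longrightarrow> (\<Sum>k<K. norm (a k)) \<le> nrm ell1 a"
  by (auto simp: ell1_def intro: sum_le_suminf)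

lemma coeff_le_nrm_ell1: "a \<in> carr ell1 \<Longrightarrow> norm (a k) \<le> nrm ell1 a"
  using sum_le_suminf[of "\<lambda>n. norm (a n)" "{k}"] by (auto simp: ell1_def)

lemma ell1_diff: "a \<in> carr ell1 \<Longrightarrow> b \<in> carr ell1 \<Longrightarrow> (\<lambda>n. a n - b n) \<in> carr ell1"
  using ell1_lincomb[of a b 1 "-1"] by simp

text \<open>Serves to show that the range of an embedding is closed. The coordinatewise limit is the
  candidate; the Cauchy bound passes to it on finite partial sums and then to the whole
  series.\<close>

lemma ell1_complete:
  fixes \<alpha> :: "nat \<Rightarrow> nat \<Rightarrow> complex"
  assumes \<alpha>: "\<And>i. \<alpha> i \<in> carr ell1"
    and Cauchy: "\<And>e. e > 0 \<Longrightarrow> \<exists>N. \<forall>i\<ge>N. \<forall>j\<ge>N. nrm ell1 (\<lambda>n. \<alpha> i n - \<alpha> j n) < e"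
  shows "\<exists>a\<in>carr ell1. \<forall>e>0. \<exists>N. \<forall>i\<ge>N. nrm ell1 (\<lambda>n. \<alpha> i n - a n) \<le> e"
proof -
  have "convergent (\<lambda>i. \<alpha> i k)" for k
  proof (intro Cauchy_convergent metric_CauchyI)
    fix e :: real assume "e > 0"
    then obtain N where N: "\<forall>i\<ge>N. \<forall>j\<ge>N. nrm ell1 (\<lambda>n. \<alpha> i n - \<alpha> j n) < e" using Cauchy by blast
    show "\<exists>N. \<forall>i\<ge>N. \<forall>j\<ge>N. dist (\<alpha> i k) (\<alpha> j k) < e"
    proof (intro exI[of _ N] allI impI)
      fix i j assume "N \<le> i" "N \<le> j"
      thus "dist (\<alpha> i k) (\<alpha> j k) < e"
        using N coeff_le_nrm_ell1[OF ell1_diff[OF \<alpha>[of i] \<alpha>[of j]], of k] by (force simp: dist_norm)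
    qed
  qed
  then obtain a where a: "\<And>k. (\<lambda>i. \<alpha> i k) \<longlonglongrightarrow> a k" unfolding convergent_def by metis
  have *: "\<exists>N. \<forall>i\<ge>N. (\<lambda>n. \<alpha> i n - a n) \<in> carr ell1 \<and> nrm ell1 (\<lambda>n. \<alpha> i n - a n) \<le> e" if "e > 0" for e
  proof -
    obtain N where N: "\<forall>i\<ge>N. \<forall>j\<ge>N. nrm ell1 (\<lambda>n. \<alpha> i n - \<alpha> j n) < e" using Cauchy \<open>e > 0\<close> by blast
    have "(\<lambda>n. \<alpha> i n - a n) \<in> carr ell1 \<and> nrm ell1 (\<lambda>n. \<alpha> i n - a n) \<le> e" if i: "i \<ge> N" for i
    proof -
      have bd: "(\<Sum>k<K. norm (\<alpha> i k - a k)) \<le> e" for K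
      proof (rule LIMSEQ_le_const2)
        show "(\<lambda>j. \<Sum>k<K. norm (\<alpha> i k - \<alpha> j k)) \<longlonglongrightarrow> (\<Sum>k<K. norm (\<alpha> i k - a k))"
          by (intro tendsto_intros a)
        show "\<exists>N. \<forall>j\<ge>N. (\<Sum>k<K. norm (\<alpha> i k - \<alpha> j k)) \<le> e"
        proof (intro exI[of _ N] allI impI)
          fix j assume "j \<ge> N"
          thus "(\<Sum>k<K. norm (\<alpha> i k - \<alpha> j k)) \<le> e"
            using N i sum_le_nrm_ell1[OF ell1_diff[OF \<alpha>[of i] \<alpha>[of j]], of K] by force
        qed
      qed
      have "summable (\<lambda>k. norm (\<alpha> i k - a k))" by (rule summableI_nonneg_bounded[OF _ bd]) simp
      thus ?thesis using suminf_le_const[OF _ bd] by (simp add: ell1_def)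
    qed
    thus ?thesis by blast
  qed
  obtain N where N: "(\<lambda>n. \<alpha> N n - a n) \<in> carr ell1" using *[of 1] by auto
  have "a \<in> carr ell1" using ell1_diff[OF \<alpha>[of N] N] by simp
  thus ?thesis using * by blast
qed

text \<open>The one lower bound yields both isomorphisms. Combined with the bound \<open>K\<close>
  of \<open>T\<close> it makes \<open>J\<close> bounded below; combined with the bound
  \<open>C\<close> of \<open>J\<close> it makes \<open>T\<close> bounded below on the range of
  \<open>J\<close>. Closedness of the range then comes from \<open>Jbelow\<close> and
  \<open>ell1_complete\<close>.\<close>

lemma fixes_copy_ell1I:
  assumes X: "normed_fspace X" and T: "bounded_operator X Y T" and J: "bounded_operator ell1 X J"
    and \<delta>: "\<delta> > 0" and below: "\<And>a. a \<in> carr ell1 \<Longrightarrow> \<delta> * nrm ell1 a \<le> nrm Y (T (J a))"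
  shows "fixes_copy X Y ell1 T"
proof -
  interpret normed_fspace X by fact
  define M where "M = J ` carr ell1"
  have JX: "J a \<in> carr X" if "a \<in> carr ell1" for a using J that by (auto simp: bounded_operator_def)
  hence MX: "M \<subseteq> carr X" by (auto simp: M_def)
  have Jlin: "J (\<lambda>n. r * a n + s * b n) = (\<lambda>x. r * J a x + s * J b x)"
    if "a \<in> carr ell1" "b \<in> carr ell1" for a b r s
    using J that unfolding bounded_operator_def by blast
  have Jdiff: "J (\<lambda>n. a n - b n) = (\<lambda>x. J a x - J b x)" if "a \<in> carr ell1" "b \<in> carr ell1" for a b
    using Jlin[OF that, of 1 "-1"] by simp
  have Tlin: "T (\<lambda>x. r * f x + s * g x) = (\<lambda>y. r * T f y + s * T g y)" if "f \<in> carr X" "g \<in> carr X" for f g r s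
    using T that unfolding bounded_operator_def by blast
  have Tdiff: "T (\<lambda>x. f x - g x) = (\<lambda>y. T f y - T g y)" if "f \<in> carr X" "g \<in> carr X" for f g
    using Tlin[OF that, of 1 "-1"] by simp
  have Msub: "(\<lambda>x. r * f x + s * g x) \<in> M" if fg: "f \<in> M" "g \<in> M" for f g r s
  proof -
    obtain a b where "a \<in> carr ell1" "b \<in> carr ell1" "f = J a" "g = J b" using fg by (auto simp: M_def)
    thus ?thesis using Jlin[of a b r s, symmetric] ell1_lincomb[of a b r s] by (auto simp: M_def)
  qed
  have "\<exists>C. \<forall>a\<in>carr ell1. nrm X (J a) \<le> C * nrm ell1 a" using J by (simp add: bounded_operator_def)
  then obtain C0 where C0: "\<And>a. a \<in> carr ell1 \<Longrightarrow> nrm X (J a) \<le> C0 * nrm ell1 a" by blast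
  define C where "C = \<bar>C0\<bar>"
  have C: "C \<ge> 0" "\<And>a. a \<in> carr ell1 \<Longrightarrow> nrm X (J a) \<le> C * nrm ell1 a"
    using order_trans[OF C0 mult_right_mono[OF abs_ge_self nrm_ell1_nonneg]] by (auto simp: C_def)
  have "\<exists>C. \<forall>f\<in>carr X. nrm Y (T f) \<le> C * nrm X f" using T by (simp add: bounded_operator_def)
  then obtain K where K: "\<And>f. f \<in> carr X \<Longrightarrow> nrm Y (T f) \<le> K * nrm X f" by blast
  have Jbelow: "nrm ell1 a \<le> K / \<delta> * nrm X (J a)" if a: "a \<in> carr ell1" for a
  proof -
    have "\<delta> * nrm ell1 a \<le> K * nrm X (J a)" using below[OF a] K[OF JX[OF a]] by linarith
    thus ?thesis using \<delta> by (simp add: field_simps)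
  qed
  have ell1_zero: "a = b" if ab: "a \<in> carr ell1" "b \<in> carr ell1" and "nrm ell1 (\<lambda>n. a n - b n) \<le> 0" for a b
  proof
    fix n
    have "norm (a n - b n) \<le> 0" by (rule order_trans[OF coeff_le_nrm_ell1[OF ell1_diff[OF ab]] that(3)])
    thus "a n = b n" by simp
  qed
  have TJ_inj: "a = b" if ab: "a \<in> carr ell1" "b \<in> carr ell1" and eq: "T (J a) = T (J b)" for a b
  proof -
    \<comment> \<open>The zero sequence, written as a difference so that \<open>Jdiff\<close> and
      \<open>Tdiff\<close> treat it like the difference of \<open>a\<close> and \<open>b\<close>. As
      \<open>Y\<close> is an arbitrary record, the norm of \<open>T (J ?z)\<close> is bounded by 0
      through \<open>K\<close> and the zero of \<open>X\<close>.\<close>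
    let ?z = "\<lambda>n. a n - a n"
    have "T (J (\<lambda>n. a n - b n)) = T (J ?z)"
      unfolding Jdiff[OF ab] Jdiff[OF ab(1) ab(1)] Tdiff[OF JX[OF ab(1)] JX[OF ab(2)]]
        Tdiff[OF JX[OF ab(1)] JX[OF ab(1)]] eq ..
    hence "\<delta> * nrm ell1 (\<lambda>n. a n - b n) \<le> nrm Y (T (J ?z))"
      using below[OF ell1_diff[OF ab]] by simp
    also have "\<dots> \<le> K * nrm X (J ?z)" by (rule K[OF JX[OF ell1_diff[OF ab(1) ab(1)]]])
    also have "J ?z = (\<lambda>_. 0)" using Jdiff[OF ab(1) ab(1)] by simp
    finally show ?thesis using nrm_0 \<delta> ell1_zero[OF ab] by (simp add: mult_le_0_iff)
  qed
  have "isomorphism ell1 (X\<lparr>carr := M\<rparr>) J"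
  proof (rule isomorphismI)
    show "bounded_operator ell1 (X\<lparr>carr := M\<rparr>) J" using J by (simp add: bounded_operator_def M_def)
    show "nrm ell1 a \<le> K / \<delta> * nrm (X\<lparr>carr := M\<rparr>) (J a)" if "a \<in> carr ell1" for a using Jbelow[OF that] by simp
    show "inj_on J (carr ell1)" using TJ_inj by (auto intro: inj_onI)
  qed (auto simp: M_def ell1_lincomb)
  moreover have "isomorphism (X\<lparr>carr := M\<rparr>) (Y\<lparr>carr := T ` M\<rparr>) T"
  proof (rule isomorphismI)
    show "bounded_operator (X\<lparr>carr := M\<rparr>) (Y\<lparr>carr := T ` M\<rparr>) T"
      unfolding bounded_operator_def using K Tlin MX by (auto simp: subset_iff intro!: exI[of _ K])
    show "inj_on T (carr (X\<lparr>carr := M\<rparr>))" using TJ_inj by (auto simp: M_def intro!: inj_onI)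
    show "nrm (X\<lparr>carr := M\<rparr>) f \<le> C / \<delta> * nrm (Y\<lparr>carr := T ` M\<rparr>) (T f)" if f: "f \<in> carr (X\<lparr>carr := M\<rparr>)" for f
    proof -
      obtain a where a: "a \<in> carr ell1" "f = J a" using f by (auto simp: M_def)
      have "nrm X f \<le> C / \<delta> * (\<delta> * nrm ell1 a)" using C(2)[OF a(1)] \<delta> a(2) by simp
      also have "\<dots> \<le> C / \<delta> * nrm Y (T f)" using below[OF a(1)] \<delta> C(1) a(2) by (intro mult_left_mono) auto
      finally show ?thesis by simp
    qed
  qed (auto intro: Msub)
  moreover have "closed_subspace X M"
    unfolding closed_subspace_def
  proof (intro conjI ballI allI Msub)
    have "(\<lambda>_. 0) \<in> carr ell1" by (simp add: ell1_def)
    thus "M \<noteq> {}" by (auto simp: M_def)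
    interpret M: Metric_space "carr X" "\<lambda>f g. nrm X (\<lambda>x. f x - g x)" by (rule Metric_space_nrm)
    show "closedin (norm_topology X) M"
      unfolding norm_topology_def M.metric_closedin_iff_sequentially_closed
    proof (intro conjI MX allI impI, elim conjE)
      fix \<sigma> :: "nat \<Rightarrow> _" and l
      assume \<sigma>: "range \<sigma> \<subseteq> M" and lim: "limitin M.mtopology \<sigma> l sequentially"
      have l: "l \<in> carr X" and conv: "\<And>e. e > 0 \<Longrightarrow> eventually (\<lambda>i. nrm X (\<lambda>x. \<sigma> i x - l x) < e) sequentially"
        using lim unfolding M.limitin_metric by (auto elim: eventually_mono)
      have "\<forall>i. \<exists>a. a \<in> carr ell1 \<and> \<sigma> i = J a" using \<sigma> by (auto simp: M_def)
      then obtain \<alpha> where \<alpha>: "\<And>i. \<alpha> i \<in> carr ell1" "\<And>i. \<sigma> i = J (\<alpha> i)" by metis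
      have "\<exists>a\<in>carr ell1. \<forall>e>0. \<exists>N. \<forall>i\<ge>N. nrm ell1 (\<lambda>n. \<alpha> i n - a n) \<le> e"
      proof (rule ell1_complete[OF \<alpha>(1)])
        fix e :: real assume e: "e > 0"
        \<comment> \<open>Two distances to \<open>l\<close> are added and the lower bound of
          \<open>J\<close> costs the factor \<open>K / \<delta>\<close>; the added 1 keeps the
          divisor positive when \<open>K\<close> is 0.\<close>
        define e' where "e' = e / (2 * (\<bar>K\<bar> / \<delta> + 1))"
        have pos: "\<bar>K\<bar> / \<delta> + 1 > 0" using \<delta> by (simp add: add_nonneg_pos)
        have "e' > 0" using e pos by (simp add: e'_def)
        then obtain N where N: "\<And>i. i \<ge> N \<Longrightarrow> nrm X (\<lambda>x. \<sigma> i x - l x) < e'"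
          using conv unfolding eventually_sequentially by blast
        show "\<exists>N. \<forall>i\<ge>N. \<forall>j\<ge>N. nrm ell1 (\<lambda>n. \<alpha> i n - \<alpha> j n) < e"
        proof (intro exI[of _ N] allI impI)
          fix i j assume ij: "N \<le> i" "N \<le> j"
          have m: "\<sigma> i \<in> carr X" "\<sigma> j \<in> carr X" using \<sigma> MX by auto
          have "nrm ell1 (\<lambda>n. \<alpha> i n - \<alpha> j n) \<le> K / \<delta> * nrm X (\<lambda>x. \<sigma> i x - \<sigma> j x)"
            using Jbelow[OF ell1_diff[OF \<alpha>(1)[of i] \<alpha>(1)[of j]]] Jdiff[OF \<alpha>(1)[of i] \<alpha>(1)[of j]] \<alpha>(2) by simp
          also have "\<dots> \<le> (\<bar>K\<bar> / \<delta> + 1) * nrm X (\<lambda>x. \<sigma> i x - \<sigma> j x)"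
            using \<delta> nrm_nonneg by (intro mult_right_mono) (auto simp: field_simps)
          also have "nrm X (\<lambda>x. \<sigma> i x - \<sigma> j x) \<le> nrm X (\<lambda>x. \<sigma> i x - l x) + nrm X (\<lambda>x. \<sigma> j x - l x)"
            using M.triangle[OF m(1) l m(2)] nrm_diff_commute[of l "\<sigma> j"] by simp
          also have "\<dots> < e' + e'" using N[OF ij(1)] N[OF ij(2)] by simp
          also have "(\<bar>K\<bar> / \<delta> + 1) * (e' + e') = e"
          proof -
            have "c * (e / (2 * c) + e / (2 * c)) = e" if "c > 0" for c :: real using that by (simp add: field_simps)
            thus ?thesis unfolding e'_def using pos by blast
          qed
          finally show "nrm ell1 (\<lambda>n. \<alpha> i n - \<alpha> j n) < e" using pos by simp
        qed
      qed
      then obtain a where a: "a \<in> carr ell1" "\<And>e. e > 0 \<Longrightarrow> \<exists>N. \<forall>i\<ge>N. nrm ell1 (\<lambda>n. \<alpha> i n - a n) \<le> e" by blast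
      have "limitin M.mtopology \<sigma> (J a) sequentially"
        unfolding M.limitin_metric eventually_sequentially
      proof (intro conjI allI impI)
        fix e :: real assume e: "e > 0"
        obtain N where N: "\<forall>i\<ge>N. nrm ell1 (\<lambda>n. \<alpha> i n - a n) \<le> e / (2 * (C + 1))"
          using a(2)[of "e / (2 * (C + 1))"] e C(1) by auto
        show "\<exists>N. \<forall>i\<ge>N. \<sigma> i \<in> carr X \<and> nrm X (\<lambda>x. \<sigma> i x - J a x) < e"
        proof (intro exI[of _ N] allI impI conjI)
          fix i assume i: "i \<ge> N"
          show "\<sigma> i \<in> carr X" using \<sigma> MX by auto
          have "nrm X (\<lambda>x. \<sigma> i x - J a x) \<le> C * nrm ell1 (\<lambda>n. \<alpha> i n - a n)"
            using C(2)[OF ell1_diff[OF \<alpha>(1)[of i] a(1)]] Jdiff[OF \<alpha>(1)[of i] a(1)] \<alpha>(2) by simp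
          also have "\<dots> \<le> C * (e / (2 * (C + 1)))" using N i C(1) by (intro mult_left_mono) auto
          also have "\<dots> < e" using e C(1) by (simp add: field_simps add_nonneg_pos)
          finally show "nrm X (\<lambda>x. \<sigma> i x - J a x) < e" .
        qed
      qed (rule JX[OF a(1)])
      hence "l = J a" using M.limitin_metric_unique[OF lim] by simp
      thus "l \<in> M" using a(1) by (simp add: M_def)
    qed
  qed
  ultimately show ?thesis using T unfolding fixes_copy_def by blast
qed


section \<open>The spaces of average radial integrability\<close>

lemma epowr_top [simp]: "epowr top p = top"
  by (simp add: epowr_def)

lemma epowr_ennreal: "0 \<le> x \<Longrightarrow> epowr (ennreal x) p = ennreal (x powr p)"
  by (simp add: epowr_def)

lemma epowr_mono:
  assumes "0 \<le> p" "x \<le> y" shows "epowr x p \<le> epowr y p"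
  using assms by (cases x; cases y) (auto simp: epowr_ennreal top_unique intro: ennreal_leI powr_mono2)

lemma epowr_epowr: "epowr (epowr x p) r = epowr x (p * r)"
  by (cases x) (simp_all add: epowr_ennreal powr_powr)

lemma epowr_1 [simp]: "epowr x 1 = x"
  by (cases x) (simp_all add: epowr_ennreal)

lemma epowr_0_left [simp]: "epowr 0 p = 0"
  by (simp add: epowr_def)

lemma epowr_le_iff: "0 < p \<Longrightarrow> epowr x p \<le> epowr y p \<longleftrightarrow> x \<le> y"
  using epowr_mono[of "1/p" "epowr x p" "epowr y p"] epowr_mono[of p x y] by (auto simp: epowr_epowr)

lemma epowr_less_iff: "0 < p \<Longrightarrow> epowr x p < epowr y p \<longleftrightarrow> x < y"
  using epowr_le_iff[of p y x] by (simp flip: not_le)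

lemma epowr_mult: 
  assumes "0 \<le> c" shows "epowr (ennreal c * x) p = ennreal (c powr p) * epowr x p"
proof (cases x)
  case (real r)
  thus ?thesis using assms by (simp add: epowr_ennreal powr_mult flip: ennreal_mult)
next
  case top
  show ?thesis
  proof (cases "c = 0")
    case False
    hence "ennreal c \<noteq> 0" "ennreal (c powr p) \<noteq> 0" using assms by (auto simp: ennreal_eq_0_iff)
    thus ?thesis using top by (simp add: ennreal_mult_top)
  qed (use top in simp)
qed

lemma measurable_epowr [measurable (raw)]:
  assumes [measurable]: "f \<in> borel_measurable M"
  shows "(\<lambda>x. epowr (f x) p) \<in> borel_measurable M"
  unfolding epowr_def[abs_def] by measurable

lemma powr_convex_nonneg:
  fixes u v x y q :: real
  assumes q: "1 \<le> q" and uv: "0 \<le> u" "0 \<le> v" "u + v = 1" and xy: "0 \<le> x" "0 \<le> y"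
  shows "(u * x + v * y) powr q \<le> u * x powr q + v * y powr q"
proof -
  \<comment> \<open>Settles the case that \<open>x\<close> or \<open>y\<close> is 0: a weight in the
    unit interval dominates its own \<open>q\<close>-th power.\<close>
  have small: "(w * z) powr q \<le> w * z powr q" if "0 \<le> w" "w \<le> 1" "0 \<le> z" for w z :: real
  proof -
    have "w powr q \<le> w" using powr_mono'[of 1 q w] that q by (cases "w = 0") auto
    thus ?thesis using that by (simp add: powr_mult mult_right_mono)
  qed
  consider "x = 0" | "y = 0" | "x > 0" "y > 0" using xy by linarith
  thus ?thesis
  proof cases
    case 3
    have u: "u = 1 - v" using uv by simp
    show ?thesis unfolding u using convex_onD[OF powr_convex[OF q], of v x y] uv 3 by simp
  qed (use small[of v y] small[of u x] uv xy in auto)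
qed

text \<open>Convexity of the power at \<open>h / \<alpha>\<close> and \<open>g / \<beta>\<close>
  with weights \<open>\<alpha> / (\<alpha> + \<beta>)\<close> and
  \<open>\<beta> / (\<alpha> + \<beta>)\<close>. The coefficients are made so that integrals
  \<open>\<alpha> powr q\<close> and \<open>\<beta> powr q\<close> combine to
  \<open>(\<alpha> + \<beta>) powr q\<close>.\<close>

lemma epowr_add_le:
  assumes q: "1 \<le> q" and ab: "0 < \<alpha>" "0 < \<beta>"
  shows "epowr (h + g) q \<le> ennreal ((\<alpha> + \<beta>) powr q * (\<alpha> / (\<alpha> + \<beta>)) / \<alpha> powr q) * epowr h q +
           ennreal ((\<alpha> + \<beta>) powr q * (\<beta> / (\<alpha> + \<beta>)) / \<beta> powr q) * epowr g q" (is "_ \<le> ennreal ?A * _ + ennreal ?B * _")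
proof -
  define A B where AB: "A = ?A" "B = ?B"
  have pos: "A > 0" "B > 0" using ab by (simp_all add: AB)
  hence ne: "ennreal A \<noteq> 0" "ennreal B \<noteq> 0" by (simp_all add: ennreal_eq_0_iff)
  have "epowr (h + g) q \<le> ennreal A * epowr h q + ennreal B * epowr g q"
  proof (cases "h = top \<or> g = top")
    case True
    thus ?thesis using ne by (auto simp: ennreal_mult_top)
  next
    case False
    then obtain x y where xy: "h = ennreal x" "0 \<le> x" "g = ennreal y" "0 \<le> y"
      by (metis ennreal_cases)
    have "(\<alpha> / (\<alpha> + \<beta>)) * (x / \<alpha>) + (\<beta> / (\<alpha> + \<beta>)) * (y / \<beta>) = (x + y) / (\<alpha> + \<beta>)"
      using ab by (simp add: add_divide_distrib)
    hence "((x + y) / (\<alpha> + \<beta>)) powr q \<le> (\<alpha> / (\<alpha> + \<beta>)) * (x / \<alpha>) powr q + (\<beta> / (\<alpha> + \<beta>)) * (y / \<beta>) powr q"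
      using powr_convex_nonneg[OF q, of "\<alpha> / (\<alpha> + \<beta>)" "\<beta> / (\<alpha> + \<beta>)" "x / \<alpha>" "y / \<beta>"] ab xy
      by (simp add: add_divide_distrib[symmetric])
    hence "(\<alpha> + \<beta>) powr q * ((x + y) / (\<alpha> + \<beta>)) powr q \<le>
       (\<alpha> + \<beta>) powr q * ((\<alpha> / (\<alpha> + \<beta>)) * (x / \<alpha>) powr q + (\<beta> / (\<alpha> + \<beta>)) * (y / \<beta>) powr q)"
      by (intro mult_left_mono) auto
    moreover have "(\<alpha> + \<beta>) powr q * ((x + y) / (\<alpha> + \<beta>)) powr q = (x + y) powr q"
      using ab xy by (subst powr_mult[symmetric]) auto
    ultimately have "(x + y) powr q \<le> A * x powr q + B * y powr q"
      using ab xy by (simp add: powr_divide algebra_simps AB)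
    hence "ennreal ((x + y) powr q) \<le> ennreal A * ennreal (x powr q) + ennreal B * ennreal (y powr q)"
      using pos xy by (simp add: ennreal_mult[symmetric] ennreal_plus[symmetric] ennreal_leI del: ennreal_plus)
    thus ?thesis using xy by (simp add: epowr_ennreal ennreal_plus[symmetric] del: ennreal_plus)
  qed
  thus ?thesis by (simp only: AB)
qed

text \<open>Minkowski's inequality, with positive bounds in place of the norms themselves, so that
  functions of norm 0 form no separate case.\<close>

lemma nn_integral_epowr_add_le:
  assumes [measurable]: "H \<in> borel_measurable M" "G \<in> borel_measurable M"
    and q: "1 \<le> q" and ab: "0 < \<alpha>" "0 < \<beta>"
    and H: "(\<integral>\<^sup>+x. epowr (H x) q \<partial>M) \<le> ennreal (\<alpha> powr q)"
    and G: "(\<integral>\<^sup>+x. epowr (G x) q \<partial>M) \<le> ennreal (\<beta> powr q)"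
  shows "(\<integral>\<^sup>+x. epowr (H x + G x) q \<partial>M) \<le> ennreal ((\<alpha> + \<beta>) powr q)"
proof -
  let ?A = "(\<alpha> + \<beta>) powr q * (\<alpha> / (\<alpha> + \<beta>)) / \<alpha> powr q"
  let ?B = "(\<alpha> + \<beta>) powr q * (\<beta> / (\<alpha> + \<beta>)) / \<beta> powr q"
  have "(\<integral>\<^sup>+x. epowr (H x + G x) q \<partial>M) \<le> (\<integral>\<^sup>+x. ennreal ?A * epowr (H x) q + ennreal ?B * epowr (G x) q \<partial>M)"
    by (intro nn_integral_mono epowr_add_le q ab)
  also have "\<dots> = ennreal ?A * (\<integral>\<^sup>+x. epowr (H x) q \<partial>M) + ennreal ?B * (\<integral>\<^sup>+x. epowr (G x) q \<partial>M)"
    by (subst nn_integral_add) (auto simp: nn_integral_cmult)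
  also have "\<dots> \<le> ennreal ?A * ennreal (\<alpha> powr q) + ennreal ?B * ennreal (\<beta> powr q)"
    using H G by (intro add_mono mult_left_mono) auto
  also have "\<dots> = ennreal (?A * \<alpha> powr q + ?B * \<beta> powr q)"
    using ab by (simp add: ennreal_mult[symmetric] ennreal_plus[symmetric] del: ennreal_plus)
  also have "?A * \<alpha> powr q + ?B * \<beta> powr q = (\<alpha> + \<beta>) powr q * ((\<alpha> + \<beta>) / (\<alpha> + \<beta>))"
    using ab by (simp add: add_divide_distrib[symmetric] distrib_left[symmetric])
  finally show ?thesis using ab by simp
qed

text \<open>Young's inequality \<open>q x \<le> x\<^sup>q + (q - 1)\<close>, integrated.\<close>

lemma nn_integral_le_epowr:
  assumes [measurable]: "H \<in> borel_measurable M" and M: "emeasure M (space M) = 1"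
    and q: "1 \<le> q" and a: "0 < \<alpha>" and H: "(\<integral>\<^sup>+x. epowr (H x) q \<partial>M) \<le> ennreal (\<alpha> powr q)"
  shows "(\<integral>\<^sup>+x. H x \<partial>M) \<le> ennreal \<alpha>"
proof -
  \<comment> \<open>Applied to \<open>h / \<alpha>\<close> and multiplied by
    \<open>\<alpha>\<close>: the two terms integrate to at most \<open>\<alpha> / q\<close> and to
    \<open>\<alpha> * (1 - 1 / q)\<close>, whose sum is \<open>\<alpha>\<close>.\<close>
  have young: "h \<le> ennreal (\<alpha> / q / \<alpha> powr q) * epowr h q + ennreal (\<alpha> * (1 - 1 / q))" for h
  proof (cases h)
    case (real x)
    have "x / \<alpha> \<le> (x / \<alpha>) powr q / q + (1 - 1 / q)"
      using Youngs_inequality_0[of "1/q" "1 - 1/q" "(x / \<alpha>) powr q" 1] q a real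
      by (cases "x = 0") (auto simp: powr_powr)
    hence "\<alpha> * (x / \<alpha>) \<le> \<alpha> * ((x / \<alpha>) powr q / q + (1 - 1 / q))"
      using a by (intro mult_left_mono) auto
    hence "x \<le> (\<alpha> / q / \<alpha> powr q) * x powr q + \<alpha> * (1 - 1 / q)"
      using a real by (simp add: powr_divide algebra_simps)
    hence "ennreal x \<le> ennreal ((\<alpha> / q / \<alpha> powr q) * x powr q + \<alpha> * (1 - 1 / q))" by (rule ennreal_leI)
    also have "\<dots> = ennreal (\<alpha> / q / \<alpha> powr q) * ennreal (x powr q) + ennreal (\<alpha> * (1 - 1 / q))"
      using a q by (subst ennreal_plus) (auto simp: ennreal_mult[symmetric])
    finally show ?thesis using real by (simp add: epowr_ennreal)
  next
    case top
    have "\<alpha> / q / \<alpha> powr q > 0" using a q by simp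
    hence "ennreal (\<alpha> / q / \<alpha> powr q) \<noteq> 0" by (simp only: ennreal_eq_0_iff not_le)
    thus ?thesis using top by (simp add: ennreal_mult_top)
  qed
  have "(\<integral>\<^sup>+x. H x \<partial>M) \<le> (\<integral>\<^sup>+x. ennreal (\<alpha> / q / \<alpha> powr q) * epowr (H x) q + ennreal (\<alpha> * (1 - 1 / q)) \<partial>M)"
    by (intro nn_integral_mono young)
  also have "\<dots> = ennreal (\<alpha> / q / \<alpha> powr q) * (\<integral>\<^sup>+x. epowr (H x) q \<partial>M) + ennreal (\<alpha> * (1 - 1 / q))"
    by (subst nn_integral_add) (auto simp: nn_integral_cmult M)
  also have "\<dots> \<le> ennreal (\<alpha> / q / \<alpha> powr q) * ennreal (\<alpha> powr q) + ennreal (\<alpha> * (1 - 1 / q))"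
    using H by (intro add_mono mult_left_mono) auto
  also have "\<dots> = ennreal (\<alpha> / q / \<alpha> powr q * \<alpha> powr q + \<alpha> * (1 - 1 / q))"
    using a q by (subst ennreal_plus) (auto simp: ennreal_mult[symmetric])
  also have "\<alpha> / q / \<alpha> powr q * \<alpha> powr q + \<alpha> * (1 - 1 / q) = \<alpha>"
    using a q by (simp add: field_simps)
  finally show ?thesis .
qed

section \<open>Radial integrals, the angular measure and the norm of \<open>RM q\<close>\<close>

definition radial :: "(complex \<Rightarrow> complex) \<Rightarrow> real \<Rightarrow> ennreal" where
  "radial f t = (\<integral>\<^sup>+r\<in>{0..<1}. ennreal (norm (f (of_real r * cis t))) \<partial>lborel)"

text \<open>Normalised to total mass 1, so that the inclusion of \<open>RM q\<close> into
  \<open>RM 1\<close> does not increase the norm.\<close>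

definition angle :: "real measure" where
  "angle = density lborel (\<lambda>t. ennreal (1 / (2 * pi)) * indicator {0..2*pi} t)"

lemma sets_angle [measurable_cong, simp]: "sets angle = sets borel"
  by (simp add: angle_def)

lemma space_angle [simp]: "space angle = UNIV"
  by (simp add: angle_def)

lemma nn_integral_angle:
  assumes [measurable]: "F \<in> borel_measurable borel"
  shows "(\<integral>\<^sup>+t. F t \<partial>angle) = ennreal (1 / (2 * pi)) * (\<integral>\<^sup>+t\<in>{0..2*pi}. F t \<partial>lborel)"
  unfolding angle_def
  by (subst nn_integral_density) (auto simp: nn_integral_cmult mult_ac simp flip: nn_integral_cmult)

lemma emeasure_angle: "emeasure angle UNIV = 1"
proof -
  have "emeasure angle UNIV = (\<integral>\<^sup>+t. 1 \<partial>angle)" by simp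
  also have "\<dots> = ennreal (1 / (2 * pi)) * ennreal (2 * pi)" by (subst nn_integral_angle) auto
  also have "\<dots> = 1" by (subst ennreal_mult[symmetric]) auto
  finally show ?thesis .
qed

interpretation angle: finite_measure angle
  by standard (simp add: emeasure_angle)

definition disc_fun :: "(complex \<Rightarrow> complex) \<Rightarrow> bool" where
  "disc_fun f \<longleftrightarrow> f holomorphic_on ball 0 1 \<and> (\<forall>z. z \<notin> ball 0 1 \<longrightarrow> f z = 0)"

lemma disc_fun_lincomb: "disc_fun f \<Longrightarrow> disc_fun g \<Longrightarrow> disc_fun (\<lambda>x. a * f x + b * g x)"
  by (auto simp: disc_fun_def intro!: holomorphic_intros)

lemma disc_fun_measurable:
  assumes "disc_fun f" shows "f \<in> borel_measurable borel"
proof -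
  have "continuous_on (ball 0 1) f" using assms by (simp add: disc_fun_def holomorphic_on_imp_continuous_on)
  hence "(\<lambda>z. indicator (ball 0 1) z *\<^sub>R f z) \<in> borel_measurable borel"
    by (intro borel_measurable_continuous_on_indicator) auto
  moreover have "(\<lambda>z. indicator (ball 0 1) z *\<^sub>R f z) = f"
    using assms by (auto simp: disc_fun_def indicator_def fun_eq_iff)
  ultimately show ?thesis by simp
qed

lemma measurable_polar [measurable (raw)]:
  assumes f: "f \<in> borel_measurable borel" and [measurable]: "g \<in> borel_measurable M" "h \<in> borel_measurable M"
  shows "(\<lambda>x. f (of_real (g x) * cis (h x)) :: complex) \<in> borel_measurable M"
proof -
  have [measurable]: "cis \<in> borel_measurable borel"
    by (intro borel_measurable_continuous_onI continuous_intros)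
  have [measurable]: "(of_real :: real \<Rightarrow> complex) \<in> borel_measurable borel"
    by (intro borel_measurable_continuous_onI continuous_intros)
  show ?thesis by (rule measurable_compose[OF _ f]) measurable
qed

lemma measurable_radial [measurable]:
  assumes [measurable]: "f \<in> borel_measurable borel"
  shows "radial f \<in> borel_measurable borel"
  unfolding radial_def[abs_def] by measurable

lemma radial_scale:
  assumes [measurable]: "f \<in> borel_measurable borel"
  shows "radial (\<lambda>x. c * f x) t = ennreal (norm c) * radial f t"
  unfolding radial_def
  by (subst nn_integral_cmult[symmetric]) (auto simp: norm_mult ennreal_mult mult_ac)

lemma radial_add_le:
  assumes [measurable]: "f \<in> borel_measurable borel" "g \<in> borel_measurable borel"
  shows "radial (\<lambda>x. f x + g x) t \<le> radial f t + radial g t"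
  unfolding radial_def
proof (subst nn_integral_add[symmetric])
  show "(\<integral>\<^sup>+ r\<in>{0..<1}. ennreal (cmod (f (of_real r * cis t) + g (of_real r * cis t))) \<partial>lborel)
    \<le> (\<integral>\<^sup>+ r. ennreal (cmod (f (of_real r * cis t))) * indicator {0..<1} r +
                ennreal (cmod (g (of_real r * cis t))) * indicator {0..<1} r \<partial>lborel)"
    by (intro nn_integral_mono)
       (auto simp: distrib_right[symmetric] ennreal_plus[symmetric] simp del: ennreal_plus
             intro!: mult_right_mono ennreal_leI norm_triangle_ineq)
qed auto

lemma RM_rho_altdef:
  assumes [measurable]: "f \<in> borel_measurable borel"
  shows "RM_rho q f = epowr (\<integral>\<^sup>+t. epowr (radial f t) q \<partial>angle) (1 / q)"
  unfolding RM_rho_def by (subst nn_integral_angle) (auto simp: radial_def)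

lemma RM_rho_le_iff:
  assumes "f \<in> borel_measurable borel" "q > 0" "\<alpha> \<ge> 0"
  shows "RM_rho q f \<le> ennreal \<alpha> \<longleftrightarrow> (\<integral>\<^sup>+t. epowr (radial f t) q \<partial>angle) \<le> ennreal (\<alpha> powr q)"
proof -
  have "ennreal \<alpha> = epowr (ennreal (\<alpha> powr q)) (1 / q)"
    using assms by (simp add: epowr_ennreal powr_powr)
  thus ?thesis using assms by (simp add: RM_rho_altdef epowr_le_iff)
qed

text \<open>Cauchy's formula on the circle of radius \<open>r\<close>: the kernel is at most
  \<open>1 / (r - \<rho>)\<close>, and the factor \<open>r\<close> of the line element is estimated
  by 1.\<close>

lemma circle_mean_bound:
  assumes f: "disc_fun f" and z: "norm z \<le> \<rho>" and r: "\<rho> < r" "r < 1"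
  shows "ennreal ((r - \<rho>) * norm (f z)) \<le> (\<integral>\<^sup>+t. ennreal (norm (f (of_real r * cis t))) \<partial>angle)"
proof -
  have r0: "r > 0" using z r norm_ge_zero[of z] by linarith
  have [measurable]: "f \<in> borel_measurable borel" by (rule disc_fun_measurable[OF f])
  have hol: "f holomorphic_on cball 0 r"
    using f r by (auto simp: disc_fun_def intro: holomorphic_on_subset)
  have inball: "of_real r * cis t \<in> ball 0 1" for t using r r0 by (simp add: norm_mult)
  have contf: "continuous_on UNIV (\<lambda>t. f (of_real r * cis t))"
    using f inball unfolding disc_fun_def
    by (intro continuous_on_compose2[OF holomorphic_on_imp_continuous_on, of f "ball 0 1"] continuous_intros) auto
  have sep: "r - \<rho> \<le> norm (of_real r * cis t - z)" for t
  proof -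
    have "norm (of_real r * cis t) - norm z \<le> norm (of_real r * cis t - z)" by (rule norm_triangle_ineq2)
    thus ?thesis using z r0 by (simp add: norm_mult)
  qed
  hence ne: "of_real r * cis t - z \<noteq> 0" for t using r by (metis diff_gt_0_iff_gt norm_zero not_le)
  let ?g = "\<lambda>t. f (of_real r * cis t) / (of_real r * cis t - z) * of_real r * \<i> * cis t"
  have "((\<lambda>u. f u / (u - z)) has_contour_integral (2 * of_real pi * \<i> * f z)) (circlepath 0 r)"
    using z r by (intro Cauchy_integral_circlepath_simple hol) auto
  hence eq: "2 * of_real pi * \<i> * f z = integral {0..2*pi} ?g"
    by (subst (asm) circlepath_def)
       (auto dest!: contour_integral_unique simp: contour_integral_part_circlepath_eq)
  have "norm (integral {0..2*pi} ?g) \<le> integral {0..2*pi} (\<lambda>t. norm (f (of_real r * cis t)) / (r - \<rho>))"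
  proof (rule integral_norm_bound_integral)
    show "?g integrable_on {0..2*pi}"
      by (intro integrable_continuous_interval continuous_intros continuous_on_subset[OF contf] ballI ne) auto
    show "(\<lambda>t. norm (f (of_real r * cis t)) / (r - \<rho>)) integrable_on {0..2*pi}"
      using r by (intro integrable_continuous_interval continuous_intros continuous_on_subset[OF contf]) auto
    fix t
    have "norm (?g t) = norm (f (of_real r * cis t)) * r / norm (of_real r * cis t - z)"
      using r0 by (simp add: norm_mult norm_divide)
    also have "\<dots> \<le> norm (f (of_real r * cis t)) * 1 / (r - \<rho>)"
      using sep[of t] r r0 by (intro frac_le mult_left_mono) auto
    finally show "norm (?g t) \<le> norm (f (of_real r * cis t)) / (r - \<rho>)" by simp
  qed
  hence *: "2 * pi * norm (f z) \<le> integral {0..2*pi} (\<lambda>t. norm (f (of_real r * cis t))) / (r - \<rho>)"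
    unfolding eq[symmetric] by (simp add: norm_mult)
  have I: "((\<lambda>t. norm (f (of_real r * cis t))) has_integral integral {0..2*pi} (\<lambda>t. norm (f (of_real r * cis t)))) {0..2*pi}"
    by (intro integrable_integral integrable_continuous_interval continuous_intros continuous_on_subset[OF contf]) auto
  have "(r - \<rho>) * norm (f z) \<le> 1 / (2 * pi) * integral {0..2*pi} (\<lambda>t. norm (f (of_real r * cis t)))"
    using * r by (simp add: field_simps)
  hence "ennreal ((r - \<rho>) * norm (f z)) \<le> ennreal (1 / (2 * pi) * integral {0..2*pi} (\<lambda>t. norm (f (of_real r * cis t))))"
    by (rule ennreal_leI)
  also have "\<dots> = ennreal (1 / (2 * pi)) * (\<integral>\<^sup>+t\<in>{0..2*pi}. ennreal (norm (f (of_real r * cis t))) \<partial>lborel)"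
    by (subst nn_integral_has_integral_lebesgue'[OF _ I]) (auto simp flip: ennreal_mult')
  also have "\<dots> = (\<integral>\<^sup>+t. ennreal (norm (f (of_real r * cis t))) \<partial>angle)"
    by (subst nn_integral_angle) auto
  finally show ?thesis .
qed

text \<open>Integrates \<open>circle_mean_bound\<close> over radii from
  \<open>(1 + \<rho>) / 2\<close> to 1: there \<open>r - \<rho>\<close> is at least
  \<open>(1 - \<rho>) / 2\<close>, the interval has that same length, and the product is the
  constant. Norm-bounded sets are therefore locally bounded, as Montel's theorem requires.\<close>

lemma disc_fun_bound:
  assumes f: "disc_fun f" and z: "norm z \<le> \<rho>" and \<rho>: "\<rho> < 1"
  shows "ennreal ((1 - \<rho>)\<^sup>2 / 4 * norm (f z)) \<le> (\<integral>\<^sup>+t. radial f t \<partial>angle)"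
proof -
  have [measurable]: "f \<in> borel_measurable borel" by (rule disc_fun_measurable[OF f])
  interpret pair_sigma_finite lborel angle
    by (intro pair_sigma_finite.intro lborel.sigma_finite_measure_axioms angle.sigma_finite_measure_axioms)
  let ?s = "(1 + \<rho>) / 2"
  have "ennreal ((1 - \<rho>)\<^sup>2 / 4 * norm (f z)) = (\<integral>\<^sup>+r. ennreal ((1 - \<rho>) / 2 * norm (f z)) * indicator {?s<..<1} r \<partial>lborel)"
  proof (subst nn_integral_cmult_indicator)
    have em: "emeasure lborel {?s<..<1} = ennreal ((1 - \<rho>) / 2)" using \<rho> by (simp add: field_simps)
    have eq: "(1 - \<rho>)\<^sup>2 / 4 * norm (f z) = (1 - \<rho>) / 2 * norm (f z) * ((1 - \<rho>) / 2)"
      by (simp add: power2_eq_square)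
    show "ennreal ((1 - \<rho>)\<^sup>2 / 4 * norm (f z)) = ennreal ((1 - \<rho>) / 2 * norm (f z)) * emeasure lborel {?s<..<1}"
      unfolding em eq using \<rho> by (intro ennreal_mult) auto
  qed simp
  also have "\<dots> \<le> (\<integral>\<^sup>+r. (\<integral>\<^sup>+t. ennreal (norm (f (of_real r * cis t))) * indicator {0..<1} r \<partial>angle) \<partial>lborel)"
  proof (intro nn_integral_mono)
    fix r :: real
    show "ennreal ((1 - \<rho>) / 2 * norm (f z)) * indicator {?s<..<1} r \<le>
          (\<integral>\<^sup>+t. ennreal (norm (f (of_real r * cis t))) * indicator {0..<1} r \<partial>angle)"
    proof (cases "r \<in> {?s<..<1}")
      case True
      have "\<rho> \<ge> 0" using z norm_ge_zero[of z] by linarith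
      hence "ennreal ((1 - \<rho>) / 2 * norm (f z)) \<le> ennreal ((r - \<rho>) * norm (f z))"
        using True by (intro ennreal_leI mult_right_mono) (auto simp: field_simps)
      also have "\<dots> \<le> (\<integral>\<^sup>+t. ennreal (norm (f (of_real r * cis t))) \<partial>angle)"
        using True \<rho> by (intro circle_mean_bound f z) (auto simp: field_simps)
      finally show ?thesis using True \<open>\<rho> \<ge> 0\<close> by simp
    qed simp
  qed
  also have "\<dots> = (\<integral>\<^sup>+t. radial f t \<partial>angle)"
    unfolding radial_def by (rule Fubini'[symmetric]) simp
  finally show ?thesis .
qed

lemma mem_RM_iff: "f \<in> carr (RM q) \<longleftrightarrow> disc_fun f \<and> RM_rho q f < top"
  by (auto simp: RM_def disc_fun_def)

lemma nrm_RM: "nrm (RM q) f = enn2real (RM_rho q f)"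
  by (simp add: RM_def)

lemma RM_rho_eq_nrm: "f \<in> carr (RM q) \<Longrightarrow> RM_rho q f = ennreal (nrm (RM q) f)"
  by (simp add: mem_RM_iff nrm_RM)

lemma RM_leI:
  assumes "disc_fun f" "0 < q" "0 \<le> \<alpha>" "(\<integral>\<^sup>+t. epowr (radial f t) q \<partial>angle) \<le> ennreal (\<alpha> powr q)"
  shows "f \<in> carr (RM q)" "nrm (RM q) f \<le> \<alpha>"
proof -
  have "RM_rho q f \<le> ennreal \<alpha>" using assms by (simp add: RM_rho_le_iff disc_fun_measurable)
  thus "f \<in> carr (RM q)" "nrm (RM q) f \<le> \<alpha>"
    using assms order.strict_trans1[OF _ ennreal_less_top] by (auto simp: mem_RM_iff nrm_RM intro: enn2real_leI)
qed

lemma RM_leD: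
  assumes "f \<in> carr (RM q)" "0 < q" "nrm (RM q) f \<le> \<alpha>"
  shows "(\<integral>\<^sup>+t. epowr (radial f t) q \<partial>angle) \<le> ennreal (\<alpha> powr q)"
proof -
  have "0 \<le> \<alpha>" using assms(3) by (auto simp: nrm_RM intro: order_trans[rotated])
  moreover have "RM_rho q f \<le> ennreal \<alpha>" using RM_rho_eq_nrm[OF assms(1)] assms(3) by (simp add: ennreal_leI)
  moreover have "f \<in> borel_measurable borel" using assms(1) by (simp add: mem_RM_iff disc_fun_measurable)
  ultimately show ?thesis using assms(2) RM_rho_le_iff by blast
qed

lemma nrm_RM_nonneg: "0 \<le> nrm (RM q) f"
  by (simp add: nrm_RM)

lemma RM_add:
  assumes q: "1 \<le> q" and f: "f \<in> carr (RM q)" and g: "g \<in> carr (RM q)"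
  shows "(\<lambda>x. f x + g x) \<in> carr (RM q)" "nrm (RM q) (\<lambda>x. f x + g x) \<le> nrm (RM q) f + nrm (RM q) g"
proof -
  have d: "disc_fun f" "disc_fun g" using f g by (auto simp: mem_RM_iff)
  hence [measurable]: "f \<in> borel_measurable borel" "g \<in> borel_measurable borel"
    by (auto intro: disc_fun_measurable)
  have dfg: "disc_fun (\<lambda>x. f x + g x)" using disc_fun_lincomb[OF d, of 1 1] by simp
  \<comment> \<open>Minkowski's inequality was stated for positive bounds, so each norm receives a
    surplus \<open>e / 2\<close>, removed at the end.\<close>
  have *: "(\<lambda>x. f x + g x) \<in> carr (RM q) \<and> nrm (RM q) (\<lambda>x. f x + g x) \<le> nrm (RM q) f + nrm (RM q) g + e"
    if "e > 0" for e
  proof -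
    let ?a = "nrm (RM q) f + e / 2" and ?b = "nrm (RM q) g + e / 2"
    have ab: "?a > 0" "?b > 0" using that nrm_RM_nonneg[of q f] nrm_RM_nonneg[of q g] by simp_all
    have "(\<integral>\<^sup>+t. epowr (radial (\<lambda>x. f x + g x) t) q \<partial>angle) \<le> (\<integral>\<^sup>+t. epowr (radial f t + radial g t) q \<partial>angle)"
      using q by (intro nn_integral_mono epowr_mono radial_add_le) auto
    also have "\<dots> \<le> ennreal ((?a + ?b) powr q)"
      using ab q that by (intro nn_integral_epowr_add_le RM_leD f g) auto
    finally have "(\<integral>\<^sup>+t. epowr (radial (\<lambda>x. f x + g x) t) q \<partial>angle) \<le> ennreal ((?a + ?b) powr q)" .
    from RM_leI[OF dfg _ _ this] ab q show ?thesis by (simp add: algebra_simps)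
  qed
  from *[of 1] show "(\<lambda>x. f x + g x) \<in> carr (RM q)" by simp
  from * show "nrm (RM q) (\<lambda>x. f x + g x) \<le> nrm (RM q) f + nrm (RM q) g" by (blast intro: field_le_epsilon)
qed

lemma RM_rho_scale:
  assumes "f \<in> borel_measurable borel" "q > 0"
  shows "RM_rho q (\<lambda>x. c * f x) = ennreal (norm c) * RM_rho q f"
proof -
  have [measurable]: "f \<in> borel_measurable borel" by fact
  have "(\<integral>\<^sup>+t. epowr (radial (\<lambda>x. c * f x) t) q \<partial>angle) = ennreal (norm c powr q) * (\<integral>\<^sup>+t. epowr (radial f t) q \<partial>angle)"
    by (simp add: radial_scale epowr_mult nn_integral_cmult)
  thus ?thesis using assms(2) by (simp add: RM_rho_altdef epowr_mult powr_powr)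
qed

lemma RM_scale:
  assumes "f \<in> carr (RM q)" "q > 0"
  shows "(\<lambda>x. c * f x) \<in> carr (RM q)" "nrm (RM q) (\<lambda>x. c * f x) = norm c * nrm (RM q) f"
proof -
  have f: "disc_fun f" "f \<in> borel_measurable borel" using assms by (auto simp: mem_RM_iff disc_fun_measurable)
  have "disc_fun (\<lambda>x. c * f x)" using disc_fun_lincomb[OF f(1) f(1), of c 0] by simp
  thus "(\<lambda>x. c * f x) \<in> carr (RM q)" "nrm (RM q) (\<lambda>x. c * f x) = norm c * nrm (RM q) f"
    using assms RM_rho_scale[OF f(2) assms(2), of c]
    by (auto simp: mem_RM_iff nrm_RM ennreal_mult_less_top enn2real_mult)
qed

text \<open>Comparison of means on a probability space; the surplus \<open>e\<close> again keeps the
  bound positive.\<close>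

lemma RM_subset_RM1:
  assumes q: "1 \<le> q" and f: "f \<in> carr (RM q)"
  shows "f \<in> carr (RM 1)" "nrm (RM 1) f \<le> nrm (RM q) f"
proof -
  have d: "disc_fun f" using f by (auto simp: mem_RM_iff)
  hence [measurable]: "f \<in> borel_measurable borel" by (rule disc_fun_measurable)
  have *: "f \<in> carr (RM 1) \<and> nrm (RM 1) f \<le> nrm (RM q) f + e" if "e > 0" for e
  proof -
    have a: "nrm (RM q) f + e > 0" using nrm_RM_nonneg[of q f] that by simp
    have "(\<integral>\<^sup>+t. radial f t \<partial>angle) \<le> ennreal (nrm (RM q) f + e)"
    proof (rule nn_integral_le_epowr[OF _ _ q a])
      show "(\<integral>\<^sup>+t. epowr (radial f t) q \<partial>angle) \<le> ennreal ((nrm (RM q) f + e) powr q)"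
        using q that by (intro RM_leD f) auto
    qed (simp_all add: emeasure_angle)
    thus ?thesis using RM_leI[OF d, of 1 "nrm (RM q) f + e"] a by simp
  qed
  from *[of 1] show "f \<in> carr (RM 1)" by simp
  from * show "nrm (RM 1) f \<le> nrm (RM q) f" by (blast intro: field_le_epsilon)
qed

lemma nrm_RM1: "f \<in> carr (RM 1) \<Longrightarrow> (\<integral>\<^sup>+t. radial f t \<partial>angle) = ennreal (nrm (RM 1) f)"
  using RM_rho_eq_nrm[of f 1] RM_rho_altdef[of f 1] by (simp add: mem_RM_iff disc_fun_measurable)

lemma RM1_pointwise_bound:
  assumes f: "f \<in> carr (RM 1)" and z: "norm z \<le> \<rho>" and \<rho>: "\<rho> < 1"
  shows "norm (f z) \<le> 4 / (1 - \<rho>)\<^sup>2 * nrm (RM 1) f"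
proof -
  have "ennreal ((1 - \<rho>)\<^sup>2 / 4 * norm (f z)) \<le> ennreal (nrm (RM 1) f)"
    using disc_fun_bound[OF _ z \<rho>, of f] f by (simp add: mem_RM_iff nrm_RM1)
  hence "(1 - \<rho>)\<^sup>2 / 4 * norm (f z) \<le> nrm (RM 1) f" using nrm_RM_nonneg by simp
  thus ?thesis using \<rho> by (simp add: field_simps)
qed

text \<open>Definiteness rests on the bound for point evaluations, which forces the value 0 on the
  disc; off the disc the value is 0 by the convention of the carrier.\<close>

lemma normed_fspace_RM:
  assumes q: "1 \<le> q" shows "normed_fspace (RM q)"
proof
  have q0: "q > 0" using q by simp
  show "(\<lambda>_. 0) \<in> carr (RM q)"
    using q0 by (intro RM_leI[of _ q 0]) (auto simp: disc_fun_def radial_def)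
  show "(\<lambda>x. a * f x + b * g x) \<in> carr (RM q)" if "f \<in> carr (RM q)" "g \<in> carr (RM q)" for f g a b
    by (intro RM_add(1)[OF q] RM_scale(1) that q0)
  show "nrm (RM q) (\<lambda>x. f x - g x) = nrm (RM q) (\<lambda>x. g x - f x)" for f g
    unfolding nrm_RM RM_rho_def by (subst norm_minus_commute) (rule refl)
  show "f = (\<lambda>_. 0)" if f: "f \<in> carr (RM q)" and 0: "nrm (RM q) f = 0" for f
  proof
    fix z
    have d: "disc_fun f" using f by (simp add: mem_RM_iff)
    show "f z = 0"
    proof (cases "z \<in> ball 0 1")
      case True
      have "norm (f z) \<le> 4 / (1 - norm z)\<^sup>2 * nrm (RM 1) f"
        using True by (intro RM1_pointwise_bound RM_subset_RM1[OF q f]) auto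
      moreover have "nrm (RM 1) f = 0" using RM_subset_RM1(2)[OF q f] 0 nrm_RM_nonneg[of 1 f] by simp
      ultimately show ?thesis by simp
    qed (use d in \<open>auto simp: disc_fun_def\<close>)
  qed
qed (use q in \<open>auto simp: nrm_RM_nonneg RM_add RM_scale\<close>)

lemma epowr_liminf_le:
  assumes "p > 0" shows "epowr (liminf x) p \<le> liminf (\<lambda>n. epowr (x n) p)"
  unfolding le_Liminf_iff
proof (intro allI impI)
  fix y assume "y < epowr (liminf x) p"
  hence "epowr y (1 / p) < liminf x"
    using epowr_less_iff[of "1/p" y "epowr (liminf x) p"] assms by (simp add: epowr_epowr)
  hence "eventually (\<lambda>n. epowr y (1 / p) < x n) sequentially" by (rule less_LiminfD)
  thus "eventually (\<lambda>n. y < epowr (x n) p) sequentially"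
  proof eventually_elim
    case (elim n)
    thus ?case using epowr_less_iff[of p "epowr y (1/p)" "x n"] assms by (simp add: epowr_epowr)
  qed
qed

text \<open>Fatou's lemma twice, along each radius and then in the angle, with
  \<open>epowr_liminf_le\<close> in between. Balls are thus closed under pointwise limits on the
  disc, which serves both for Montel limits and for sums of series.\<close>

lemma RM_Fatou:
  assumes q: "1 \<le> q" and f: "disc_fun f" and u: "\<And>n. u n \<in> carr (RM q)" "\<And>n. nrm (RM q) (u n) \<le> C"
    and lim: "\<And>z. z \<in> ball 0 1 \<Longrightarrow> (\<lambda>n. u n z) \<longlonglongrightarrow> f z"
  shows "f \<in> carr (RM q)" "nrm (RM q) f \<le> C"
proof -
  have C: "0 \<le> C" using u(2)[of 0] nrm_RM_nonneg[of q "u 0"] by linarith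
  have [measurable]: "f \<in> borel_measurable borel" "u n \<in> borel_measurable borel" for n
    using f u(1) by (auto simp: mem_RM_iff disc_fun_measurable)
  have rad: "radial f t \<le> liminf (\<lambda>n. radial (u n) t)" for t
  proof -
    have "radial f t = (\<integral>\<^sup>+r. liminf (\<lambda>n. ennreal (norm (u n (of_real r * cis t))) * indicator {0..<1} r) \<partial>lborel)"
      unfolding radial_def
    proof (rule nn_integral_cong)
      fix r :: real
      show "ennreal (norm (f (of_real r * cis t))) * indicator {0..<1} r =
            liminf (\<lambda>n. ennreal (norm (u n (of_real r * cis t))) * indicator {0..<1} r)"
      proof (cases "r \<in> {0..<1}")
        case True
        hence "(\<lambda>n. ennreal (norm (u n (of_real r * cis t)))) \<longlonglongrightarrow> ennreal (norm (f (of_real r * cis t)))"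
          by (intro tendsto_ennrealI tendsto_norm lim) (auto simp: norm_mult)
        from lim_imp_Liminf[OF _ this] True show ?thesis by simp
      qed (simp add: Liminf_const)
    qed
    also have "\<dots> \<le> liminf (\<lambda>n. radial (u n) t)"
      unfolding radial_def by (rule nn_integral_liminf) measurable
    finally show ?thesis .
  qed
  have "(\<integral>\<^sup>+t. epowr (radial f t) q \<partial>angle) \<le> (\<integral>\<^sup>+t. liminf (\<lambda>n. epowr (radial (u n) t) q) \<partial>angle)"
    using q by (intro nn_integral_mono order_trans[OF epowr_mono[OF _ rad] epowr_liminf_le]) auto
  also have "\<dots> \<le> liminf (\<lambda>n. \<integral>\<^sup>+t. epowr (radial (u n) t) q \<partial>angle)"
    by (rule nn_integral_liminf) measurable
  also have "\<dots> \<le> liminf (\<lambda>n. ennreal (C powr q))"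
    using q by (intro Liminf_mono always_eventually allI RM_leD u) auto
  finally have "(\<integral>\<^sup>+t. epowr (radial f t) q \<partial>angle) \<le> ennreal (C powr q)" by (simp add: Liminf_const)
  thus "f \<in> carr (RM q)" "nrm (RM q) f \<le> C" using RM_leI[OF f _ C] q by auto
qed


section \<open>The integration operator\<close>

text \<open>The weight \<open>1 - norm z\<close> is the one that the exchange of integrals in
  \<open>radial_T_op_le\<close> produces; on the disc it is at most the Bloch weight.\<close>

lemma BlochD:
  assumes "g \<in> Bloch"
  shows "g holomorphic_on ball 0 1"
    and "\<exists>K>0. \<forall>z\<in>ball 0 1. (1 - norm z) * norm (deriv g z) \<le> K"
proof -
  show "g holomorphic_on ball 0 1" using assms by (simp add: Bloch_def)
  have "bdd_above ((\<lambda>z. (1 - (norm z)\<^sup>2) * norm (deriv g z)) ` ball 0 1)"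
    using assms by (simp add: Bloch_def)
  then obtain K where K: "\<And>z. z \<in> ball 0 1 \<Longrightarrow> (1 - (norm z)\<^sup>2) * norm (deriv g z) \<le> K"
    unfolding bdd_above_def by blast
  have "(1 - norm z) * norm (deriv g z) \<le> max K 1" if z: "z \<in> ball 0 1" for z
  proof -
    have "(norm z)\<^sup>2 \<le> norm z" using z by (simp add: power2_eq_square mult_left_le)
    hence "(1 - norm z) * norm (deriv g z) \<le> (1 - (norm z)\<^sup>2) * norm (deriv g z)"
      by (intro mult_right_mono) auto
    thus ?thesis using K[OF z] by simp
  qed
  thus "\<exists>K>0. \<forall>z\<in>ball 0 1. (1 - norm z) * norm (deriv g z) \<le> K"
    by (intro exI[of _ "max K 1"]) auto
qed

text \<open>A primitive replaces the integrals over segments: it yields holomorphy of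
  \<open>T_op g f\<close> and, along a radius, the fundamental theorem of calculus.\<close>

lemma T_op_primitive:
  assumes f: "f holomorphic_on ball 0 1" and g: "g holomorphic_on ball 0 1"
  obtains h where "\<And>z. z \<in> ball 0 1 \<Longrightarrow> (h has_field_derivative f z * deriv g z) (at z)"
    and "\<And>z. z \<in> ball 0 1 \<Longrightarrow> T_op g f z = h z - h 0"
proof -
  have "(\<lambda>z. f z * deriv g z) holomorphic_on ball 0 1"
    by (intro holomorphic_intros f g) auto
  then obtain h where h: "\<And>z. z \<in> ball 0 1 \<Longrightarrow> (h has_field_derivative f z * deriv g z) (at z within ball 0 1)"
    using holomorphic_convex_primitive'[of "ball 0 1" "\<lambda>z. f z * deriv g z"] by (auto simp: convex_ball)
  have "T_op g f z = h z - h 0" if z: "z \<in> ball 0 1" for z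
  proof -
    have "closed_segment 0 z \<subseteq> ball 0 1"
      using z by (intro closed_segment_subset) auto
    hence "((\<lambda>w. f w * deriv g w) has_contour_integral (h (pathfinish (linepath 0 z)) - h (pathstart (linepath 0 z)))) (linepath 0 z)"
      by (intro contour_integral_primitive[of "ball 0 1"] h valid_path_linepath) (simp_all only: path_image_linepath)
    thus ?thesis using z by (simp add: T_op_def contour_integral_unique)
  qed
  thus thesis using that h at_within_open[OF _ open_ball] by metis
qed

lemma disc_fun_T_op:
  assumes f: "disc_fun f" and g: "g holomorphic_on ball 0 1"
  shows "disc_fun (T_op g f)"
proof -
  obtain h where h: "\<And>z. z \<in> ball 0 1 \<Longrightarrow> (h has_field_derivative f z * deriv g z) (at z)"
    and T: "\<And>z. z \<in> ball 0 1 \<Longrightarrow> T_op g f z = h z - h 0"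
    using T_op_primitive[of f g] f g by (auto simp: disc_fun_def)
  have "h holomorphic_on ball 0 1"
    using h by (subst holomorphic_on_open) blast+
  hence "(\<lambda>z. h z - h 0) holomorphic_on ball 0 1" by (intro holomorphic_intros)
  hence "T_op g f holomorphic_on ball 0 1" by (rule holomorphic_transform) (simp add: T)
  thus ?thesis by (simp add: disc_fun_def T_op_def)
qed

lemma T_op_integrable:
  assumes f: "f holomorphic_on ball 0 1" and g: "g holomorphic_on ball 0 1" and z: "z \<in> ball 0 1"
  shows "(\<lambda>w. f w * deriv g w) contour_integrable_on linepath 0 z"
proof -
  have "(\<lambda>w. f w * deriv g w) holomorphic_on ball 0 1" by (intro holomorphic_intros f g) auto
  hence "continuous_on (ball 0 1) (\<lambda>w. f w * deriv g w)" by (rule holomorphic_on_imp_continuous_on)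
  moreover have "closed_segment 0 z \<subseteq> ball 0 1" using z by (intro closed_segment_subset) auto
  ultimately show ?thesis by (rule contour_integrable_continuous_linepath[OF continuous_on_subset])
qed

lemma T_op_lincomb:
  assumes f: "disc_fun f1" "disc_fun f2" and g: "g holomorphic_on ball 0 1"
  shows "T_op g (\<lambda>x. a * f1 x + b * f2 x) = (\<lambda>z. a * T_op g f1 z + b * T_op g f2 z)"
proof
  fix z
  show "T_op g (\<lambda>x. a * f1 x + b * f2 x) z = a * T_op g f1 z + b * T_op g f2 z"
  proof (cases "z \<in> ball 0 1")
    case True
    have i: "(\<lambda>w. f1 w * deriv g w) contour_integrable_on linepath 0 z"
      "(\<lambda>w. f2 w * deriv g w) contour_integrable_on linepath 0 z"
      using f g True by (auto intro: T_op_integrable simp: disc_fun_def)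
    have "T_op g (\<lambda>x. a * f1 x + b * f2 x) z =
      contour_integral (linepath 0 z) (\<lambda>w. a * (f1 w * deriv g w) + b * (f2 w * deriv g w))"
      using True by (simp add: T_op_def algebra_simps)
    also have "\<dots> = a * T_op g f1 z + b * T_op g f2 z"
      using True i by (simp add: contour_integral_add contour_integrable_lmul contour_integral_lmul T_op_def)
    finally show ?thesis .
  qed (auto simp: T_op_def)
qed

lemma T_op_pointwise_bound:
  assumes f: "f holomorphic_on ball 0 1" and g: "g holomorphic_on ball 0 1"
    and K: "\<And>z. z \<in> ball 0 1 \<Longrightarrow> (1 - norm z) * norm (deriv g z) \<le> K" and "0 \<le> K"
    and z: "norm z \<le> \<rho>" "\<rho> < 1" and A: "0 \<le> A" "\<And>w. norm w \<le> \<rho> \<Longrightarrow> norm (f w) \<le> A"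
  shows "norm (T_op g f z) \<le> A * (K / (1 - \<rho>))"
proof -
  have zb: "z \<in> ball 0 1" using z by simp
  have "norm (contour_integral (linepath 0 z) (\<lambda>w. f w * deriv g w)) \<le> A * (K / (1 - \<rho>)) * norm (z - 0)"
  proof (rule contour_integral_bound_linepath)
    show "(\<lambda>w. f w * deriv g w) contour_integrable_on linepath 0 z" by (rule T_op_integrable[OF f g zb])
    fix w assume "w \<in> closed_segment 0 z"
    hence "w \<in> cball 0 \<rho>" using z closed_segment_subset[of 0 "cball 0 \<rho>" z] norm_ge_zero[of z] 
      by (auto simp del: norm_ge_zero)
    hence w: "norm w \<le> \<rho>" by simp
    have "norm (deriv g w) \<le> K / (1 - norm w)"
      using K[of w] w z(2) by (simp add: field_simps)
    also have "\<dots> \<le> K / (1 - \<rho>)" using w z(2) \<open>0 \<le> K\<close> by (intro divide_left_mono) auto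
    finally show "norm (f w * deriv g w) \<le> A * (K / (1 - \<rho>))"
      unfolding norm_mult using A(2)[OF w] A(1) by (intro mult_mono) auto
  qed (use A \<open>0 \<le> K\<close> z in auto)
  also have "\<dots> \<le> A * (K / (1 - \<rho>)) * 1"
    using A \<open>0 \<le> K\<close> z by (intro mult_left_mono) auto
  finally show ?thesis using zb by (simp add: T_op_def)
qed

text \<open>The image at radius \<open>r\<close> is at most the integral of |f g'| over the radius
  up to \<open>r\<close>. After the exchange \<open>r\<close> runs over \<open>{s..<1}\<close>,
  whose length \<open>1 - s\<close> compensates the growth of g'. Because the estimate holds angle
  by angle, every exponent inherits the same constant.\<close>

lemma radial_T_op_le:
  assumes f: "disc_fun f" and g: "g holomorphic_on ball 0 1"
    and K: "\<And>z. z \<in> ball 0 1 \<Longrightarrow> (1 - norm z) * norm (deriv g z) \<le> K" and "0 \<le> K"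
  shows "radial (T_op g f) t \<le> ennreal K * radial f t"
proof -
  have [measurable]: "f \<in> borel_measurable borel" by (rule disc_fun_measurable[OF f])
  have hf: "f holomorphic_on ball 0 1" using f by (simp add: disc_fun_def)
  \<comment> \<open>The derivative, cut off outside the disc, where nothing is known about
    \<open>deriv g\<close>; this makes the integrand Borel measurable.\<close>
  define G where "G z = (if z \<in> ball 0 1 then deriv g z else 0)" for z
  have "G holomorphic_on ball 0 1"
    by (rule holomorphic_transform[OF holomorphic_deriv[OF g open_ball]]) (simp add: G_def)
  hence "disc_fun G" by (simp add: disc_fun_def G_def)
  hence [measurable]: "G \<in> borel_measurable borel" by (rule disc_fun_measurable)
  define P where "P s = norm (f (of_real s * cis t)) * norm (G (of_real s * cis t))" for s :: real
  have [measurable]: "P \<in> borel_measurable borel" unfolding P_def by measurable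
  have inball: "of_real s * cis t \<in> ball 0 1" if "s \<in> {0..<1}" for s :: real
    using that by (simp add: norm_mult)
  obtain h where h: "\<And>z. z \<in> ball 0 1 \<Longrightarrow> (h has_field_derivative f z * deriv g z) (at z)"
    and T: "\<And>z. z \<in> ball 0 1 \<Longrightarrow> T_op g f z = h z - h 0"
    using T_op_primitive[OF hf g] by blast
  have bound: "ennreal (norm (T_op g f (of_real r * cis t))) \<le> (\<integral>\<^sup>+s\<in>{0..r}. ennreal (P s) \<partial>lborel)"
    if r: "r \<in> {0..<1}" for r
  proof -
    let ?d = "\<lambda>s. cis t * (f (of_real s * cis t) * deriv g (of_real s * cis t))"
    have sub: "s \<in> {0..<1}" if "s \<in> {0..r}" for s using that r by auto
    have I: "(?d has_integral (h (of_real r * cis t) - h (of_real 0 * cis t))) {0..r}"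
    proof (rule fundamental_theorem_of_calculus)
      fix s assume "s \<in> {0..r}"
      hence s: "of_real s * cis t \<in> ball 0 1" using inball sub by blast
      have "((\<lambda>s. of_real s * cis t) has_vector_derivative cis t) (at s)"
        by (auto intro!: derivative_eq_intros simp: has_vector_derivative_def scaleR_conv_of_real)
      from field_vector_diff_chain_at[OF this h[OF s]]
      show "((\<lambda>s. h (of_real s * cis t)) has_vector_derivative ?d s) (at s within {0..r})"
        by (auto simp: o_def intro: has_vector_derivative_at_within)
    qed (use r in auto)
    have contP: "continuous_on {0..r} P"
    proof -
      have "continuous_on {0..r} (\<lambda>s. norm (f (of_real s * cis t)) * norm (deriv g (of_real s * cis t)))"
        using inball sub
        by (intro continuous_intros continuous_on_compose2[OF holomorphic_on_imp_continuous_on[OF hf]]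
             continuous_on_compose2[OF holomorphic_on_imp_continuous_on[OF holomorphic_deriv[OF g open_ball]]])
           blast+
      moreover have "norm (f (of_real s * cis t)) * norm (deriv g (of_real s * cis t)) = P s" if "s \<in> {0..r}" for s
        using inball[OF sub[OF that]] by (simp add: P_def G_def)
      ultimately show ?thesis by (rule continuous_on_eq)
    qed
    have "norm (integral {0..r} ?d) \<le> integral {0..r} P"
    proof (rule integral_norm_bound_integral)
      show "?d integrable_on {0..r}" using I by (rule has_integral_integrable)
      show "P integrable_on {0..r}" by (rule integrable_continuous_interval[OF contP])
      show "norm (?d s) \<le> P s" if "s \<in> {0..r}" for s
        using inball[OF sub[OF that]] by (simp add: P_def G_def norm_mult)
    qed
    moreover have "T_op g f (of_real r * cis t) = integral {0..r} ?d"
      using integral_unique[OF I] T[OF inball[OF r]] by simp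
    ultimately have "ennreal (norm (T_op g f (of_real r * cis t))) \<le> ennreal (integral {0..r} P)"
      by (simp add: ennreal_leI)
    also have "\<dots> = (\<integral>\<^sup>+s\<in>{0..r}. ennreal (P s) \<partial>lborel)"
      by (rule nn_integral_has_integral_lebesgue'[symmetric])
         (simp add: P_def, rule integrable_integral[OF integrable_continuous_interval[OF contP]])
    finally show ?thesis .
  qed
  have "radial (T_op g f) t \<le> (\<integral>\<^sup>+r. (\<integral>\<^sup>+s. ennreal (P s) * indicator {0..r} s * indicator {0..<1} r \<partial>lborel) \<partial>lborel)"
    unfolding radial_def
  proof (rule nn_integral_mono)
    fix r
    show "ennreal (norm (T_op g f (of_real r * cis t))) * indicator {0..<1} r \<le>
      (\<integral>\<^sup>+s. ennreal (P s) * indicator {0..r} s * indicator {0..<1} r \<partial>lborel)"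
      using bound[of r] by (cases "r \<in> {0..<1}") auto
  qed
  \<comment> \<open>The triangle 0 <= s <= r < 1, sliced by \<open>s\<close> instead of
    \<open>r\<close>.\<close>
  also have "\<dots> = (\<integral>\<^sup>+r. (\<integral>\<^sup>+s. ennreal (P s) * indicator {0..<1} s * indicator {s..<1} r \<partial>lborel) \<partial>lborel)"
    by (intro nn_integral_cong) (auto simp: indicator_def)
  also have "\<dots> = (\<integral>\<^sup>+s. (\<integral>\<^sup>+r. ennreal (P s) * indicator {0..<1} s * indicator {s..<1} r \<partial>lborel) \<partial>lborel)"
  proof (rule lborel_pair.Fubini')
    have [measurable]: "Measurable.pred (borel \<Otimes>\<^sub>M borel) (\<lambda>x::real \<times> real. snd x \<in> {fst x..<1})"
      unfolding atLeastLessThan_iff by measurable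
    show "(\<lambda>(s, r). ennreal (P s) * indicator {0..<1} s * indicator {s..<1} r)
        \<in> borel_measurable (lborel \<Otimes>\<^sub>M lborel)"
      by measurable
  qed
  also have "\<dots> \<le> (\<integral>\<^sup>+s. ennreal K * (ennreal (norm (f (of_real s * cis t))) * indicator {0..<1} s) \<partial>lborel)"
  proof (rule nn_integral_mono)
    fix s :: real
    show "(\<integral>\<^sup>+r. ennreal (P s) * indicator {0..<1} s * indicator {s..<1} r \<partial>lborel) \<le>
       ennreal K * (ennreal (norm (f (of_real s * cis t))) * indicator {0..<1} s)"
    proof (cases "s \<in> {0..<1}")
      case True
      have "(\<integral>\<^sup>+r. ennreal (P s) * indicator {0..<1} s * indicator {s..<1} r \<partial>lborel) = ennreal (P s) * ennreal (1 - s)"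
        using True by (simp add: nn_integral_cmult_indicator)
      also have "\<dots> = ennreal ((1 - s) * P s)" using True by (simp add: P_def mult.commute flip: ennreal_mult)
      also have "\<dots> \<le> ennreal (K * norm (f (of_real s * cis t)))"
      proof (rule ennreal_leI)
        have "(1 - s) * norm (deriv g (of_real s * cis t)) \<le> K"
          using K[OF inball[OF True]] True by (simp add: norm_mult)
        from mult_right_mono[OF this norm_ge_zero[of "f (of_real s * cis t)"]]
        show "(1 - s) * P s \<le> K * norm (f (of_real s * cis t))"
          using inball[OF True] by (simp add: P_def G_def mult_ac)
      qed
      finally show ?thesis using True \<open>0 \<le> K\<close> by (simp add: ennreal_mult)
    qed simp
  qed
  also have "\<dots> = ennreal K * radial f t"
    unfolding radial_def by (rule nn_integral_cmult) measurable
  finally show ?thesis .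
qed

lemma T_op_RM:
  assumes g: "g holomorphic_on ball 0 1"
    and K: "\<And>z. z \<in> ball 0 1 \<Longrightarrow> (1 - norm z) * norm (deriv g z) \<le> K" and "0 \<le> K"
    and q: "1 \<le> q" and f: "f \<in> carr (RM q)"
  shows "T_op g f \<in> carr (RM q)" "nrm (RM q) (T_op g f) \<le> K * nrm (RM q) f"
proof -
  have d: "disc_fun f" using f by (simp add: mem_RM_iff)
  have [measurable]: "f \<in> borel_measurable borel" by (rule disc_fun_measurable[OF d])
  have "(\<integral>\<^sup>+t. epowr (radial (T_op g f) t) q \<partial>angle) \<le> (\<integral>\<^sup>+t. ennreal (K powr q) * epowr (radial f t) q \<partial>angle)"
    using q \<open>0 \<le> K\<close> by (intro nn_integral_mono order_trans[OF epowr_mono[OF _ radial_T_op_le[OF d g K]]])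
      (auto simp: epowr_mult)
  also have "\<dots> = ennreal (K powr q) * (\<integral>\<^sup>+t. epowr (radial f t) q \<partial>angle)"
    by (rule nn_integral_cmult) measurable
  also have "\<dots> \<le> ennreal (K powr q) * ennreal (nrm (RM q) f powr q)"
    using q by (intro mult_left_mono RM_leD f) auto
  also have "\<dots> = ennreal ((K * nrm (RM q) f) powr q)"
    using \<open>0 \<le> K\<close> nrm_RM_nonneg by (simp add: powr_mult ennreal_mult)
  finally show "T_op g f \<in> carr (RM q)" "nrm (RM q) (T_op g f) \<le> K * nrm (RM q) f"
    using RM_leI[OF disc_fun_T_op[OF d g], of q "K * nrm (RM q) f"] q \<open>0 \<le> K\<close> nrm_RM_nonneg by auto
qed

lemma bounded_operator_T_op:
  assumes g: "g \<in> Bloch" and q: "1 \<le> q"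
  shows "bounded_operator (RM q) (RM q) (T_op g)" "bounded_operator (RM q) (RM 1) (T_op g)"
proof -
  obtain K where K: "K > 0" "\<And>z. z \<in> ball 0 1 \<Longrightarrow> (1 - norm z) * norm (deriv g z) \<le> K"
    using BlochD(2)[OF g] by blast
  note T = T_op_RM[OF BlochD(1)[OF g] K(2) less_imp_le[OF K(1)] q]
  have lin: "T_op g (\<lambda>x. a * f x + b * h x) = (\<lambda>z. a * T_op g f z + b * T_op g h z)"
    if "f \<in> carr (RM q)" "h \<in> carr (RM q)" for f h a b
    using that BlochD(1)[OF g] by (intro T_op_lincomb) (auto simp: mem_RM_iff)
  show "bounded_operator (RM q) (RM q) (T_op g)"
    unfolding bounded_operator_def by (intro conjI ballI allI image_subsetI exI[of _ K] lin T)
  show "bounded_operator (RM q) (RM 1) (T_op g)"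
    unfolding bounded_operator_def
    by (intro conjI ballI allI image_subsetI exI[of _ K] lin RM_subset_RM1(1)[OF q] T(1)
          order_trans[OF RM_subset_RM1(2)[OF q] T(2)])
qed


section \<open>The gliding hump\<close>

text \<open>The first coordinate is the angle and the second the radius; as in \<open>RM_rho\<close>, there is no
  Jacobian.\<close>

definition polar_mass :: "real set \<Rightarrow> (complex \<Rightarrow> complex) \<Rightarrow> ennreal" where
  "polar_mass A f = (\<integral>\<^sup>+p. ennreal (norm (f (of_real (snd p) * cis (fst p)))) * indicator A (snd p)
     \<partial>(angle \<Otimes>\<^sub>M lborel))"

lemma polar_mass_unit: 
  assumes "disc_fun f"
  shows "polar_mass {0..<1} f = (\<integral>\<^sup>+t. radial f t \<partial>angle)"
proof -
  have [measurable]: "f \<in> borel_measurable borel" by (rule disc_fun_measurable[OF assms])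
  show ?thesis unfolding polar_mass_def radial_def
    by (subst lborel.nn_integral_fst[symmetric]) auto
qed

lemma polar_mass_mono: "A \<subseteq> B \<Longrightarrow> polar_mass A f \<le> polar_mass B f"
  unfolding polar_mass_def by (intro nn_integral_mono mult_left_mono) (auto simp: indicator_def)

lemma polar_mass_Un_le:
  assumes "disc_fun f" and [measurable]: "A \<in> sets borel" "B \<in> sets borel"
  shows "polar_mass (A \<union> B) f \<le> polar_mass A f + polar_mass B f"
proof -
  have [measurable]: "f \<in> borel_measurable borel" by (rule disc_fun_measurable[OF assms(1)])
  show ?thesis unfolding polar_mass_def
    by (subst nn_integral_add[symmetric]) (auto intro!: nn_integral_mono simp: indicator_def)
qed

lemma polar_mass_disc_le:
  assumes "disc_fun f" "R < 1" "0 \<le> R" and b: "\<And>z. norm z \<le> R \<Longrightarrow> norm (f z) \<le> b"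
  shows "polar_mass {0..R} f \<le> ennreal b"
proof -
  have [measurable]: "f \<in> borel_measurable borel" by (rule disc_fun_measurable[OF assms(1)])
  have b0: "b \<ge> 0" using b[of 0] \<open>0 \<le> R\<close> norm_ge_zero[of "f 0"] by (simp del: norm_ge_zero)
  have "polar_mass {0..R} f \<le> (\<integral>\<^sup>+p. ennreal b * indicator {0..R} (snd p) \<partial>(angle \<Otimes>\<^sub>M lborel))"
    unfolding polar_mass_def
  proof (rule nn_integral_mono)
    fix p :: "real \<times> real"
    show "ennreal (norm (f (of_real (snd p) * cis (fst p)))) * indicator {0..R} (snd p)
       \<le> ennreal b * indicator {0..R} (snd p)"
      using b[of "of_real (snd p) * cis (fst p)"] by (auto simp: indicator_def norm_mult intro: ennreal_leI)
  qed
  also have "\<dots> = (\<integral>\<^sup>+t. \<integral>\<^sup>+r. ennreal b * indicator {0..R} r \<partial>lborel \<partial>angle)"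
    by (subst lborel.nn_integral_fst[symmetric]) auto
  also have "\<dots> = ennreal b * ennreal R"
    using \<open>0 \<le> R\<close> by (simp add: nn_integral_cmult_indicator emeasure_angle)
  also have "\<dots> \<le> ennreal b" using assms b0 by (simp add: mult_left_le flip: ennreal_mult)
  finally show ?thesis .
qed

text \<open>Dominated convergence: the annuli shrink to the empty set and the mass on the whole disc
  is finite.\<close>

lemma polar_mass_outer_tendsto_0:
  assumes f: "f \<in> carr (RM 1)"
  shows "(\<lambda>n. polar_mass {1 - 1 / real (Suc n)<..<1} f) \<longlonglongrightarrow> 0"
proof -
  have d: "disc_fun f" using f by (simp add: mem_RM_iff)
  have [measurable]: "f \<in> borel_measurable borel" by (rule disc_fun_measurable[OF d])
  let ?F = "\<lambda>p. ennreal (norm (f (of_real (snd p) * cis (fst p))))"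
  have "(\<lambda>n. \<integral>\<^sup>+p. ?F p * indicator {1 - 1 / real (Suc n)<..<1} (snd p) \<partial>(angle \<Otimes>\<^sub>M lborel))
     \<longlonglongrightarrow> (\<integral>\<^sup>+(p::real \<times> real). 0 \<partial>(angle \<Otimes>\<^sub>M lborel))"
  proof (rule nn_integral_dominated_convergence[where w = "\<lambda>p. ?F p * indicator {0..<1} (snd p)"])
    show "(\<integral>\<^sup>+p. ?F p * indicator {0..<1} (snd p) \<partial>(angle \<Otimes>\<^sub>M lborel)) < \<infinity>"
      using polar_mass_unit[OF d] nrm_RM1[OF f] unfolding polar_mass_def by simp
    show "AE p in angle \<Otimes>\<^sub>M lborel. ?F p * indicator {1 - 1 / real (Suc n)<..<1} (snd p) \<le> ?F p * indicator {0..<1} (snd p)" for n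
    proof (intro AE_I2 mult_left_mono)
      fix p :: "real \<times> real"
      have "0 \<le> 1 - 1 / real (Suc n)" by (simp add: field_simps)
      moreover have "{c<..<1} \<subseteq> {0..<1}" if "0 \<le> c" for c :: real using that by auto
      ultimately have "{1 - 1 / real (Suc n)<..<1} \<subseteq> {0..<1}" by blast
      thus "indicator {1 - 1 / real (Suc n)<..<1} (snd p) \<le> (indicator {0..<1} (snd p) :: ennreal)"
        by (auto simp: indicator_def)
    qed simp
    show "AE p in angle \<Otimes>\<^sub>M lborel. (\<lambda>n. ?F p * indicator {1 - 1 / real (Suc n)<..<1} (snd p)) \<longlonglongrightarrow> 0"
    proof (intro AE_I2)
      fix p :: "real \<times> real"
      have "eventually (\<lambda>n. snd p \<notin> {1 - 1 / real (Suc n)<..<1}) sequentially"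
      proof (cases "snd p < 1")
        case True
        have "(\<lambda>n. 1 - 1 / real (Suc n)) \<longlonglongrightarrow> 1 - 0"
          by (intro tendsto_diff tendsto_const) (use LIMSEQ_inverse_real_of_nat in \<open>simp add: inverse_eq_divide\<close>)
        hence "eventually (\<lambda>n. snd p < 1 - 1 / real (Suc n)) sequentially"
          using True by (intro order_tendstoD) auto
        thus ?thesis by eventually_elim auto
      qed auto
      hence "eventually (\<lambda>n. ?F p * indicator {1 - 1 / real (Suc n)<..<1} (snd p) = 0) sequentially"
        by eventually_elim (auto simp: indicator_def)
      thus "(\<lambda>n. ?F p * indicator {1 - 1 / real (Suc n)<..<1} (snd p)) \<longlonglongrightarrow> 0"
        by (rule tendsto_eventually)
    qed
  qed auto
  thus ?thesis by (simp add: polar_mass_def)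
qed

text \<open>Given \<open>R k\<close>, locally uniform convergence supplies an index whose function
  has little mass within that radius; this one function then has little mass beyond some larger
  radius, which becomes \<open>R (Suc k)\<close>. The recursion runs over the radii, and the indices
  are read off afterwards.\<close>

lemma gliding_hump_radii:
  assumes v: "\<And>n. v n \<in> carr (RM 1)"
    and unif: "\<And>\<rho>. \<rho> < 1 \<Longrightarrow> uniform_limit (cball 0 \<rho>) v (\<lambda>_. 0) sequentially"
    and \<epsilon>: "\<epsilon> > 0"
  obtains R :: "nat \<Rightarrow> real" and n :: "nat \<Rightarrow> nat"
  where "strict_mono R" "\<And>k. 0 \<le> R k" "\<And>k. R k < 1"
    and "\<And>k. polar_mass {0..R k} (v (n k)) \<le> ennreal \<epsilon>"
    and "\<And>k. polar_mass {R (Suc k)<..<1} (v (n k)) \<le> ennreal \<epsilon>"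
proof -
  have step: "\<exists>y. (0 \<le> y \<and> y < 1) \<and> (x < y \<and> (\<exists>n. polar_mass {0..x} (v n) \<le> ennreal \<epsilon> \<and> polar_mass {y<..<1} (v n) \<le> ennreal \<epsilon>))"
    if x: "0 \<le> x \<and> x < 1" for x :: real
  proof -
    have "eventually (\<lambda>n. \<forall>z\<in>cball 0 x. dist (v n z) 0 < \<epsilon>) sequentially"
      using unif[of x] x \<epsilon> unfolding uniform_limit_iff by blast
    then obtain n where n: "\<And>z. z \<in> cball 0 x \<Longrightarrow> dist (v n z) 0 < \<epsilon>"
      unfolding eventually_sequentially by blast
    have 1: "polar_mass {0..x} (v n) \<le> ennreal \<epsilon>"
      using v[of n] x n by (intro polar_mass_disc_le) (auto simp: mem_RM_iff intro: less_imp_le)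
    have "eventually (\<lambda>m. polar_mass {1 - 1 / real (Suc m)<..<1} (v n) < ennreal \<epsilon>) sequentially"
      using \<epsilon> by (intro order_tendstoD(2)[OF polar_mass_outer_tendsto_0[OF v]]) auto
    moreover have "eventually (\<lambda>m. x < 1 - 1 / real (Suc m)) sequentially"
    proof -
      have "(\<lambda>n. 1 - 1 / real (Suc n)) \<longlonglongrightarrow> 1 - 0"
        by (intro tendsto_diff tendsto_const) (use LIMSEQ_inverse_real_of_nat in \<open>simp add: inverse_eq_divide\<close>)
      thus ?thesis using x by (intro order_tendstoD) auto
    qed
    ultimately have "eventually (\<lambda>m. polar_mass {1 - 1 / real (Suc m)<..<1} (v n) < ennreal \<epsilon> \<and> x < 1 - 1 / real (Suc m)) sequentially"
      by eventually_elim auto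
    then obtain m where "polar_mass {1 - 1 / real (Suc m)<..<1} (v n) < ennreal \<epsilon>" "x < 1 - 1 / real (Suc m)"
      by (auto simp: eventually_sequentially)
    thus ?thesis using 1 x by (intro exI[of _ "1 - 1 / real (Suc m)"]) (auto intro!: exI[of _ n] less_imp_le)
  qed
  have "\<exists>R. \<forall>k. (0 \<le> R k \<and> R k < 1) \<and> (R k < R (Suc k) \<and>
      (\<exists>n. polar_mass {0..R k} (v n) \<le> ennreal \<epsilon> \<and> polar_mass {R (Suc k)<..<1} (v n) \<le> ennreal \<epsilon>))"
    by (rule dependent_nat_choice) (use step in \<open>auto intro: exI[of _ 0]\<close>)
  then obtain R where R: "\<And>k. 0 \<le> R k \<and> R k < 1" "\<And>k. R k < R (Suc k)"
    "\<forall>k. \<exists>n. polar_mass {0..R k} (v n) \<le> ennreal \<epsilon> \<and> polar_mass {R (Suc k)<..<1} (v n) \<le> ennreal \<epsilon>"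
    by blast
  obtain n where "\<And>k. polar_mass {0..R k} (v (n k)) \<le> ennreal \<epsilon> \<and> polar_mass {R (Suc k)<..<1} (v (n k)) \<le> ennreal \<epsilon>"
    using R(3) by metis
  thus thesis using that[of R n] R strict_mono_Suc_iff[of R] by blast
qed

text \<open>Each \<open>v k\<close> carries most of its mass on the annulus \<open>R k < |z| \<le> R (k + 1)\<close>; these are disjoint.\<close>

lemma gliding_hump_lower_bound:
  assumes v: "\<And>k. v k \<in> carr (RM 1)" and R: "strict_mono R" "\<And>k. 0 \<le> R k" "\<And>k. R k < 1"
    and inner: "\<And>k. polar_mass {0..R k} (v k) \<le> ennreal (\<delta> / 8)"
    and outer: "\<And>k. polar_mass {R (Suc k)<..<1} (v k) \<le> ennreal (\<delta> / 8)"
    and \<delta>: "\<delta> > 0" "\<And>k. \<delta> \<le> nrm (RM 1) (v k)"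
    and a: "a \<in> carr ell1" and w: "w \<in> carr (RM 1)"
    and sums: "\<And>z. z \<in> ball 0 1 \<Longrightarrow> summable (\<lambda>k. norm (a k * v k z))"
              "\<And>z. z \<in> ball 0 1 \<Longrightarrow> (\<lambda>k. a k * v k z) sums w z"
  shows "\<delta> / 2 * nrm ell1 a \<le> nrm (RM 1) w"
proof -
  have dv: "disc_fun (v k)" for k using v by (simp add: mem_RM_iff)
  have dw: "disc_fun w" using w by (simp add: mem_RM_iff)
  have [measurable]: "v k \<in> borel_measurable borel" "w \<in> borel_measurable borel" for k
    using dv dw by (auto intro: disc_fun_measurable)
  \<comment> \<open>Radii of the annulus of \<open>v k\<close>; \<open>B k\<close> is the rest of
    the unit interval. Losing \<open>\<delta> / 8\<close> on either side leaves at least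
    \<open>3 * \<delta> / 4\<close> on \<open>A k\<close> against at most
    \<open>\<delta> / 4\<close> on \<open>B k\<close>, whence the final factor 1/2.\<close>
  define A where "A k = {R k<..R (Suc k)}" for k
  define B where "B k = {0..<1} - A k" for k
  have [measurable]: "A k \<in> sets borel" "B k \<in> sets borel" for k by (auto simp: A_def B_def)
  have disj: "k = j" if "r \<in> A k" "r \<in> A j" for r k j
  proof (rule ccontr)
    assume "k \<noteq> j"
    then consider "Suc k \<le> j" | "Suc j \<le> k" by linarith
    thus False
    proof cases
      case 1
      thus False using that strict_mono_less_eq[OF R(1), of "Suc k" j] by (auto simp: A_def)
    next
      case 2
      thus False using that strict_mono_less_eq[OF R(1), of "Suc j" k] by (auto simp: A_def)
    qed
  qed
  have A01: "A k \<subseteq> {0..<1}" for k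
    using R(2)[of k] R(3)[of "Suc k"] by (auto simp: A_def)
  have massB: "polar_mass (B k) (v k) \<le> ennreal (\<delta> / 4)" for k
  proof -
    have "polar_mass (B k) (v k) \<le> polar_mass ({0..R k} \<union> {R (Suc k)<..<1}) (v k)"
      by (rule polar_mass_mono) (auto simp: A_def B_def)
    also have "\<dots> \<le> polar_mass {0..R k} (v k) + polar_mass {R (Suc k)<..<1} (v k)"
      by (rule polar_mass_Un_le[OF dv]) auto
    also have "\<dots> \<le> ennreal (\<delta> / 8) + ennreal (\<delta> / 8)" by (intro add_mono inner outer)
    also have "\<dots> = ennreal (\<delta> / 4)" using \<delta>(1) by (simp flip: ennreal_plus)
    finally show ?thesis .
  qed
  have massA: "ennreal (3 * \<delta> / 4) \<le> polar_mass (A k) (v k)" for k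
  proof -
    have "ennreal \<delta> \<le> polar_mass {0..<1} (v k)"
      using \<delta>(2)[of k] by (simp add: polar_mass_unit[OF dv] nrm_RM1[OF v] ennreal_leI)
    also have "{0..<1} = A k \<union> B k" using A01 by (auto simp: B_def)
    also have "polar_mass (A k \<union> B k) (v k) \<le> polar_mass (A k) (v k) + polar_mass (B k) (v k)"
      by (rule polar_mass_Un_le[OF dv]) auto
    also have "\<dots> \<le> polar_mass (A k) (v k) + ennreal (\<delta> / 4)" by (intro add_left_mono massB)
    finally have "ennreal \<delta> - ennreal (\<delta> / 4) \<le> polar_mass (A k) (v k)"
      by (simp add: ennreal_minus_le_iff add.commute)
    thus ?thesis using \<delta>(1) by (simp add: ennreal_minus)
  qed
  define X where "X k p = ennreal (norm (a k)) * ennreal (norm (v k (of_real (snd p) * cis (fst p))))" for k p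
  \<comment> \<open>At a radius in \<open>A j\<close> only the term \<open>j\<close> survives on the
    left. It is \<open>w\<close> minus the other terms, and every other index \<open>k\<close> has
    that radius in \<open>B k\<close>. Off all annuli the left side is 0. Stated with indicators,
    the inequality can be integrated once, without splitting the disc.\<close>
  have pt: "(\<Sum>k. X k p * indicator (A k) (snd p)) \<le>
     ennreal (norm (w (of_real (snd p) * cis (fst p)))) * indicator {0..<1} (snd p) + (\<Sum>k. X k p * indicator (B k) (snd p))" for p
  proof (cases "\<exists>j. snd p \<in> A j")
    case False
    thus ?thesis by simp
  next
    case True
    then obtain j where j: "snd p \<in> A j" by blast
    hence r: "snd p \<in> {0..<1}" using A01 by blast
    define z where "z = of_real (snd p) * cis (fst p)"
    have z: "z \<in> ball 0 1" using r by (simp add: z_def norm_mult)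
    have X: "X k p = ennreal (norm (a k * v k z))" for k
      by (simp add: X_def z_def norm_mult ennreal_mult)
    have dj: "snd p \<in> A k \<longleftrightarrow> k = j" for k using disj[of "snd p" k j] j by blast
    have "(\<Sum>k. X k p * indicator (A k) (snd p)) = (\<Sum>k. if k = j then X j p else 0)"
      by (intro suminf_cong) (simp add: indicator_def dj)
    also have "\<dots> = X j p" using sums_single[of j "\<lambda>_. X j p"] by (simp add: sums_iff)
    also have "X j p \<le> ennreal (norm (w z) + (\<Sum>k. if k = j then 0 else norm (a k * v k z)))"
      unfolding X
    proof (rule ennreal_leI)
      have sj: "(\<lambda>k. if k = j then a k * v k z else 0) sums (a j * v j z)"
        using sums_single[of j "\<lambda>k. a k * v k z"] by simp
      have "(\<lambda>k. a k * v k z - (if k = j then a k * v k z else 0)) sums (w z - a j * v j z)"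
        by (intro sums_diff sums(2)[OF z] sj)
      also have "(\<lambda>k. a k * v k z - (if k = j then a k * v k z else 0)) = (\<lambda>k. if k = j then 0 else a k * v k z)"
        by auto
      finally have s: "(\<lambda>k. if k = j then 0 else a k * v k z) sums (w z - a j * v j z)" .
      have sn: "summable (\<lambda>k. norm (if k = j then 0 else a k * v k z))"
        by (rule summable_comparison_test'[OF sums(1)[OF z], where N = 0]) auto
      have "norm (w z - a j * v j z) \<le> (\<Sum>k. norm (if k = j then 0 else a k * v k z))"
        using summable_norm[OF sn] s by (simp add: sums_iff)
      also have "\<dots> = (\<Sum>k. if k = j then 0 else norm (a k * v k z))" by (intro suminf_cong) auto
      finally show "norm (a j * v j z) \<le> norm (w z) + (\<Sum>k. if k = j then 0 else norm (a k * v k z))"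
        using norm_triangle_ineq2[of "a j * v j z" "w z"] by (simp add: norm_minus_commute)
    qed
    also have "\<dots> = ennreal (norm (w z)) + ennreal (\<Sum>k. if k = j then 0 else norm (a k * v k z))"
    proof (rule ennreal_plus)
      show "0 \<le> (\<Sum>k. if k = j then 0 else norm (a k * v k z))"
        by (intro suminf_nonneg summable_comparison_test'[OF sums(1)[OF z], where N = 0]) auto
    qed simp
    also have "ennreal (\<Sum>k. if k = j then 0 else norm (a k * v k z)) = (\<Sum>k. ennreal (if k = j then 0 else norm (a k * v k z)))"
      by (rule suminf_ennreal2[symmetric]) (auto intro!: summable_comparison_test'[OF sums(1)[OF z], where N = 0])
    also have "(\<lambda>k. ennreal (if k = j then 0 else norm (a k * v k z))) = (\<lambda>k. X k p * indicator (B k) (snd p))"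
      using r by (simp add: X B_def indicator_def fun_eq_iff dj)
    finally show ?thesis using r by (simp add: z_def)
  qed
  have intX: "(\<integral>\<^sup>+p. X k p * indicator E (snd p) \<partial>(angle \<Otimes>\<^sub>M lborel)) = ennreal (norm (a k)) * polar_mass E (v k)"
    if [measurable]: "E \<in> sets borel" for k E
    unfolding X_def polar_mass_def mult.assoc by (rule nn_integral_cmult) measurable
  have [measurable]: "X k \<in> borel_measurable (angle \<Otimes>\<^sub>M lborel)" for k unfolding X_def by measurable
  define S where "S = nrm ell1 a"
  have S: "(\<lambda>k. norm (a k)) sums S" using a by (simp add: S_def ell1_def summable_sums)
  have S0: "S \<ge> 0" using nrm_ell1_nonneg[OF a] by (simp add: S_def)
  have sumS: "(\<Sum>k. ennreal (norm (a k)) * ennreal c) = ennreal (S * c)" if "c \<ge> 0" for c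
  proof -
    have "(\<Sum>k. ennreal (norm (a k)) * ennreal c) = (\<Sum>k. ennreal (norm (a k) * c))"
      using that by (simp add: ennreal_mult)
    also have "\<dots> = ennreal (\<Sum>k. norm (a k) * c)"
      using that sums_mult2[OF S, of c] by (intro suminf_ennreal2) (auto simp: sums_iff)
    also have "(\<Sum>k. norm (a k) * c) = S * c" using sums_mult2[OF S, of c] by (simp add: sums_iff)
    finally show ?thesis .
  qed
  have "ennreal (S * (3 * \<delta> / 4)) = (\<Sum>k. ennreal (norm (a k)) * ennreal (3 * \<delta> / 4))"
    using \<delta>(1) by (intro sumS[symmetric]) auto
  also have "\<dots> \<le> (\<Sum>k. ennreal (norm (a k)) * polar_mass (A k) (v k))"
    by (intro suminf_le mult_left_mono massA) auto
  also have "\<dots> = (\<integral>\<^sup>+p. (\<Sum>k. X k p * indicator (A k) (snd p)) \<partial>(angle \<Otimes>\<^sub>M lborel))"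
    by (subst nn_integral_suminf) (auto simp: intX)
  also have "\<dots> \<le> (\<integral>\<^sup>+p. ennreal (norm (w (of_real (snd p) * cis (fst p)))) * indicator {0..<1} (snd p)
      + (\<Sum>k. X k p * indicator (B k) (snd p)) \<partial>(angle \<Otimes>\<^sub>M lborel))"
    by (intro nn_integral_mono pt)
  also have "\<dots> = polar_mass {0..<1} w + (\<Sum>k. ennreal (norm (a k)) * polar_mass (B k) (v k))"
    unfolding polar_mass_def[of "{0..<1}"]
    by (subst nn_integral_add) (auto simp: nn_integral_suminf intX)
  also have "\<dots> \<le> ennreal (nrm (RM 1) w) + (\<Sum>k. ennreal (norm (a k)) * ennreal (\<delta> / 4))"
    by (intro add_mono suminf_le mult_left_mono massB) (auto simp: polar_mass_unit[OF dw] nrm_RM1[OF w])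
  also have "\<dots> = ennreal (nrm (RM 1) w) + ennreal (S * (\<delta> / 4))"
    using \<delta>(1) by (subst sumS) auto
  also have "\<dots> = ennreal (nrm (RM 1) w + S * (\<delta> / 4))"
    using S0 \<delta>(1) nrm_RM_nonneg by (intro ennreal_plus[symmetric]) auto
  finally have "S * (3 * \<delta> / 4) \<le> nrm (RM 1) w + S * (\<delta> / 4)"
    using S0 \<delta>(1) nrm_RM_nonneg[of 1 w] by (subst (asm) ennreal_le_iff) auto
  thus ?thesis by (simp add: S_def field_simps)
qed

section \<open>Series with coefficients in the sequence space\<close>

lemma RM_pointwise_bound:
  assumes q: "1 \<le> q" and f: "f \<in> carr (RM q)" and z: "norm z \<le> \<rho>" and \<rho>: "\<rho> < 1"
  shows "norm (f z) \<le> 4 / (1 - \<rho>)\<^sup>2 * nrm (RM q) f"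
  using RM1_pointwise_bound[OF RM_subset_RM1(1)[OF q f] z \<rho>]
    mult_left_mono[OF RM_subset_RM1(2)[OF q f], of "4 / (1 - \<rho>)\<^sup>2"] by simp

lemma RM_diff:
  assumes q: "1 \<le> q" and "f \<in> carr (RM q)" "h \<in> carr (RM q)"
  shows "(\<lambda>z. f z - h z) \<in> carr (RM q)" "nrm (RM q) (\<lambda>z. f z - h z) \<le> nrm (RM q) f + nrm (RM q) h"
proof -
  interpret normed_fspace "RM q" by (rule normed_fspace_RM[OF q])
  show "(\<lambda>z. f z - h z) \<in> carr (RM q)" by (rule diff_mem[OF assms(2,3)])
  show "nrm (RM q) (\<lambda>z. f z - h z) \<le> nrm (RM q) f + nrm (RM q) h"
    using nrm_triangle[OF assms(2) scale_mem[OF assms(3)], of "-1"] nrm_scale[OF assms(3), of "-1"] by simp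
qed

definition fseries :: "(nat \<Rightarrow> complex \<Rightarrow> complex) \<Rightarrow> (nat \<Rightarrow> complex) \<Rightarrow> complex \<Rightarrow> complex" where
  "fseries u a z = (\<Sum>k. a k * u k z)"

context
  fixes q C :: real and u :: "nat \<Rightarrow> complex \<Rightarrow> complex" and a :: "nat \<Rightarrow> complex"
  assumes q: "1 \<le> q" and u: "\<And>k. u k \<in> carr (RM q)" "\<And>k. nrm (RM q) (u k) \<le> C" and a: "a \<in> carr ell1"
begin

lemma fseries_term_bound:
  assumes "norm z \<le> \<rho>" "\<rho> < 1"
  shows "norm (a k * u k z) \<le> norm (a k) * (4 / (1 - \<rho>)\<^sup>2 * C)"
  unfolding norm_mult
  by (intro mult_left_mono order_trans[OF RM_pointwise_bound[OF q u(1) assms]] mult_left_mono u(2)) auto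

lemma fseries_bound_summable: "summable (\<lambda>k. norm (a k) * c)"
  using a by (auto simp: ell1_def intro: summable_mult2)

lemma fseries_summable:
  assumes "z \<in> ball 0 1" shows "summable (\<lambda>k. norm (a k * u k z))"
  using assms
  by (intro summable_comparison_test'[OF fseries_bound_summable[of "4 / (1 - norm z)\<^sup>2 * C"], where N = 0])
     (use fseries_term_bound[of z "norm z"] in auto)

lemma fseries_uniform_limit:
  assumes "\<rho> < 1"
  shows "uniform_limit (cball 0 \<rho>) (\<lambda>N z. \<Sum>k<N. a k * u k z) (fseries u a) sequentially"
  unfolding fseries_def[abs_def]
  by (rule Weierstrass_m_test[OF _ fseries_bound_summable[of "4 / (1 - \<rho>)\<^sup>2 * C"]])
     (use fseries_term_bound[of _ \<rho>] assms in auto)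

lemma fseries_partial_sum:
  "(\<lambda>z. \<Sum>k<N. a k * u k z) \<in> carr (RM q) \<and> nrm (RM q) (\<lambda>z. \<Sum>k<N. a k * u k z) \<le> (\<Sum>k<N. norm (a k)) * C"
proof (induction N)
  case 0
  interpret normed_fspace "RM q" by (rule normed_fspace_RM[OF q])
  show ?case using zero_mem nrm_0 by simp
next
  case (Suc N)
  interpret normed_fspace "RM q" by (rule normed_fspace_RM[OF q])
  have "nrm (RM q) (\<lambda>z. a N * u N z) \<le> norm (a N) * C"
    using nrm_scale[OF u(1)] u(2) by (simp add: mult_left_mono)
  thus ?case using Suc nrm_triangle[OF conjunct1[OF Suc] scale_mem[OF u(1)], of "a N" N]
      add_mem[OF conjunct1[OF Suc] scale_mem[OF u(1)], of "a N" N] by (simp add: algebra_simps)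
qed

lemma disc_fun_fseries: "disc_fun (fseries u a)"
  unfolding disc_fun_def
proof (intro conjI allI impI)
  show "fseries u a holomorphic_on ball 0 1"
  proof (rule holomorphic_uniform_sequence[OF open_ball])
    show "(\<lambda>z. \<Sum>k<N. a k * u k z) holomorphic_on ball 0 1" for N
      using fseries_partial_sum[of N] by (simp add: mem_RM_iff disc_fun_def)
    fix x :: complex assume x: "x \<in> ball 0 1"
    show "\<exists>d>0. cball x d \<subseteq> ball 0 1 \<and>
        uniform_limit (cball x d) (\<lambda>N z. \<Sum>k<N. a k * u k z) (fseries u a) sequentially"
    proof (intro exI conjI)
      let ?d = "(1 - norm x) / 2"
      show "?d > 0" using x by simp
      have *: "cball x ?d \<subseteq> cball 0 ((1 + norm x) / 2)"
      proof
        fix y assume "y \<in> cball x ?d"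
        hence "norm (y - x) \<le> ?d" by (simp add: dist_norm norm_minus_commute)
        thus "y \<in> cball 0 ((1 + norm x) / 2)"
          using norm_triangle_sub[of y x] by (simp add: field_simps)
      qed
      also have "\<dots> \<subseteq> ball 0 1" using x by auto
      finally show "cball x ?d \<subseteq> ball 0 1" .
      show "uniform_limit (cball x ?d) (\<lambda>N z. \<Sum>k<N. a k * u k z) (fseries u a) sequentially"
        using x by (intro uniform_limit_on_subset[OF fseries_uniform_limit *]) auto
    qed
  qed
  show "fseries u a z = 0" if "z \<notin> ball 0 1" for z
    using u(1) that by (simp add: fseries_def mem_RM_iff disc_fun_def)
qed

text \<open>\<open>RM_Fatou\<close> does the work of completeness: the partial sums are bounded by
  \<open>C * nrm ell1 a\<close> and converge pointwise on the disc.\<close>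

lemma fseries_RM: "fseries u a \<in> carr (RM q)" "nrm (RM q) (fseries u a) \<le> C * nrm ell1 a"
proof -
  have C: "0 \<le> C" using u(2)[of 0] nrm_RM_nonneg[of q "u 0"] by linarith
  have bd: "nrm (RM q) (\<lambda>z. \<Sum>k<N. a k * u k z) \<le> C * nrm ell1 a" for N
    using fseries_partial_sum[of N] mult_left_mono[OF sum_le_nrm_ell1[OF a, of N] C] by (simp add: mult.commute)
  have lim: "(\<lambda>N. \<Sum>k<N. a k * u k z) \<longlonglongrightarrow> fseries u a z" if "z \<in> ball 0 1" for z
    unfolding fseries_def using that by (intro summable_LIMSEQ summable_norm_cancel[OF fseries_summable])
  note F = RM_Fatou[OF q disc_fun_fseries conjunct1[OF fseries_partial_sum] bd lim]
  show "fseries u a \<in> carr (RM q)" by (rule F(1))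
  show "nrm (RM q) (fseries u a) \<le> C * nrm ell1 a" by (rule F(2))
qed

end

section \<open>The dichotomy for locally uniformly null sequences\<close>

lemma T_op_uniform_limit:
  assumes g: "g \<in> Bloch" and w: "\<And>n. disc_fun (w n)" and f: "disc_fun f" and \<rho>: "\<rho> < 1"
    and lim: "uniform_limit (cball 0 \<rho>) w f sequentially"
  shows "uniform_limit (cball 0 \<rho>) (\<lambda>n. T_op g (w n)) (T_op g f) sequentially"
  unfolding uniform_limit_iff
proof (intro allI impI)
  fix e :: real assume e: "e > 0"
  obtain K where K: "K > 0" "\<And>z. z \<in> ball 0 1 \<Longrightarrow> (1 - norm z) * norm (deriv g z) \<le> K"
    using BlochD(2)[OF g] by blast
  define c where "c = K / (1 - \<rho>)"
  have c: "c > 0" using K \<rho> by (simp add: c_def)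
  have "eventually (\<lambda>n. \<forall>z\<in>cball 0 \<rho>. dist (w n z) (f z) < e / (2 * c)) sequentially"
    using lim e c unfolding uniform_limit_iff by simp
  thus "eventually (\<lambda>n. \<forall>z\<in>cball 0 \<rho>. dist (T_op g (w n) z) (T_op g f z) < e) sequentially"
  proof eventually_elim
    case (elim n)
    show ?case
    proof
      fix z :: complex assume z: "z \<in> cball 0 \<rho>"
      let ?d = "\<lambda>x. 1 * w n x + (-1) * f x"
      have d: "disc_fun ?d" by (rule disc_fun_lincomb[OF w f])
      have "norm (T_op g ?d z) \<le> e / (2 * c) * (K / (1 - \<rho>))"
        using z d elim e c
        by (intro T_op_pointwise_bound[OF _ BlochD(1)[OF g] K(2)] less_imp_le[OF K(1)] \<rho>)
           (auto simp: disc_fun_def dist_norm intro: less_imp_le)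
      also have "\<dots> = e / 2" using c by (simp flip: c_def)
      also have "T_op g ?d z = T_op g (w n) z - T_op g f z"
        by (subst T_op_lincomb[OF w f BlochD(1)[OF g]]) simp
      finally show "dist (T_op g (w n) z) (T_op g f z) < e" using e by (simp add: dist_norm)
    qed
  qed
qed

lemma T_op_sum:
  fixes N :: nat
  assumes g: "g holomorphic_on ball 0 1" and u: "\<And>k. disc_fun (u k)"
  shows "T_op g (\<lambda>z. \<Sum>k<N. a k * u k z) = (\<lambda>z. \<Sum>k<N. a k * T_op g (u k) z)"
proof -
  have "disc_fun (\<lambda>z. \<Sum>k<N. a k * u k z) \<and>
      T_op g (\<lambda>z. \<Sum>k<N. a k * u k z) = (\<lambda>z. \<Sum>k<N. a k * T_op g (u k) z)"
  proof (induction N)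
    case 0
    have z: "disc_fun (\<lambda>_. 0)" by (simp add: disc_fun_def)
    thus ?case using T_op_lincomb[OF z z g, of 0 0] by simp
  next
    case (Suc N)
    show ?case
      using disc_fun_lincomb[OF conjunct1[OF Suc] u, of 1 "a N" N]
        T_op_lincomb[OF conjunct1[OF Suc] u g, of 1 "a N" N] Suc by simp
  qed
  thus ?thesis by blast
qed

text \<open>The partial sums converge uniformly on smaller discs, a convergence that
  \<open>T_op g\<close> respects; the hump estimate asks for the exchange only pointwise.\<close>

lemma T_op_fseries_sums:
  assumes g: "g \<in> Bloch" and q: "1 \<le> q" and u: "\<And>k. u k \<in> carr (RM q)" "\<And>k. nrm (RM q) (u k) \<le> C"
    and a: "a \<in> carr ell1" and z: "z \<in> ball 0 1"
  shows "(\<lambda>k. a k * T_op g (u k) z) sums T_op g (fseries u a) z"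
proof -
  have du: "disc_fun (u k)" for k using u by (simp add: mem_RM_iff)
  have "uniform_limit (cball 0 (norm z)) (\<lambda>N. T_op g (\<lambda>z. \<Sum>k<N. a k * u k z)) (T_op g (fseries u a)) sequentially"
    using z fseries_partial_sum[OF q u a]
    by (intro T_op_uniform_limit[OF g] fseries_uniform_limit[OF q u a] disc_fun_fseries[OF q u a])
       (auto simp: mem_RM_iff)
  hence "(\<lambda>N. T_op g (\<lambda>z. \<Sum>k<N. a k * u k z) z) \<longlonglongrightarrow> T_op g (fseries u a) z"
    by (rule tendsto_uniform_limitI) simp
  thus ?thesis unfolding sums_def by (simp add: T_op_sum[OF BlochD(1)[OF g] du])
qed

text \<open>The embedding of the sequence space is \<open>fseries w\<close> for a selection
  \<open>w\<close> of the \<open>u n\<close>: bounded by \<open>C\<close> because the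
  \<open>u n\<close> are, and bounded below after \<open>T_op g\<close> by the hump
  estimate.\<close>

lemma fixes_copy_ell1_of_not_tendsto:
  assumes g: "g \<in> Bloch" and q: "1 \<le> q" and u: "\<And>n. u n \<in> carr (RM q)" "\<And>n. nrm (RM q) (u n) \<le> C"
    and unif: "\<And>\<rho>. \<rho> < 1 \<Longrightarrow> uniform_limit (cball 0 \<rho>) u (\<lambda>_. 0) sequentially"
    and nz: "\<not> (\<lambda>n. nrm (RM 1) (T_op g (u n))) \<longlonglongrightarrow> 0"
  shows "fixes_copy (RM q) (RM 1) ell1 (T_op g)"
proof -
  obtain K where K: "K > 0" "\<And>z. z \<in> ball 0 1 \<Longrightarrow> (1 - norm z) * norm (deriv g z) \<le> K"
    using BlochD(2)[OF g] by blast
  have T: "T_op g f \<in> carr (RM q)" "nrm (RM q) (T_op g f) \<le> K * nrm (RM q) f" if "f \<in> carr (RM q)" for f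
    using T_op_RM[OF BlochD(1)[OF g] _ less_imp_le[OF K(1)] q that] K(2) by blast+
  have T1: "T_op g f \<in> carr (RM 1)" if "f \<in> carr (RM q)" for f by (rule RM_subset_RM1(1)[OF q T(1)[OF that]])
  obtain \<delta> where \<delta>: "\<delta> > 0" "\<And>N. \<exists>n\<ge>N. \<delta> \<le> nrm (RM 1) (T_op g (u n))"
    using nz nrm_RM_nonneg[of 1] unfolding LIMSEQ_iff by (auto simp: not_less)
  \<comment> \<open>The choice need not be increasing; \<open>r N \<ge> N\<close> makes it tend to
    infinity, which preserves locally uniform convergence.\<close>
  then obtain r where r: "\<And>N. r N \<ge> N" "\<And>N. \<delta> \<le> nrm (RM 1) (T_op g (u (r N)))" by metis
  define v where "v N = T_op g (u (r N))" for N
  have v: "v N \<in> carr (RM 1)" for N unfolding v_def by (rule T1[OF u(1)])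
  have v0: "uniform_limit (cball 0 \<rho>) v (\<lambda>_. 0) sequentially" if \<rho>: "\<rho> < 1" for \<rho>
  proof -
    have z: "disc_fun (\<lambda>_. 0)" by (simp add: disc_fun_def)
    have T0: "T_op g (\<lambda>_. 0) = (\<lambda>_. 0)" using T_op_lincomb[OF z z BlochD(1)[OF g], of 0 0] by simp
    have "uniform_limit (cball 0 \<rho>) (\<lambda>n. T_op g (u n)) (\<lambda>_. 0) sequentially"
      using T_op_uniform_limit[OF g _ z \<rho> unif[OF \<rho>]] u(1) T0 by (simp add: mem_RM_iff)
    moreover have "filterlim r at_top sequentially"
      by (rule filterlim_at_top_mono[OF filterlim_ident]) (use r(1) in auto)
    ultimately show ?thesis unfolding v_def[abs_def] uniform_limit_iff by (auto dest: eventually_compose_filterlim)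
  qed
  have "\<delta> / 8 > 0" using \<delta>(1) by simp
  obtain R n where R: "strict_mono R" "\<And>k. 0 \<le> R k" "\<And>k. R k < 1"
    and Rv: "\<And>k. polar_mass {0..R k} (v (n k)) \<le> ennreal (\<delta> / 8)"
            "\<And>k. polar_mass {R (Suc k)<..<1} (v (n k)) \<le> ennreal (\<delta> / 8)"
  proof (rule gliding_hump_radii[OF v v0 \<open>\<delta> / 8 > 0\<close>])
  qed (assumption, rule that)
  define w where "w k = u (r (n k))" for k
  have w: "w k \<in> carr (RM q)" "nrm (RM q) (w k) \<le> C" for k unfolding w_def by (rule u)+
  have Tw: "T_op g (w k) \<in> carr (RM q)" "nrm (RM q) (T_op g (w k)) \<le> K * C" for k
    using T(1)[OF w(1)] order_trans[OF T(2)[OF w(1)] mult_left_mono[OF w(2) less_imp_le[OF K(1)]]] by blast+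
  show ?thesis
  proof (rule fixes_copy_ell1I[OF normed_fspace_RM[OF q]])
    show "bounded_operator (RM q) (RM 1) (T_op g)" by (rule bounded_operator_T_op[OF g q])
    have lin: "fseries w (\<lambda>k. s * a k + t * b k) = (\<lambda>z. s * fseries w a z + t * fseries w b z)"
      if a: "a \<in> carr ell1" and b: "b \<in> carr ell1" for a b s t
    proof
      fix z
      show "fseries w (\<lambda>k. s * a k + t * b k) z = s * fseries w a z + t * fseries w b z"
      proof (cases "z \<in> ball 0 1")
        case True
        have "summable (\<lambda>k. a k * w k z)" "summable (\<lambda>k. b k * w k z)"
          using summable_norm_cancel[OF fseries_summable[where u = w, OF q w a True]]
            summable_norm_cancel[OF fseries_summable[where u = w, OF q w b True]] by blast+
        thus ?thesis unfolding fseries_def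
          by (simp add: suminf_mult[symmetric] suminf_add summable_mult algebra_simps)
      next
        case False
        thus ?thesis using w(1) by (simp add: fseries_def mem_RM_iff disc_fun_def)
      qed
    qed
    show "bounded_operator ell1 (RM q) (fseries w)"
      unfolding bounded_operator_def
      by (intro conjI ballI allI image_subsetI exI[of _ C] lin fseries_RM[OF q w])
    show "\<delta> / 2 > 0" using \<delta> by simp
    fix a assume a: "a \<in> carr ell1"
    show "\<delta> / 2 * nrm ell1 a \<le> nrm (RM 1) (T_op g (fseries w a))"
    proof (rule gliding_hump_lower_bound[OF _ R])
      show "T_op g (w k) \<in> carr (RM 1)" for k by (rule T1[OF w(1)])
      show "polar_mass {0..R k} (T_op g (w k)) \<le> ennreal (\<delta> / 8)"
        "polar_mass {R (Suc k)<..<1} (T_op g (w k)) \<le> ennreal (\<delta> / 8)" for k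
        using Rv[of k] by (simp_all add: v_def w_def)
      show "\<delta> \<le> nrm (RM 1) (T_op g (w k))" for k using r(2) by (simp add: w_def)
      show "T_op g (fseries w a) \<in> carr (RM 1)" by (intro T1 fseries_RM[OF q w a])
      show "summable (\<lambda>k. norm (a k * T_op g (w k) z))" if "z \<in> ball 0 1" for z
        by (rule fseries_summable[OF q Tw a that])
      show "(\<lambda>k. a k * T_op g (w k) z) sums T_op g (fseries w a) z" if "z \<in> ball 0 1" for z
        by (rule T_op_fseries_sums[OF g q w a that])
    qed (use \<delta> a in auto)
  qed
qed

section \<open>Compactness of the image of the unit ball\<close>

lemma compact_subset_unit_ball:
  fixes K :: "complex set"
  assumes "compact K" "K \<subseteq> ball 0 1"
  shows "\<exists>\<rho><1. K \<subseteq> cball 0 \<rho>"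
proof (cases "K = {}")
  case False
  obtain x where x: "x \<in> K" "\<And>y. y \<in> K \<Longrightarrow> norm y \<le> norm x"
    using continuous_attains_sup[OF assms(1) False continuous_on_norm_id] by blast
  thus ?thesis using assms(2) by (intro exI[of _ "norm x"]) auto
qed (auto intro: exI[of _ 0])

text \<open>The image itself is compact, not merely its closure, since a Montel limit stays in the
  unit ball by \<open>RM_Fatou\<close>. The bound 2 in \<open>null\<close> is that of a difference
  of two members of the unit ball.\<close>

lemma compactin_image_unit_ball:
  assumes g: "g \<in> Bloch" and q: "1 \<le> q"
    and null: "\<And>u. (\<And>n. u n \<in> carr (RM q)) \<Longrightarrow> (\<And>n. nrm (RM q) (u n) \<le> 2) \<Longrightarrow>
           (\<And>\<rho>. \<rho> < 1 \<Longrightarrow> uniform_limit (cball 0 \<rho>) u (\<lambda>_. 0) sequentially) \<Longrightarrow>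
           (\<lambda>n. nrm (RM 1) (T_op g (u n))) \<longlonglongrightarrow> 0"
  shows "compactin (norm_topology (RM 1)) (T_op g ` unit_ball (RM q))"
proof -
  interpret normed_fspace "RM 1" by (rule normed_fspace_RM) simp
  interpret M: Metric_space "carr (RM 1)" "\<lambda>f g. nrm (RM 1) (\<lambda>x. f x - g x)" by (rule Metric_space_nrm)
  have T1: "T_op g f \<in> carr (RM 1)" if "f \<in> carr (RM q)" for f
    using bounded_operator_T_op(2)[OF g q] that by (auto simp: bounded_operator_def)
  show ?thesis
    unfolding norm_topology_def M.compactin_sequentially
  proof (intro conjI allI impI)
    show "T_op g ` unit_ball (RM q) \<subseteq> carr (RM 1)" using T1 by (auto simp: unit_ball_def)
    fix \<sigma> :: "nat \<Rightarrow> complex \<Rightarrow> complex" assume "range \<sigma> \<subseteq> T_op g ` unit_ball (RM q)"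
    hence "\<forall>n. \<exists>f. f \<in> unit_ball (RM q) \<and> \<sigma> n = T_op g f" by auto
    then obtain f where f: "\<And>n. f n \<in> unit_ball (RM q)" "\<And>n. \<sigma> n = T_op g (f n)" by metis
    hence fq: "f n \<in> carr (RM q)" "nrm (RM q) (f n) \<le> 1" for n by (auto simp: unit_ball_def)
    obtain h r where h: "h holomorphic_on ball 0 1" and r: "strict_mono (r :: nat \<Rightarrow> nat)"
      and pt: "\<And>x. x \<in> ball 0 1 \<Longrightarrow> (\<lambda>n. f (r n) x) \<longlonglongrightarrow> h x"
      and un: "\<And>K. compact K \<Longrightarrow> K \<subseteq> ball 0 1 \<Longrightarrow> uniform_limit K (f \<circ> r) h sequentially"
    proof (rule Montel[of "ball 0 1" "unit_ball (RM q)" f])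
      show "\<exists>B. \<forall>h\<in>unit_ball (RM q). \<forall>z\<in>K. norm (h z) \<le> B" if K: "compact K" "K \<subseteq> ball 0 1" for K
      proof -
        obtain \<rho> where \<rho>: "\<rho> < 1" "K \<subseteq> cball 0 \<rho>" using compact_subset_unit_ball[OF K] by blast
        have "norm (h z) \<le> 4 / (1 - \<rho>)\<^sup>2 * 1" if "h \<in> unit_ball (RM q)" "z \<in> K" for h z
        proof -
          have "norm (h z) \<le> 4 / (1 - \<rho>)\<^sup>2 * nrm (RM q) h"
            using that \<rho> by (intro RM_pointwise_bound[OF q]) (auto simp: unit_ball_def)
          also have "\<dots> \<le> 4 / (1 - \<rho>)\<^sup>2 * 1" using that by (intro mult_left_mono) (auto simp: unit_ball_def)
          finally show ?thesis .
        qed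
        thus ?thesis by blast
      qed
    qed (use f(1) in \<open>auto simp: unit_ball_def mem_RM_iff disc_fun_def\<close>)
    \<comment> \<open>Montel's theorem controls the limit only on the disc; the cut-off puts it into
      the carrier.\<close>
    define l where "l z = (if z \<in> ball 0 1 then h z else 0)" for z
    have "l holomorphic_on ball 0 1" by (rule holomorphic_transform[OF h]) (simp add: l_def)
    hence dl: "disc_fun l" by (simp add: disc_fun_def l_def)
    have l: "l \<in> carr (RM q)" "nrm (RM q) l \<le> 1"
      using RM_Fatou[OF q dl, of "\<lambda>n. f (r n)" 1] fq pt by (auto simp: l_def)
    define u where "u n = (\<lambda>z. f (r n) z - l z)" for n
    have "(\<lambda>n. nrm (RM 1) (T_op g (u n))) \<longlonglongrightarrow> 0"
    proof (rule null)
      show "u n \<in> carr (RM q)" for n unfolding u_def by (rule RM_diff(1)[OF q fq(1) l(1)])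
      show "nrm (RM q) (u n) \<le> 2" for n
        using RM_diff(2)[OF q fq(1)[of "r n"] l(1)] fq(2)[of "r n"] l(2) by (simp add: u_def)
      fix \<rho> :: real assume \<rho>: "\<rho> < 1"
      hence sub: "cball 0 \<rho> \<subseteq> (ball 0 1 :: complex set)" by auto
      have "uniform_limit (cball 0 \<rho>) (f \<circ> r) h sequentially" by (rule un[OF _ sub]) simp
      thus "uniform_limit (cball 0 \<rho>) u (\<lambda>_. 0) sequentially"
        unfolding uniform_limit_iff
      proof (intro allI impI)
        fix e :: real assume "e > 0"
        hence "eventually (\<lambda>n. \<forall>x\<in>cball 0 \<rho>. dist ((f \<circ> r) n x) (h x) < e) sequentially"
          using \<open>uniform_limit (cball 0 \<rho>) (f \<circ> r) h sequentially\<close> unfolding uniform_limit_iff by blast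
        thus "eventually (\<lambda>n. \<forall>x\<in>cball 0 \<rho>. dist (u n x) 0 < e) sequentially"
        proof eventually_elim
          case (elim n)
          show ?case
          proof
            fix z :: complex assume z: "z \<in> cball 0 \<rho>"
            hence "z \<in> ball 0 1" using sub by blast
            thus "dist (u n z) 0 < e" using elim[rule_format, OF z] by (simp add: u_def l_def dist_norm)
          qed
        qed
      qed
    qed
    moreover have "T_op g (u n) = (\<lambda>x. (\<sigma> \<circ> r) n x - T_op g l x)" for n
      unfolding u_def using T_op_lincomb[OF _ dl BlochD(1)[OF g], of "f (r n)" 1 "-1"] fq(1) f(2)
      by (simp add: mem_RM_iff)
    ultimately have "(\<lambda>n. nrm (RM 1) (\<lambda>x. (\<sigma> \<circ> r) n x - T_op g l x)) \<longlonglongrightarrow> 0" by simp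
    moreover have "T_op g l \<in> T_op g ` unit_ball (RM q)" using l by (auto simp: unit_ball_def)
    ultimately show "\<exists>l r. l \<in> T_op g ` unit_ball (RM q) \<and> strict_mono r \<and> limitin M.mtopology (\<sigma> \<circ> r) l sequentially"
      using r T1[OF l(1)] T1[OF fq(1)] f(2)
      by (intro exI[of _ "T_op g l"] exI[of _ r]) (auto simp: M.limitin_metric_dist_null)
  qed
qed


section \<open>Weak convergence\<close>

text \<open>A weak form of the Brezis--Lieb lemma. The coefficient \<open>1\<close> of \<open>s\<^sup>q\<close> is what makes the \<open>q\<close>-th
  powers of the norms of the partial sums in \<open>RM_dual_small\<close> grow only linearly.\<close>

lemma powr_add_le:
  fixes s h q L :: real
  assumes q: "1 \<le> q" and sh: "0 \<le> s" "0 \<le> h" and L: "0 < L"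
  shows "(s + h) powr q \<le> s powr q + q * 2 powr q * h powr q + q * 2 powr q * L powr (q - 1) * h
           + (if s > L then q * 2 powr q * s powr q else 0)"
proof -
  have K: "2 powr q \<le> q * 2 powr q" using q by simp
  have pos: "0 \<le> q * 2 powr q * h powr q" "0 \<le> q * 2 powr q * L powr (q - 1) * h" 
    "0 \<le> (if s > L then q * 2 powr q * s powr q else 0)" "0 \<le> s powr q"
    using q sh by auto
  \<comment> \<open>In the first two cases the crude estimate by twice the larger summand is
    absorbed by the term in \<open>h powr q\<close> or by the truncation term. The coefficient 1
    needs care only when \<open>h < s \<le> L\<close>.\<close>
  consider "s \<le> h" | "h < s" "s > L" | "h < s" "s \<le> L" by linarith
  thus ?thesis
  proof cases
    case 1
    have "(s + h) powr q \<le> (2 * h) powr q" using 1 sh q by (intro powr_mono2) auto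
    also have "\<dots> = 2 powr q * h powr q" using sh by (simp add: powr_mult)
    also have "\<dots> \<le> q * 2 powr q * h powr q" using K by (intro mult_right_mono) auto
    finally show ?thesis using pos by linarith
  next
    case 2
    have "(s + h) powr q \<le> (2 * s) powr q" using 2 sh q by (intro powr_mono2) auto
    also have "\<dots> = 2 powr q * s powr q" using sh by (simp add: powr_mult)
    also have "\<dots> \<le> q * 2 powr q * s powr q" using K by (intro mult_right_mono) auto
    also have "\<dots> = (if s > L then q * 2 powr q * s powr q else 0)" using 2 by simp
    finally show ?thesis using pos by linarith
  next
    case 3
    \<comment> \<open>Young's inequality for \<open>s * x powr (q - 1)\<close> amounts to the
      tangent estimate at \<open>x\<close>: the increment of the power is at most
      \<open>q * x powr (q - 1) * h\<close>, and \<open>x\<close> is below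
      \<open>2 * L\<close>.\<close>
    define x where "x = s + h"
    have x: "x > 0" "s > 0" using 3 sh by (auto simp: x_def)
    have "s * x powr (q - 1) \<le> (1 / q) * s powr q + (1 - 1 / q) * x powr q"
      using Youngs_inequality_0[of "1/q" "1 - 1/q" "s powr q" "x powr q"] q x
      by (simp add: powr_powr right_diff_distrib)
    hence "q * (s * x powr (q - 1)) \<le> q * ((1 / q) * s powr q + (1 - 1 / q) * x powr q)"
      using q by (intro mult_left_mono) auto
    also have "\<dots> = s powr q + (q - 1) * x powr q" using q by (simp add: field_simps)
    also have "x powr q = x powr (q - 1) * x" using x powr_add[of x "q - 1" 1] by simp
    finally have "x powr q \<le> s powr q + q * x powr (q - 1) * h"
      using x powr_add[of x "q - 1" 1] by (simp add: x_def algebra_simps)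
    also have "q * x powr (q - 1) * h \<le> q * (2 * L) powr (q - 1) * h"
      using 3 x q sh by (intro mult_right_mono mult_left_mono powr_mono2) (auto simp: x_def)
    also have "(2 * L) powr (q - 1) = 2 powr (q - 1) * L powr (q - 1)" using L by (simp add: powr_mult)
    also have "q * (2 powr (q - 1) * L powr (q - 1)) * h \<le> q * (2 powr q * L powr (q - 1)) * h"
      using q sh by (intro mult_right_mono mult_left_mono powr_mono) auto
    finally show ?thesis using pos by (simp add: x_def mult_ac)
  qed
qed

lemma epowr_add_le_tail:
  assumes q: "1 \<le> q" and L: "0 < L"
  shows "epowr (s + h) q \<le> epowr s q + ennreal (q * 2 powr q) * epowr h q
     + ennreal (q * 2 powr q * L powr (q - 1)) * h
     + ennreal (q * 2 powr q) * (epowr s q * indicator {ennreal L<..} s)"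
proof (cases "s = top \<or> h = top")
  case True
  have "q * 2 powr q > 0" using q by simp
  hence "ennreal (q * 2 powr q) \<noteq> 0" by (simp only: ennreal_eq_0_iff not_le)
  thus ?thesis using True by (auto simp: ennreal_mult_top)
next
  case False
  then obtain x y where xy: "s = ennreal x" "0 \<le> x" "h = ennreal y" "0 \<le> y" by (metis ennreal_cases)
  have ind: "epowr s q * indicator {ennreal L<..} s = ennreal (if x > L then x powr q else 0)"
    using xy L by (auto simp: indicator_def epowr_ennreal ennreal_less_iff)
  have "epowr (s + h) q = ennreal ((x + y) powr q)"
    using xy by (simp add: epowr_ennreal flip: ennreal_plus)
  also have "\<dots> \<le> ennreal (x powr q + q * 2 powr q * y powr q + q * 2 powr q * L powr (q - 1) * y
           + q * 2 powr q * (if x > L then x powr q else 0))"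
    using powr_add_le[OF q xy(2,4) L] by (intro ennreal_leI) (auto split: if_splits)
  also have "\<dots> = epowr s q + ennreal (q * 2 powr q) * epowr h q
     + ennreal (q * 2 powr q * L powr (q - 1)) * h
     + ennreal (q * 2 powr q) * (epowr s q * indicator {ennreal L<..} s)"
    unfolding ind using xy q by (simp add: epowr_ennreal ennreal_plus ennreal_mult)
  finally show ?thesis .
qed

text \<open>Where the power is finite, the truncated integrand is eventually 0; the full power
  dominates it. This later fixes the truncation level \<open>L\<close> for one given
  function.\<close>

lemma nn_integral_tail_tendsto_0:
  assumes [measurable]: "S \<in> borel_measurable M" and fin: "(\<integral>\<^sup>+t. epowr (S t) q \<partial>M) < top"
  shows "(\<lambda>n. \<integral>\<^sup>+t. epowr (S t) q * indicator {ennreal (real (Suc n))<..} (S t) \<partial>M) \<longlonglongrightarrow> 0"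
proof -
  have "(\<lambda>n. \<integral>\<^sup>+t. epowr (S t) q * indicator {ennreal (real (Suc n))<..} (S t) \<partial>M) \<longlonglongrightarrow> (\<integral>\<^sup>+t. 0 \<partial>M)"
  proof (rule nn_integral_dominated_convergence[where w = "\<lambda>t. epowr (S t) q"])
    show "AE t in M. epowr (S t) q * indicator {ennreal (real (Suc n))<..} (S t) \<le> epowr (S t) q" for n
      by (auto simp: indicator_def)
    have "AE t in M. epowr (S t) q \<noteq> \<infinity>"
      using fin by (intro nn_integral_PInf_AE) auto
    thus "AE t in M. (\<lambda>n. epowr (S t) q * indicator {ennreal (real (Suc n))<..} (S t)) \<longlonglongrightarrow> 0"
    proof eventually_elim
      case (elim t)
      hence "S t \<noteq> top" by auto
      then obtain x where x: "S t = ennreal x" "0 \<le> x" by (metis ennreal_cases)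
      obtain N where N: "x \<le> real N" using real_arch_simple by blast
      have "epowr (S t) q * indicator {ennreal (real (Suc n))<..} (S t) = 0" if "n \<ge> N" for n
      proof -
        have "x \<le> real (Suc n)" using N that by simp
        thus ?thesis using x by (auto simp: indicator_def ennreal_less_iff simp del: of_nat_Suc)
      qed
      thus ?case by (intro tendsto_eventually) (auto simp: eventually_sequentially)
    qed
  qed (use fin in auto)
  thus ?thesis by simp
qed

text \<open>Three errors arise from \<open>epowr_add_le_tail\<close>: the power of \<open>h\<close>
  is bounded through \<open>C\<close>, the truncation term is at most 1/2 for a level
  \<open>L\<close> depending on \<open>f\<close>, and the term linear in \<open>h\<close> is at most
  1/2 once the \<open>RM 1\<close> norm is small against \<open>L powr (q - 1)\<close>. So
  \<open>\<delta>\<close> depends on \<open>f\<close> but the added energy does not.\<close>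

lemma RM_add_energy:
  assumes q: "1 \<le> q" and f: "f \<in> carr (RM q)" and C: "0 \<le> C"
  shows "\<exists>\<delta>>0. \<forall>h\<in>carr (RM q). nrm (RM q) h \<le> C \<longrightarrow> nrm (RM 1) h < \<delta> \<longrightarrow>
     (\<integral>\<^sup>+t. epowr (radial (\<lambda>z. f z + h z) t) q \<partial>angle) \<le>
     (\<integral>\<^sup>+t. epowr (radial f t) q \<partial>angle) + ennreal (q * 2 powr q * C powr q + 1)"
proof -
  define K where "K = q * 2 powr q"
  have K: "K > 0" using q by (simp add: K_def)
  have df: "disc_fun f" using f by (simp add: mem_RM_iff)
  have [measurable]: "f \<in> borel_measurable borel" by (rule disc_fun_measurable[OF df])
  have "(\<integral>\<^sup>+t. epowr (radial f t) q \<partial>angle) \<le> ennreal (nrm (RM q) f powr q)"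
    using q by (intro RM_leD f) auto
  hence fin: "(\<integral>\<^sup>+t. epowr (radial f t) q \<partial>angle) < top" by (rule order.strict_trans1) simp
  have "eventually (\<lambda>n. (\<integral>\<^sup>+t. epowr (radial f t) q * indicator {ennreal (real (Suc n))<..} (radial f t) \<partial>angle)
          < ennreal (1 / (2 * K))) sequentially"
    using K by (intro order_tendstoD(2)[OF nn_integral_tail_tendsto_0[OF _ fin]]) auto
  then obtain n where n: "(\<integral>\<^sup>+t. epowr (radial f t) q * indicator {ennreal (real (Suc n))<..} (radial f t) \<partial>angle)
          < ennreal (1 / (2 * K))"
    by (auto simp: eventually_sequentially simp del: of_nat_Suc)
  define L where "L = real (Suc n)"
  have L: "L > 0" by (simp add: L_def)
  define c where "c = K * L powr (q - 1)"
  have c: "c > 0" using K L by (simp add: c_def)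
  show ?thesis
  proof (intro exI[of _ "1 / (2 * c)"] conjI ballI impI)
    show "1 / (2 * c) > 0" using c by simp
    fix h assume h: "h \<in> carr (RM q)" "nrm (RM q) h \<le> C" "nrm (RM 1) h < 1 / (2 * c)"
    have dh: "disc_fun h" using h by (simp add: mem_RM_iff)
    have [measurable]: "h \<in> borel_measurable borel" by (rule disc_fun_measurable[OF dh])
    let ?S = "radial f" and ?H = "radial h"
    have "(\<integral>\<^sup>+t. epowr (radial (\<lambda>z. f z + h z) t) q \<partial>angle) \<le> (\<integral>\<^sup>+t. epowr (?S t + ?H t) q \<partial>angle)"
      using q by (intro nn_integral_mono epowr_mono radial_add_le) auto
    also have "\<dots> \<le> (\<integral>\<^sup>+t. epowr (?S t) q + ennreal K * epowr (?H t) q + ennreal c * ?H t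
        + ennreal K * (epowr (?S t) q * indicator {ennreal L<..} (?S t)) \<partial>angle)"
      unfolding K_def c_def by (intro nn_integral_mono epowr_add_le_tail q L)
    also have "\<dots> = (\<integral>\<^sup>+t. epowr (?S t) q \<partial>angle) + ennreal K * (\<integral>\<^sup>+t. epowr (?H t) q \<partial>angle)
        + ennreal c * (\<integral>\<^sup>+t. ?H t \<partial>angle)
        + ennreal K * (\<integral>\<^sup>+t. epowr (?S t) q * indicator {ennreal L<..} (?S t) \<partial>angle)"
      by (simp add: nn_integral_add nn_integral_cmult)
    also have "\<dots> \<le> (\<integral>\<^sup>+t. epowr (?S t) q \<partial>angle) + ennreal K * ennreal (C powr q)
        + ennreal c * ennreal (1 / (2 * c)) + ennreal K * ennreal (1 / (2 * K))"
    proof (intro add_mono mult_left_mono order_refl)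
      show "(\<integral>\<^sup>+t. epowr (?H t) q \<partial>angle) \<le> ennreal (C powr q)" using q by (intro RM_leD h) auto
      show "(\<integral>\<^sup>+t. ?H t \<partial>angle) \<le> ennreal (1 / (2 * c))"
        using h(3) by (simp add: nrm_RM1[OF RM_subset_RM1(1)[OF q h(1)]] ennreal_leI)
      show "(\<integral>\<^sup>+t. epowr (?S t) q * indicator {ennreal L<..} (?S t) \<partial>angle) \<le> ennreal (1 / (2 * K))"
        using n by (simp add: L_def less_imp_le del: of_nat_Suc)
    qed auto
    also have "\<dots> = (\<integral>\<^sup>+t. epowr (?S t) q \<partial>angle) + (ennreal (K * C powr q) + ennreal (1 / 2) + ennreal (1 / 2))"
      using K c by (simp add: add.assoc flip: ennreal_mult)
    also have "ennreal (K * C powr q) + ennreal (1 / 2) + ennreal (1 / 2) = ennreal (K * C powr q + 1)"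
      using K ennreal_plus[of "K * C powr q + 1 / 2" "1 / 2"] ennreal_plus[of "K * C powr q" "1 / 2"] by simp
    finally show "(\<integral>\<^sup>+t. epowr (radial (\<lambda>z. f z + h z) t) q \<partial>angle) \<le>
        (\<integral>\<^sup>+t. epowr (?S t) q \<partial>angle) + ennreal (q * 2 powr q * C powr q + 1)"
      by (simp add: K_def)
  qed
qed

text \<open>Otherwise one could add up \<open>N\<close> small functions on each of which \<open>\<phi>\<close> is at least \<open>\<epsilon>\<close>, with a
  sum of norm \<open>O(N\<^sup>1\<^sup>/\<^sup>q)\<close>; this is where \<open>1 < q\<close> enters.\<close>

lemma RM_dual_small:
  assumes q: "1 < q" and \<phi>: "\<phi> \<in> dual_space (RM q)" and \<epsilon>: "\<epsilon> > 0" and C: "0 \<le> C"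
  shows "\<exists>\<delta>>0. \<forall>h\<in>carr (RM q). nrm (RM q) h \<le> C \<longrightarrow> nrm (RM 1) h < \<delta> \<longrightarrow> norm (\<phi> h) < \<epsilon>"
proof (rule ccontr)
  assume contra: "\<not> ?thesis"
  have q1: "1 \<le> q" using q by simp
  have q0: "q > 0" using q by simp
  interpret normed_fspace "RM q" by (rule normed_fspace_RM[OF q1])
  have lin: "\<phi> (\<lambda>z. a * f z + b * h z) = a * \<phi> f + b * \<phi> h" if "f \<in> carr (RM q)" "h \<in> carr (RM q)" for f h a b
    using \<phi> that unfolding dual_space_def by blast
  obtain D where D: "\<And>f. f \<in> carr (RM q) \<Longrightarrow> norm (\<phi> f) \<le> D * nrm (RM q) f"
    using \<phi> unfolding dual_space_def by blast
  define E where "E = q * 2 powr q * C powr q + 1"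
  have E: "E > 0" using q by (simp add: E_def add_nonneg_pos)
  \<comment> \<open>Each summand raises the energy by at most \<open>E\<close> and the value of
    \<open>\<phi>\<close> by at least \<open>\<epsilon>\<close>; it is chosen after the previous
    sum, on which its \<open>\<delta>\<close> depends.\<close>
  have claim: "\<exists>f\<in>carr (RM q). (\<integral>\<^sup>+t. epowr (radial f t) q \<partial>angle) \<le> ennreal (real N * E) \<and>
     (\<exists>x\<ge>real N * \<epsilon>. \<phi> f = of_real x)" for N
  proof (induction N)
    case 0
    have "\<phi> (\<lambda>_. 0) = 0" using lin[OF zero_mem zero_mem, of 0 0] by simp
    thus ?case using zero_mem by (intro bexI[of _ "\<lambda>_. 0"]) (auto simp: radial_def)
  next
    case (Suc N)
    then obtain f x where f: "f \<in> carr (RM q)" "(\<integral>\<^sup>+t. epowr (radial f t) q \<partial>angle) \<le> ennreal (real N * E)"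
      "x \<ge> real N * \<epsilon>" "\<phi> f = of_real x" by blast
    obtain \<delta> where \<delta>: "\<delta> > 0" and add: "\<And>h. h \<in> carr (RM q) \<Longrightarrow> nrm (RM q) h \<le> C \<Longrightarrow> nrm (RM 1) h < \<delta> \<Longrightarrow>
       (\<integral>\<^sup>+t. epowr (radial (\<lambda>z. f z + h z) t) q \<partial>angle) \<le> (\<integral>\<^sup>+t. epowr (radial f t) q \<partial>angle) + ennreal E"
      using RM_add_energy[OF q1 f(1) C] unfolding E_def by blast
    obtain h where h: "h \<in> carr (RM q)" "nrm (RM q) h \<le> C" "nrm (RM 1) h < \<delta>" "norm (\<phi> h) \<ge> \<epsilon>"
      using contra \<delta> by (meson not_less)
    \<comment> \<open>The rotation makes the values of \<open>\<phi>\<close> positive reals, so that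
      they add up without cancellation.\<close>
    define c where "c = of_real (norm (\<phi> h)) / \<phi> h"
    have \<phi>h: "\<phi> h \<noteq> 0" using h(4) \<epsilon> by auto
    hence c: "norm c = 1" "c * \<phi> h = of_real (norm (\<phi> h))" by (auto simp: c_def norm_divide)
    let ?h = "\<lambda>z. c * h z"
    have h': "?h \<in> carr (RM q)" "nrm (RM q) ?h \<le> C" "nrm (RM 1) ?h < \<delta>"
      using RM_scale[OF h(1) q0, of c] RM_scale[OF RM_subset_RM1(1)[OF q1 h(1)], of c] h c by auto
    show ?case
    proof (intro bexI[of _ "\<lambda>z. f z + ?h z"] conjI exI[of _ "x + norm (\<phi> h)"])
      have "(\<integral>\<^sup>+t. epowr (radial (\<lambda>z. f z + ?h z) t) q \<partial>angle) \<le> ennreal (real N * E) + ennreal E"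
        using add[OF h'] f(2) by (meson add_right_mono order_trans)
      also have "\<dots> = ennreal (real (Suc N) * E)" using E by (simp add: algebra_simps flip: ennreal_plus)
      finally show "(\<integral>\<^sup>+t. epowr (radial (\<lambda>z. f z + ?h z) t) q \<partial>angle) \<le> ennreal (real (Suc N) * E)" .
      show "x + norm (\<phi> h) \<ge> real (Suc N) * \<epsilon>" using f(3) h(4) by (simp add: algebra_simps)
      show "\<phi> (\<lambda>z. f z + ?h z) = of_real (x + norm (\<phi> h))"
        using lin[OF f(1) h(1), of 1 c] f(4) c(2) by simp
      show "(\<lambda>z. f z + ?h z) \<in> carr (RM q)" by (rule add_mem[OF f(1) h'(1)])
    qed
  qed
  \<comment> \<open>A value of at least \<open>real N * \<epsilon>\<close> against a norm of at most
    \<open>(real N * E) powr (1 / q)\<close> bounds \<open>real N powr p\<close> by \<open>A\<close>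
    for all \<open>N\<close>, which is absurd as \<open>p\<close> is positive.\<close>
  define p where "p = 1 - 1 / q"
  have p: "p > 0" using q by (simp add: p_def)
  define A where "A = \<bar>D\<bar> * E powr (1 / q) / \<epsilon>"
  have A: "A \<ge> 0" using \<epsilon> by (simp add: A_def)
  have bound: "real N powr p \<le> A" if N: "N > 0" for N :: nat
  proof -
    obtain f x where f: "f \<in> carr (RM q)" "(\<integral>\<^sup>+t. epowr (radial f t) q \<partial>angle) \<le> ennreal (real N * E)"
      "x \<ge> real N * \<epsilon>" "\<phi> f = of_real x" using claim[of N] by blast
    let ?\<alpha> = "(real N * E) powr (1 / q)"
    have "nrm (RM q) f \<le> ?\<alpha>"
      using f q E N by (intro RM_leI) (auto simp: mem_RM_iff powr_powr)
    have "real N * \<epsilon> \<le> norm (\<phi> f)" using f(3,4) by simp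
    also have "\<dots> \<le> \<bar>D\<bar> * nrm (RM q) f"
      using D[OF f(1)] mult_right_mono[OF abs_ge_self nrm_nonneg, of D f] by linarith
    also have "\<dots> \<le> \<bar>D\<bar> * ?\<alpha>" using \<open>nrm (RM q) f \<le> ?\<alpha>\<close> by (intro mult_left_mono) auto
    also have "?\<alpha> = real N powr (1 / q) * E powr (1 / q)" using E by (simp add: powr_mult)
    finally have "real N * \<epsilon> \<le> A * \<epsilon> * real N powr (1 / q)" using \<epsilon> by (simp add: A_def mult_ac)
    moreover have "real N = real N powr p * real N powr (1 / q)"
      using N by (simp add: p_def flip: powr_add)
    ultimately have "real N powr p * (\<epsilon> * real N powr (1 / q)) \<le> A * (\<epsilon> * real N powr (1 / q))"
      by (metis (no_types, opaque_lifting) mult.assoc mult.commute)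
    thus ?thesis using N \<epsilon> by (subst (asm) mult_le_cancel_right_pos) auto
  qed
  obtain N where N: "A powr (1 / p) < real N" using reals_Archimedean2 by blast
  have "N > 0" using N powr_ge_zero[of A "1/p"] by (cases N) auto
  have "(A powr (1 / p)) powr p < real N powr p" using N p by (intro powr_less_mono2) auto
  hence "A < real N powr p" using p A by (simp add: powr_powr)
  thus False using bound[OF \<open>N > 0\<close>] by simp
qed

text \<open>By \<open>RM_dual_small\<close> the identity of \<open>K\<close>, from the metric of
  \<open>RM 1\<close> to the weak topology of \<open>RM q\<close>, is continuous: differences of
  members of \<open>K\<close> are bounded by \<open>C + C\<close> in \<open>RM q\<close>.
  Compactness passes to the image.\<close>

lemma compactin_RM1_imp_weakly:
  assumes q: "1 < q" and K: "compactin (norm_topology (RM 1)) K"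
    and KC: "\<And>f. f \<in> K \<Longrightarrow> f \<in> carr (RM q) \<and> nrm (RM q) f \<le> C"
  shows "compactin (weak_topology (RM q)) K"
proof -
  have q1: "1 \<le> q" using q by simp
  interpret Q: normed_fspace "RM q" by (rule normed_fspace_RM[OF q1])
  interpret R: normed_fspace "RM 1" by (rule normed_fspace_RM) simp
  interpret M: Metric_space "carr (RM 1)" "\<lambda>f g. nrm (RM 1) (\<lambda>x. f x - g x)" by (rule R.Metric_space_nrm)
  have K1: "K \<subseteq> carr (RM 1)" using KC RM_subset_RM1(1)[OF q1] by blast
  interpret S: Submetric "carr (RM 1)" "\<lambda>f g. nrm (RM 1) (\<lambda>x. f x - g x)" K
    by unfold_locales (rule K1)
  define Z where "Z = subtopology (norm_topology (RM 1)) K"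
  have Z: "Z = S.sub.mtopology" unfolding Z_def norm_topology_def by (rule S.mtopology_submetric[symmetric])
  have "continuous_map Z (weak_topology (RM q)) (\<lambda>f. f)"
  proof (rule continuous_map_weak_topologyI)
    show "(\<lambda>f. f) ` topspace Z \<subseteq> carr (RM q)" using KC by (auto simp: Z)
    fix \<phi> assume \<phi>: "\<phi> \<in> dual_space (RM q)"
    show "continuous_map Z euclidean (\<lambda>f. \<phi> f)"
      unfolding Z mtopology_is_euclidean[symmetric] S.sub.metric_continuous_map[OF Met_TC.Metric_space_axioms]
    proof (intro conjI ballI allI impI)
      fix f and e :: real assume f: "f \<in> K" and e: "e > 0"
      have "0 \<le> C + C" using KC[OF f] Q.nrm_nonneg[of f] by simp
      then obtain \<delta> where \<delta>: "\<delta> > 0" "\<And>h. h \<in> carr (RM q) \<Longrightarrow> nrm (RM q) h \<le> C + C \<Longrightarrow> nrm (RM 1) h < \<delta> \<Longrightarrow> norm (\<phi> h) < e"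
        using RM_dual_small[OF q \<phi> e] by blast
      show "\<exists>\<delta>>0. \<forall>x. x \<in> K \<and> nrm (RM 1) (\<lambda>z. f z - x z) < \<delta> \<longrightarrow> dist (\<phi> f) (\<phi> x) < e"
      proof (intro exI[of _ \<delta>] conjI allI impI)
        fix x assume "x \<in> K \<and> nrm (RM 1) (\<lambda>z. f z - x z) < \<delta>"
        hence x: "x \<in> K" "nrm (RM 1) (\<lambda>z. f z - x z) < \<delta>" by auto
        note fx = conjunct1[OF KC[OF f]] conjunct1[OF KC[OF x(1)]]
        have "norm (\<phi> (\<lambda>z. f z - x z)) < e"
        proof (rule \<delta>(2)[OF RM_diff(1)[OF q1 fx] _ x(2)])
          show "nrm (RM q) (\<lambda>z. f z - x z) \<le> C + C"
            using RM_diff(2)[OF q1 fx] KC[OF f] KC[OF x(1)] by linarith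
        qed
        thus "dist (\<phi> f) (\<phi> x) < e" using Q.dual_diff[OF \<phi> fx] by (simp add: dist_norm)
      qed (rule \<delta>(1))
    qed auto
  qed
  moreover have "compactin Z K" unfolding Z_def using K by (simp add: compactin_subtopology)
  ultimately have "compactin (weak_topology (RM q)) ((\<lambda>f. f) ` K)" by (rule image_compactin[rotated])
  thus ?thesis by simp
qed

text \<open>The same \<open>M\<close> and \<open>J\<close> serve: on \<open>M\<close> the
  \<open>RM q\<close> norm of \<open>f\<close> is controlled by the \<open>RM 1\<close> norm of
  \<open>T f\<close>, which is at most its \<open>RM q\<close> norm. The absolute value of
  \<open>C\<close> is taken because its sign is unknown.\<close>

lemma fixes_copy_RM1_imp:
  assumes q: "1 \<le> q" and T: "bounded_operator (RM q) (RM q) T" and fix1: "fixes_copy (RM q) (RM 1) E T"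
  shows "fixes_copy (RM q) (RM q) E T"
proof -
  interpret normed_fspace "RM q" by (rule normed_fspace_RM[OF q])
  obtain M J where M: "closed_subspace (RM q) M" and J: "isomorphism E ((RM q)\<lparr>carr := M\<rparr>) J"
    and iso: "isomorphism ((RM q)\<lparr>carr := M\<rparr>) ((RM 1)\<lparr>carr := T ` M\<rparr>) T"
    using fix1 unfolding fixes_copy_def by blast
  have MX: "M \<subseteq> carr (RM q)"
    using M closedin_subset[of "norm_topology (RM q)" M] topspace_norm_topology
    unfolding closed_subspace_def by blast
  have TM: "T f \<in> carr (RM q)" if "f \<in> M" for f using T MX that by (auto simp: bounded_operator_def)
  obtain C where C: "\<And>f. f \<in> M \<Longrightarrow> nrm (RM q) f \<le> C * nrm (RM 1) (T f)"
    using isomorphism_bounded_below[OF iso] by auto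
  have "isomorphism ((RM q)\<lparr>carr := M\<rparr>) ((RM q)\<lparr>carr := T ` M\<rparr>) T"
  proof (rule isomorphismI)
    obtain K where K: "\<forall>f\<in>carr (RM q). nrm (RM q) (T f) \<le> K * nrm (RM q) f"
      using T unfolding bounded_operator_def by blast
    show "bounded_operator ((RM q)\<lparr>carr := M\<rparr>) ((RM q)\<lparr>carr := T ` M\<rparr>) T"
      using T MX K unfolding bounded_operator_def by (auto simp: subset_iff intro!: exI[of _ K])
    show "(\<lambda>x. a * f x + b * g x) \<in> carr ((RM q)\<lparr>carr := M\<rparr>)"
      if "f \<in> carr ((RM q)\<lparr>carr := M\<rparr>)" "g \<in> carr ((RM q)\<lparr>carr := M\<rparr>)" for f g a b
      using that M by (simp add: closed_subspace_def)
    show "nrm ((RM q)\<lparr>carr := M\<rparr>) f \<le> \<bar>C\<bar> * nrm ((RM q)\<lparr>carr := T ` M\<rparr>) (T f)"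
      if "f \<in> carr ((RM q)\<lparr>carr := M\<rparr>)" for f
    proof -
      have f: "f \<in> M" using that by simp
      have "C * nrm (RM 1) (T f) \<le> \<bar>C\<bar> * nrm (RM q) (T f)"
        using nrm_RM_nonneg by (intro mult_mono RM_subset_RM1(2)[OF q TM[OF f]]) auto
      thus ?thesis using C[OF f] by simp
    qed
    show "inj_on T (carr ((RM q)\<lparr>carr := M\<rparr>))" using iso by (simp add: isomorphism_def bij_betw_def)
  qed simp
  thus ?thesis using M J T unfolding fixes_copy_def by blast
qed

theorem proposition6p5:
  fixes q :: real and g :: "complex \<Rightarrow> complex"
  assumes "1 < q" and "g \<in> Bloch"
  shows "(weakly_compact_operator (RM q) (RM q) (T_op g) \<longleftrightarrow>
            compact_operator (RM q) (RM 1) (T_op g)) \<and>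
         (compact_operator (RM q) (RM 1) (T_op g) \<longleftrightarrow>
            weakly_compact_operator (RM q) (RM 1) (T_op g)) \<and>
         (weakly_compact_operator (RM q) (RM 1) (T_op g) \<longleftrightarrow>
            \<not> fixes_copy (RM q) (RM 1) ell1 (T_op g)) \<and>
         (\<not> fixes_copy (RM q) (RM 1) ell1 (T_op g) \<longleftrightarrow>
            \<not> fixes_copy (RM q) (RM q) ell1 (T_op g))"
proof -
  have q: "1 \<le> q" using assms(1) by simp
  note g = assms(2)
  interpret Q: normed_fspace "RM q" by (rule normed_fspace_RM[OF q])
  interpret R: normed_fspace "RM 1" by (rule normed_fspace_RM) simp
  note bd = bounded_operator_T_op[OF g q]
  \<comment> \<open>The implications close up as follows: (4) gives (1) and (2); (2) gives (3),
    which gives (4); (1) gives (5), which gives (4).\<close>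
  have "weakly_compact_operator (RM q) (RM q) (T_op g)" "compact_operator (RM q) (RM 1) (T_op g)"
    if not_fix: "\<not> fixes_copy (RM q) (RM 1) ell1 (T_op g)"
  proof -
    have comp: "compactin (norm_topology (RM 1)) (T_op g ` unit_ball (RM q))"
      by (rule compactin_image_unit_ball[OF g q]) (use fixes_copy_ell1_of_not_tendsto[OF g q] not_fix in blast)
    have "Hausdorff_space (norm_topology (RM 1))"
      unfolding norm_topology_def by (rule Metric_space.Hausdorff_space_mtopology[OF R.Metric_space_nrm])
    thus "compact_operator (RM q) (RM 1) (T_op g)"
      unfolding compact_operator_def using bd(2) compactin_closure_of_subset[OF _ comp] by blast
    obtain K where K: "\<And>f. f \<in> carr (RM q) \<Longrightarrow> nrm (RM q) (T_op g f) \<le> K * nrm (RM q) f"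
      using bd(1) unfolding bounded_operator_def by blast
    have "compactin (weak_topology (RM q)) (T_op g ` unit_ball (RM q))"
    proof (rule compactin_RM1_imp_weakly[OF assms(1) comp, of "\<bar>K\<bar>"])
      fix h assume "h \<in> T_op g ` unit_ball (RM q)"
      then obtain f where f: "f \<in> carr (RM q)" "nrm (RM q) f \<le> 1" "h = T_op g f" by (auto simp: unit_ball_def)
      have "K * nrm (RM q) f \<le> \<bar>K\<bar> * 1" using f(2) nrm_RM_nonneg by (intro mult_mono) auto
      thus "h \<in> carr (RM q) \<and> nrm (RM q) h \<le> \<bar>K\<bar>"
        using K[OF f(1)] bd(1) f by (auto simp: bounded_operator_def)
    qed
    thus "weakly_compact_operator (RM q) (RM q) (T_op g)"
      unfolding weakly_compact_operator_def using bd(1) compactin_closure_of_subset[OF Q.Hausdorff_weak_topology] by blast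
  qed
  moreover have "weakly_compact_operator (RM q) (RM 1) (T_op g)" if "compact_operator (RM q) (RM 1) (T_op g)"
    using that R.normed_fspace_axioms by (rule compact_imp_weakly_compact_operator[rotated])
  moreover have "\<not> fixes_copy (RM q) (RM 1) ell1 (T_op g)" if "weakly_compact_operator (RM q) (RM 1) (T_op g)"
    using weakly_compact_imp_not_fixes_ell1[OF Q.normed_fspace_axioms R.normed_fspace_axioms that] .
  moreover have "\<not> fixes_copy (RM q) (RM q) ell1 (T_op g)" if "weakly_compact_operator (RM q) (RM q) (T_op g)"
    using weakly_compact_imp_not_fixes_ell1[OF Q.normed_fspace_axioms Q.normed_fspace_axioms that] .
  moreover have "fixes_copy (RM q) (RM q) ell1 (T_op g)" if "fixes_copy (RM q) (RM 1) ell1 (T_op g)"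
    by (rule fixes_copy_RM1_imp[OF q bd(1) that])
  ultimately show ?thesis by blast
qed

end
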